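(* Let $A_0\in\mathfrak{gl}_n(\mathbb{R})$ and let $\mu_{A(t)}$ be the bracket flow solution starting at $\mu_{A_0}$. If $A(t)\to A_\infty$ as $t\to\infty$, then $A_\infty$ is a skew-symmetric matrix, and for any sequence $t_k\to\infty$ there exists a subsequence of $(G_{\mu_{A(t_k)}},g_{\mu_{A(t_k)}})$ which converges in the pointed topology to a manifold locally isometric to $(G_{\mu_{A_\infty}},g_{\mu_{A_\infty}})$, which is flat.
   Context: Let $n\ge1$ and equip $\mathbb{R}^{n+1}=\mathbb{R}e_0\oplus\mathbb{R}^n$ with the canonical inner product $\langle\cdot,\cdot\rangle$ and canonical basis $e_0,e_1,\dots,e_n$. For $A\in\mathfrak{gl}_n(\mathbb{R})$, $\mu_A$ is the Lie bracket on $\mathbb{R}^{n+1}$ given by $\mu_A(e_0,e_i)=Ae_i$ and $\mu_A(e_i,e_j)=0$ for $i,j\ge1$, where $A$ acts on $\mathbb{R}^n=\langle e_1,\dots,e_n\rangle$. $G_{\mu_A}$ is the simply connected Lie group with Lie algebra $(\mathbb{R}^{n+1},\mu_A)$ and $g_{\mu_A}$ is the left-invariant Riemannian metric on it equal to $\langle\cdot,\cdot\rangle$ at the identity. The bracket flow starting at $\mu_{A_0}$ is $\mu_{A(t)}$, where $A(t)$ is the solution (defined for all $t\ge0$) of $$\tfrac{d}{dt}A=-\operatorname{tr}(S(A)^2)A+\tfrac12[A,[A,A^t]]-\tfrac12\operatorname{tr}(A)[A,A^t],\quad A(0)=A_0,\qquad S(A)=\tfrac12(A+A^t).$$ Pointed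 topology: pointed (Cheeger–Gromov) smooth convergence of Riemannian manifolds. For Lie groups the base points are the identity elements. $(M_k,g_k,p_k)\to(M,g,p)$ means there are open sets $\Omega_k\ni p$ exhausting $M$ and embeddings $\phi_k:\Omega_k\to M_k$ with $\phi_k(p)=p_k$ and $\phi_k^*g_k\to g$ smoothly, uniformly on compact sets. *)

theory Defs
  imports "HOL-Analysis.Analysis" "HOL-Algebra.Group"
begin

section \<open>Smooth functions between Euclidean spaces\<close>

text \<open>\<open>dderivs [v\<^sub>1, \<dots>, v\<^sub>m] f\<close> is the iterated directional derivative
  \<open>\<partial>\<^bsub>v\<^sub>1\<^esub> \<dots> \<partial>\<^bsub>v\<^sub>m\<^esub> f\<close>.\<close>

primrec dderivs ::
  "'a::euclidean_space list \<Rightarrow> ('a \<Rightarrow> 'b::real_normed_vector) \<Rightarrow> 'a \<Rightarrow> 'b" where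
  "dderivs [] f = f"
| "dderivs (v # vs) f = (\<lambda>x. frechet_derivative (dderivs vs f) (at x) v)"

text \<open>\<open>C\<^sup>\<infinity>\<close>; only meant for open \<open>U\<close>.\<close>

definition smooth_on :: "('a::euclidean_space \<Rightarrow> 'b::real_normed_vector) \<Rightarrow> 'a set \<Rightarrow> bool" where
  "smooth_on f U \<longleftrightarrow> (\<forall>vs. dderivs vs f differentiable_on U)"


section \<open>Smooth manifolds and smooth maps\<close>

text \<open>A chart is a pair of its domain and its coordinate map, with values in the model space
  \<open>'e\<close>; the dimension of the manifold is \<open>DIM('e)\<close>. The atlas need not be maximal.\<close>

type_synonym ('m, 'e) chart = "'m set \<times> ('m \<Rightarrow> 'e)"

record ('m, 'e) mfd =
  mtop :: "'m topology"
  atlas :: "('m, 'e) chart set"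

definition charts_at :: "('m, 'e::euclidean_space) mfd \<Rightarrow> 'm \<Rightarrow> ('m, 'e) chart set" where
  "charts_at M p = {c \<in> atlas M. p \<in> fst c}"

abbreviation chart_inv :: "('m, 'e) chart \<Rightarrow> 'e \<Rightarrow> 'm" where
  "chart_inv c \<equiv> inv_into (fst c) (snd c)"

definition is_chart :: "'m topology \<Rightarrow> ('m, 'e::euclidean_space) chart \<Rightarrow> bool" where
  "is_chart X c \<longleftrightarrow> openin X (fst c) \<and> open (snd c ` fst c) \<and>
     homeomorphic_map (subtopology X (fst c)) (top_of_set (snd c ` fst c)) (snd c)"

definition smooth_manifold :: "('m, 'e::euclidean_space) mfd \<Rightarrow> bool" where
  "smooth_manifold M \<longleftrightarrow>
     Hausdorff_space (mtop M) \<and> second_countable (mtop M) \<and>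
     (\<forall>c\<in>atlas M. is_chart (mtop M) c) \<and>
     (\<Union>c\<in>atlas M. fst c) = topspace (mtop M) \<and>
     (\<forall>c\<in>atlas M. \<forall>d\<in>atlas M. smooth_on (snd d \<circ> chart_inv c) (snd c ` (fst c \<inter> fst d)))"

definition product_mfd ::
  "('m, 'e::euclidean_space) mfd \<Rightarrow> ('n, 'f::euclidean_space) mfd \<Rightarrow> ('m \<times> 'n, 'e \<times> 'f) mfd" where
  "product_mfd M N =
     \<lparr>mtop = prod_topology (mtop M) (mtop N),
      atlas = {(fst c \<times> fst d, map_prod (snd c) (snd d)) |c d. c \<in> atlas M \<and> d \<in> atlas N}\<rparr>"

definition smooth_map ::
  "('m, 'e::euclidean_space) mfd \<Rightarrow> 'm set \<Rightarrow> ('n, 'f::euclidean_space) mfd \<Rightarrow> ('m \<Rightarrow> 'n) \<Rightarrow> bool" where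
  "smooth_map M W N f \<longleftrightarrow> openin (mtop M) W \<and>
     continuous_map (subtopology (mtop M) W) (mtop N) f \<and>
     (\<forall>c\<in>atlas M. \<forall>d\<in>atlas N.
        smooth_on (snd d \<circ> f \<circ> chart_inv c) (snd c ` {p \<in> fst c \<inter> W. f p \<in> fst d}))"

text \<open>A tangent vector at \<open>p\<close> is represented by its coordinates in each chart around \<open>p\<close>.
  \<open>differential c d f p\<close> is the differential of \<open>f\<close> at \<open>p\<close> with respect to the chart \<open>c\<close>
  around \<open>p\<close> and the chart \<open>d\<close> around \<open>f p\<close>. For \<open>f = id\<close> it is the change of
  coordinates of tangent vectors from \<open>c\<close> to \<open>d\<close>.\<close>

definition differential ::
  "('m, 'e::euclidean_space) chart \<Rightarrow> ('n, 'f::euclidean_space) chart \<Rightarrow> ('m \<Rightarrow> 'n) \<Rightarrow> 'm \<Rightarrow> 'e \<Rightarrow> 'f" where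
  "differential c d f p = frechet_derivative (snd d \<circ> f \<circ> chart_inv c) (at (snd c p))"

definition smooth_embedding ::
  "('m, 'e::euclidean_space) mfd \<Rightarrow> 'm set \<Rightarrow> ('n, 'f::euclidean_space) mfd \<Rightarrow> ('m \<Rightarrow> 'n) \<Rightarrow> bool" where
  "smooth_embedding M W N f \<longleftrightarrow> smooth_map M W N f \<and>
     (\<forall>p\<in>W. \<forall>c\<in>charts_at M p. \<forall>d\<in>charts_at N (f p). inj (differential c d f p)) \<and>
     embedding_map (subtopology (mtop M) W) (mtop N) f"


section \<open>Riemannian manifolds\<close>

text \<open>\<open>g c p v w\<close> is the inner product of the tangent vectors at \<open>p\<close> which have the
  coordinates \<open>v\<close>, \<open>w\<close> in the chart \<open>c\<close>.\<close>

type_synonym ('m, 'e) metric = "('m, 'e) chart \<Rightarrow> 'm \<Rightarrow> 'e \<Rightarrow> 'e \<Rightarrow> real"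

definition riemannian_metric ::
  "('m, 'e::euclidean_space) mfd \<Rightarrow> ('m, 'e) metric \<Rightarrow> bool" where
  "riemannian_metric M g \<longleftrightarrow>
     (\<forall>p\<in>topspace (mtop M). \<forall>c\<in>charts_at M p.
        bilinear (g c p) \<and> (\<forall>v w. g c p v w = g c p w v) \<and> (\<forall>v. v \<noteq> 0 \<longrightarrow> 0 < g c p v v) \<and>
        (\<forall>d\<in>charts_at M p. \<forall>v w.
           g c p v w = g d p (differential c d id p v) (differential c d id p w))) \<and>
     (\<forall>c\<in>atlas M. \<forall>v w. smooth_on (\<lambda>x. g c (chart_inv c x) v w) (snd c ` fst c))"

text \<open>As usual in the context of pointed convergence, Riemannian manifolds are connected.\<close>

definition riemannian_manifold ::
  "('m, 'e::euclidean_space) mfd \<Rightarrow> ('m, 'e) metric \<Rightarrow> bool" where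
  "riemannian_manifold M g \<longleftrightarrow>
     smooth_manifold M \<and> connected_space (mtop M) \<and> riemannian_metric M g"

text \<open>The choice of the chart \<open>d\<close> is irrelevant, because \<open>h\<close> is compatible with changes of
  coordinates.\<close>

definition pullback ::
  "('m \<Rightarrow> 'n) \<Rightarrow> ('n, 'f::euclidean_space) mfd \<Rightarrow> ('n, 'f) metric \<Rightarrow> ('m, 'e::euclidean_space) metric" where
  "pullback f N h = (\<lambda>c p v w. let d = (SOME d. d \<in> charts_at N (f p)) in
     h d (f p) (differential c d f p v) (differential c d f p w))"

definition isometry_onto_open ::
  "('m, 'e::euclidean_space) mfd \<Rightarrow> ('m, 'e) metric \<Rightarrow> 'm set \<Rightarrow>
   ('n, 'e) mfd \<Rightarrow> ('n, 'e) metric \<Rightarrow> ('m \<Rightarrow> 'n) \<Rightarrow> bool" where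
  "isometry_onto_open M g W N h f \<longleftrightarrow>
     smooth_embedding M W N f \<and> openin (mtop N) (f ` W) \<and>
     (\<forall>p\<in>W. \<forall>c\<in>charts_at M p. \<forall>v w. pullback f N h c p v w = g c p v w)"

definition locally_isometric ::
  "('m, 'e::euclidean_space) mfd \<Rightarrow> ('m, 'e) metric \<Rightarrow> ('n, 'e) mfd \<Rightarrow> ('n, 'e) metric \<Rightarrow> bool" where
  "locally_isometric M g N h \<longleftrightarrow>
     (\<forall>p\<in>topspace (mtop M). \<exists>W f. p \<in> W \<and> isometry_onto_open M g W N h f)"

definition euclidean_mfd :: "('e, 'e::euclidean_space) mfd" where
  "euclidean_mfd = \<lparr>mtop = euclidean, atlas = {(UNIV, id)}\<rparr>"

definition std_metric :: "('e, 'e::euclidean_space) metric" where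
  "std_metric = (\<lambda>c p v w. v \<bullet> w)"

definition flat :: "('m, 'e::euclidean_space) mfd \<Rightarrow> ('m, 'e) metric \<Rightarrow> bool" where
  "flat M g \<longleftrightarrow> locally_isometric M g (euclidean_mfd :: ('e, 'e) mfd) std_metric"


section \<open>Pointed convergence\<close>

definition exhausting :: "'m topology \<Rightarrow> (nat \<Rightarrow> 'm set) \<Rightarrow> bool" where
  "exhausting X \<Omega> \<longleftrightarrow>
     (\<forall>k. openin X (\<Omega> k)) \<and> (\<forall>K. compactin X K \<longrightarrow> (\<forall>\<^sub>F k in sequentially. K \<subseteq> \<Omega> k))"

text \<open>\<open>C\<^sup>\<infinity>\<close> convergence, uniform on compact sets: in each chart all partial derivatives (of
  every order, including order zero) of the coefficients of the metrics converge uniformly on compact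
  sets. The metric \<open>h k\<close> may be meaningful only on the \<open>k\<close>-th set of an exhaustion.\<close>

definition metrics_converge ::
  "('m, 'e::euclidean_space) mfd \<Rightarrow> (nat \<Rightarrow> ('m, 'e) metric) \<Rightarrow> ('m, 'e) metric \<Rightarrow> bool" where
  "metrics_converge M h g \<longleftrightarrow>
     (\<forall>c\<in>atlas M. \<forall>K. compact K \<and> K \<subseteq> snd c ` fst c \<longrightarrow> (\<forall>v w vs.
        uniform_limit K (\<lambda>k. dderivs vs (\<lambda>x. h k c (chart_inv c x) v w))
          (dderivs vs (\<lambda>x. g c (chart_inv c x) v w)) sequentially))"

definition pointed_converges ::
  "(nat \<Rightarrow> ('n, 'e::euclidean_space) mfd) \<Rightarrow> (nat \<Rightarrow> ('n, 'e) metric) \<Rightarrow> (nat \<Rightarrow> 'n) \<Rightarrow>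
   ('m, 'e) mfd \<Rightarrow> ('m, 'e) metric \<Rightarrow> 'm \<Rightarrow> bool" where
  "pointed_converges N h q M g p \<longleftrightarrow> p \<in> topspace (mtop M) \<and>
     (\<exists>\<Omega> \<phi>. exhausting (mtop M) \<Omega> \<and>
        (\<forall>k. p \<in> \<Omega> k \<and> smooth_embedding M (\<Omega> k) (N k) (\<phi> k) \<and> \<phi> k p = q k) \<and>
        metrics_converge M (\<lambda>k. pullback (\<phi> k) (N k) (h k)) g)"


section \<open>Lie groups\<close>

definition simply_connected_space :: "'m topology \<Rightarrow> bool" where
  "simply_connected_space X \<longleftrightarrow> path_connected_space X \<and>
     (\<forall>\<gamma>. pathin X \<gamma> \<and> \<gamma> 0 = \<gamma> 1 \<longrightarrow>
        homotopic_with (\<lambda>\<delta>. \<delta> 0 = \<gamma> 0 \<and> \<delta> 1 = \<gamma> 0) (top_of_set {0..1}) X \<gamma> (\<lambda>t. \<gamma> 0))"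

record ('m, 'e) lie_group = "'m monoid" +
  lmfd :: "('m, 'e) mfd"

definition is_lie_group :: "('m, 'e::euclidean_space) lie_group \<Rightarrow> bool" where
  "is_lie_group G \<longleftrightarrow> group G \<and> smooth_manifold (lmfd G) \<and> carrier G = topspace (mtop (lmfd G)) \<and>
     smooth_map (product_mfd (lmfd G) (lmfd G)) (carrier G \<times> carrier G) (lmfd G)
       (\<lambda>(a, b). a \<otimes>\<^bsub>G\<^esub> b) \<and>
     smooth_map (lmfd G) (carrier G) (lmfd G) (\<lambda>a. inv\<^bsub>G\<^esub> a)"

text \<open>\<open>X c p\<close> are the coordinates in the chart \<open>c\<close> of the value of the vector field \<open>X\<close> at
  \<open>p\<close>.\<close>

type_synonym ('m, 'e) vfield = "('m, 'e) chart \<Rightarrow> 'm \<Rightarrow> 'e"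

definition smooth_vfield ::
  "('m, 'e::euclidean_space) mfd \<Rightarrow> ('m, 'e) vfield \<Rightarrow> bool" where
  "smooth_vfield M X \<longleftrightarrow>
     (\<forall>p\<in>topspace (mtop M). \<forall>c\<in>charts_at M p. \<forall>d\<in>charts_at M p.
        X d p = differential c d id p (X c p)) \<and>
     (\<forall>c\<in>atlas M. smooth_on (\<lambda>x. X c (chart_inv c x)) (snd c ` fst c))"

definition vfield_bracket ::
  "('m, 'e::euclidean_space) vfield \<Rightarrow> ('m, 'e) vfield \<Rightarrow> ('m, 'e) vfield" where
  "vfield_bracket X Y = (\<lambda>c p.
     frechet_derivative (\<lambda>x. Y c (chart_inv c x)) (at (snd c p)) (X c p) -
     frechet_derivative (\<lambda>x. X c (chart_inv c x)) (at (snd c p)) (Y c p))"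

definition left_invariant_vfield ::
  "('m, 'e::euclidean_space) lie_group \<Rightarrow> ('m, 'e) vfield \<Rightarrow> bool" where
  "left_invariant_vfield G X \<longleftrightarrow> smooth_vfield (lmfd G) X \<and>
     (\<forall>a\<in>carrier G. \<forall>p\<in>carrier G. \<forall>c\<in>charts_at (lmfd G) p. \<forall>d\<in>charts_at (lmfd G) (a \<otimes>\<^bsub>G\<^esub> p).
        X d (a \<otimes>\<^bsub>G\<^esub> p) = differential c d (\<lambda>b. a \<otimes>\<^bsub>G\<^esub> b) p (X c p))"

definition left_invariant_metric ::
  "('m, 'e::euclidean_space) lie_group \<Rightarrow> ('m, 'e) metric \<Rightarrow> bool" where
  "left_invariant_metric G g \<longleftrightarrow> riemannian_metric (lmfd G) g \<and>
     (\<forall>a\<in>carrier G. \<forall>p\<in>carrier G. \<forall>c\<in>charts_at (lmfd G) p. \<forall>v w.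
        pullback (\<lambda>b. a \<otimes>\<^bsub>G\<^esub> b) (lmfd G) g c p v w = g c p v w)"

text \<open>\<open>\<xi>\<close> is an isomorphism from the Lie algebra \<open>('e, \<mu>)\<close> onto the Lie algebra of \<open>G\<close>,
  i.e. the left-invariant vector fields with the Lie bracket of vector fields. Linearity and
  bijectivity are expressed by evaluation at the identity, which identifies the left-invariant
  vector fields with the tangent space there.\<close>

definition lie_algebra_iso ::
  "('e \<Rightarrow> 'e \<Rightarrow> 'e) \<Rightarrow> ('m, 'e::euclidean_space) lie_group \<Rightarrow> ('e \<Rightarrow> ('m, 'e) vfield) \<Rightarrow> bool" where
  "lie_algebra_iso \<mu> G \<xi> \<longleftrightarrow>
     (\<forall>v. left_invariant_vfield G (\<xi> v)) \<and>
     (\<forall>c\<in>charts_at (lmfd G) \<one>\<^bsub>G\<^esub>. linear (\<lambda>v. \<xi> v c \<one>\<^bsub>G\<^esub>) \<and> bij (\<lambda>v. \<xi> v c \<one>\<^bsub>G\<^esub>)) \<and>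
     (\<forall>v w. \<forall>p\<in>carrier G. \<forall>c\<in>charts_at (lmfd G) p.
        vfield_bracket (\<xi> v) (\<xi> w) c p = \<xi> (\<mu> v w) c p)"

text \<open>\<open>is_G\<^sub>\<mu> \<mu> G g\<close>: up to the identification \<open>\<xi>\<close> of the Lie algebras, \<open>G\<close> is the simply
  connected Lie group with Lie algebra \<open>('e, \<mu>)\<close> and \<open>g\<close> is the left-invariant metric on \<open>G\<close> which
  is the canonical inner product at the identity.\<close>

definition is_G\<^sub>\<mu> ::
  "('e \<Rightarrow> 'e \<Rightarrow> 'e) \<Rightarrow> ('m, 'e::euclidean_space) lie_group \<Rightarrow> ('m, 'e) metric \<Rightarrow> bool" where
  "is_G\<^sub>\<mu> \<mu> G g \<longleftrightarrow>
     is_lie_group G \<and> simply_connected_space (mtop (lmfd G)) \<and> left_invariant_metric G g \<and>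
     (\<exists>\<xi>. lie_algebra_iso \<mu> G \<xi> \<and>
        (\<forall>c\<in>charts_at (lmfd G) \<one>\<^bsub>G\<^esub>. \<forall>v w. g c \<one>\<^bsub>G\<^esub> (\<xi> v c \<one>\<^bsub>G\<^esub>) (\<xi> w c \<one>\<^bsub>G\<^esub>) = v \<bullet> w))"


section \<open>The brackets \<open>\<mu>\<^sub>A\<close> and the bracket flow\<close>

text \<open>\<open>\<real>\<^bsup>n+1\<^esup>\<close> is \<open>\<real> \<times> \<real>\<^sup>n\<close>, with \<open>e\<^sub>0 = (1, 0)\<close> and \<open>e\<^sub>i = (0, axis i 1)\<close>; the inner product of
  the product type is the canonical one. The definition is the skew-symmetric bilinear extension of
  \<open>\<mu>\<^sub>A(e\<^sub>0, e\<^sub>i) = A e\<^sub>i\<close>, \<open>\<mu>\<^sub>A(e\<^sub>i, e\<^sub>j) = 0\<close>.\<close>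

definition mu ::
  "real^'n^'n \<Rightarrow> real \<times> (real^'n) \<Rightarrow> real \<times> (real^'n) \<Rightarrow> real \<times> (real^'n)" where
  "mu A v w = (0, fst v *\<^sub>R (A *v snd w) - fst w *\<^sub>R (A *v snd v))"

definition commutator :: "real^'n^'n \<Rightarrow> real^'n^'n \<Rightarrow> real^'n^'n" where
  "commutator A B = A ** B - B ** A"

definition sym_part :: "real^'n^'n \<Rightarrow> real^'n^'n" where
  "sym_part A = (1/2) *\<^sub>R (A + transpose A)"

text \<open>The values of \<open>A\<close> at negative times are irrelevant.\<close>

definition bracket_flow :: "real^'n^'n \<Rightarrow> (real \<Rightarrow> real^'n^'n) \<Rightarrow> bool" where
  "bracket_flow A\<^sub>0 A \<longleftrightarrow> A 0 = A\<^sub>0 \<and>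
     (\<forall>t\<ge>0. (A has_vector_derivative
        - trace (sym_part (A t) ** sym_part (A t)) *\<^sub>R A t
        + (1/2) *\<^sub>R commutator (A t) (commutator (A t) (transpose (A t)))
        - (1/2 * trace (A t)) *\<^sub>R commutator (A t) (transpose (A t))) (at t within {0..}))"

end

theory Submission
  imports Defs
begin

text \<open>The bracket flow enters only through its limit. A limit \<open>A\<^sub>\<infinity>\<close> of a solution of an autonomous
  equation is a zero of the vector field, and pairing the vector field with \<open>A\<close> gives
  \<open>- tr(S(A)\<^sup>2) |A|\<^sup>2 - |[A, A\<^sup>t]|\<^sup>2 / 2\<close>, so that \<open>A\<^sub>\<infinity>\<close> is skew-symmetric
  (\<open>bracket_flow_limit_skew\<close>).

  The geometry rests on an explicit model of \<open>G\<^sub>\<mu>\<close> for \<open>\<mu> = \<mu>\<^sub>A\<close>: it is \<open>\<real> \<times> \<real>\<^sup>n\<close> with the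
  multiplication \<open>(s, x)(t, y) = (s + t, x + e\<^bsup>sA\<^esup>y)\<close>, and the left-invariant metric is
  \<open>dt\<^sup>2 + |e\<^bsup>-tA\<^esup>dx|\<^sup>2\<close> (\<open>is_G\<^sub>\<mu>_coordinates\<close>). Two features of this formula give the theorem.
  First, all its derivatives depend continuously on \<open>A\<close>, uniformly on compact sets
  (\<open>model_metric_uniform_limit\<close>). The global coordinates identify all the groups with one
  manifold, and there the whole sequence of metrics converges, with \<open>G\<^sub>\<mu>\<close> for \<open>\<mu> = \<mu>\<^bsub>A\<^sub>\<infinity>\<^esub>\<close>
  as its limit. Second, \<open>e\<^bsup>-tA\<^esup>\<close> is orthogonal if \<open>A\<close> is skew-symmetric, so that the limit is
  Euclidean space (\<open>model_metric_skew\<close>).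

  What remains is to find these coordinates on an abstract simply connected Lie group with Lie algebra
  \<open>\<mu>\<^sub>A\<close>. Let \<open>\<theta> = (\<theta>\<^sup>0, \<theta>')\<close> be the coframe dual to the left-invariant frame. The
  Maurer-Cartan equation reads \<open>d\<theta>\<^sup>0 = 0\<close>, \<open>d\<theta>' = - \<theta>\<^sup>0 \<and> A\<theta>'\<close>. So near the identity
  \<open>\<theta>\<^sup>0 = d\<tau>\<close> for a function \<open>\<tau>\<close>, then \<open>e\<^bsup>\<tau>A\<^esup>\<theta>'\<close> is closed and equals \<open>d\<chi>\<close>, and \<open>(\<tau>, \<chi>)\<close> carries
  the frame to the one of the model (\<open>adapted_coordinates\<close>). Two maps with this property differ
  by a left translation of the model, hence \<open>(\<tau>, \<chi>)\<close> and its local inverse are local homomorphisms. A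
  local homomorphism on a simply connected group extends to a homomorphism: multiply its values
  along the steps of a fine subdivision of a path (\<open>local_hom.extension\<close>). The two
  extensions are inverse to each other, because they are near the identity
  (\<open>G_mu.global_isomorphism\<close>). This use of the Poincare lemma replaces the exponential map, so
  that no differential equation has to be solved. All maps in sight are smooth because their
  derivatives are expressed by the maps themselves (\<open>smooth_on_bootstrap\<close>).\<close>

section \<open>Calculus of smooth functions\<close>

text \<open>The recursion differentiates first in the innermost direction, whereas \<open>dderivs\<close> adds
  derivatives on the outside. Only in the former order does the product or the chain rule produce functions to
  which an induction hypothesis applies.\<close>

primrec Ck :: "nat \<Rightarrow> ('a::euclidean_space \<Rightarrow> 'b::real_normed_vector) \<Rightarrow> 'a set \<Rightarrow> bool" where
  "Ck 0 f U \<longleftrightarrow> continuous_on U f"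
| "Ck (Suc k) f U \<longleftrightarrow> f differentiable_on U \<and> (\<forall>v. Ck k (\<lambda>x. frechet_derivative f (at x) v) U)"

lemma dderivs_append: "dderivs (vs @ ws) f = dderivs vs (dderivs ws f)"
  by (induction vs) auto

lemma smooth_on_iff_Ck: "smooth_on f U \<longleftrightarrow> (\<forall>k. Ck k f U)"
proof
  assume "smooth_on f U"
  then show "\<forall>k. Ck k f U"
  proof (intro allI)
    fix k assume "smooth_on f U"
    then show "Ck k f U"
    proof (induction k arbitrary: f)
      case 0
      from 0[unfolded smooth_on_def, rule_format, of "[]"] show ?case
        by (auto intro: differentiable_imp_continuous_on)
    next
      case (Suc k)
      have d: "dderivs vs f differentiable_on U" for vs
        using Suc.prems by (auto simp: smooth_on_def)
      have "smooth_on (\<lambda>x. frechet_derivative f (at x) v) U" for v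
        unfolding smooth_on_def
      proof
        fix vs show "dderivs vs (\<lambda>x. frechet_derivative f (at x) v) differentiable_on U"
          using d[of "vs @ [v]"] by (simp add: dderivs_append)
      qed
      with Suc.IH d[of "[]"] show ?case by auto
    qed
  qed
next
  assume *: "\<forall>k. Ck k f U"
  have "dderivs vs f differentiable_on U" for vs
    using *
  proof (induction vs arbitrary: f rule: rev_induct)
    case Nil
    then have "Ck (Suc 0) f U" by blast
    then show ?case by simp
  next
    case (snoc v vs)
    have "\<forall>k. Ck k (\<lambda>x. frechet_derivative f (at x) v) U"
      using snoc.prems by (metis Ck.simps(2))
    from snoc.IH[OF this] show ?case by (simp add: dderivs_append)
  qed
  then show "smooth_on f U" by (simp add: smooth_on_def)
qed

lemma frechet_derivative_cong_open:
  assumes "open U" "x \<in> U" "\<And>y. y \<in> U \<Longrightarrow> f y = g y"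
  shows "frechet_derivative f (at x) = frechet_derivative g (at x)"
proof -
  have "\<And>D. (f has_derivative D) (at x) \<longleftrightarrow> (g has_derivative D) (at x)"
    using assms by (auto elim!: has_derivative_transform_within_open)
  then show ?thesis by (simp add: frechet_derivative_def)
qed

lemma Ck_cong:
  assumes "open U" "\<And>x. x \<in> U \<Longrightarrow> f x = g x"
  shows "Ck k f U \<longleftrightarrow> Ck k g U"
  using assms(2)
proof (induction k arbitrary: f g)
  case 0 then show ?case by (auto intro: continuous_on_cong)
next
  case (Suc k)
  have "f differentiable_on U \<longleftrightarrow> g differentiable_on U"
    using Suc.prems unfolding differentiable_on_def
    by (auto elim!: differentiable_transform_within[OF _ zero_less_one])
  moreover have "Ck k (\<lambda>x. frechet_derivative f (at x) v) U \<longleftrightarrow>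
     Ck k (\<lambda>x. frechet_derivative g (at x) v) U" for v
    using Suc.prems by (intro Suc.IH) (simp add: frechet_derivative_cong_open[OF assms(1), where f=f and g=g])
  ultimately show ?case by simp
qed

lemma Ck_SucD: "Ck (Suc k) f U \<Longrightarrow> Ck k f U"
proof (induction k arbitrary: f)
  case 0 then show ?case by (auto intro: differentiable_imp_continuous_on)
next
  case (Suc k)
  then show ?case by simp
qed

lemma Ck_SucI:
  assumes "open U" "\<And>x. x \<in> U \<Longrightarrow> (f has_derivative f' x) (at x)"
    and "\<And>v. Ck k (\<lambda>x. f' x v) U"
  shows "Ck (Suc k) f U"
proof -
  have "frechet_derivative f (at x) = f' x" if "x \<in> U" for x
    using assms(2)[OF that] by (metis frechet_derivative_at)
  then have "Ck k (\<lambda>x. frechet_derivative f (at x) v) U" for v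
    using assms(3)[of v] by (subst Ck_cong[OF assms(1), where g = "\<lambda>x. f' x v"]) auto
  moreover have "f differentiable_on U"
    using assms(1,2) by (meson differentiableI differentiable_at_imp_differentiable_on)
  ultimately show ?thesis by simp
qed

lemma Ck_Suc_has_derivative:
  assumes "open U" "Ck (Suc k) f U" "x \<in> U"
  shows "(f has_derivative frechet_derivative f (at x)) (at x)"
  using assms frechet_derivative_works[of f "at x"]
  by (auto simp: differentiable_on_eq_differentiable_at)

lemma Ck_SucE:
  assumes "open U" "Ck (Suc k) f U"
  obtains "\<And>x. x \<in> U \<Longrightarrow> (f has_derivative frechet_derivative f (at x)) (at x)"
    "\<And>v. Ck k (\<lambda>x. frechet_derivative f (at x) v) U"
  using Ck_Suc_has_derivative[OF assms] assms(2) by simp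

lemma Ck_const: "open U \<Longrightarrow> Ck k (\<lambda>x. c) U"
proof (induction k arbitrary: c)
  case (Suc k)
  show ?case by (rule Ck_SucI[where f' = "\<lambda>x v. 0"]) (use Suc in auto)
qed auto

lemma Ck_add:
  assumes "open U" "Ck k f U" "Ck k g U"
  shows "Ck k (\<lambda>x. f x + g x) U"
  using assms(2,3)
proof (induction k arbitrary: f g)
  case 0 then show ?case by (auto intro: continuous_intros)
next
  case (Suc k)
  from Suc.prems show ?case
    by (elim Ck_SucE[OF assms(1)])
      (rule Ck_SucI[OF assms(1)], rule has_derivative_add, auto intro: Suc.IH)
qed

lemma Ck_bilinear:
  assumes "bounded_bilinear h" "open U" "Ck k f U" "Ck k g U"
  shows "Ck k (\<lambda>x. h (f x) (g x)) U"
  using assms(3,4)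
proof (induction k arbitrary: f g)
  case 0
  then show ?case by (simp add: bounded_bilinear.continuous_on[OF assms(1)])
next
  case (Suc k)
  show ?case
  proof (rule Ck_SucI[OF assms(2)])
    fix x assume "x \<in> U"
    with Suc.prems show "((\<lambda>x. h (f x) (g x)) has_derivative (\<lambda>v. h (f x) (frechet_derivative g (at x) v)
       + h (frechet_derivative f (at x) v) (g x))) (at x)"
      by (elim Ck_SucE[OF assms(2)]) (rule bounded_bilinear.FDERIV[OF assms(1)], auto)
  next
    fix v
    show "Ck k (\<lambda>x. h (f x) (frechet_derivative g (at x) v) + h (frechet_derivative f (at x) v) (g x)) U"
      using Suc.prems by (intro Ck_add[OF assms(2)] Suc.IH) (auto intro: Ck_SucD)
  qed
qed

lemma Ck_linear:
  assumes "bounded_linear h" "open U" "Ck k f U"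
  shows "Ck k (\<lambda>x. h (f x)) U"
proof -
  have "bounded_bilinear (\<lambda>(r::real) y. r *\<^sub>R h y)"
    using bounded_bilinear.comp[OF bounded_bilinear_scaleR bounded_linear_ident assms(1)] by simp
  from Ck_bilinear[OF this assms(2) Ck_const[OF assms(2), of k 1] assms(3)] show ?thesis by simp
qed

lemma Ck_minus: "open U \<Longrightarrow> Ck k f U \<Longrightarrow> Ck k (\<lambda>x. - f x) U"
  by (rule Ck_linear[OF bounded_linear_minus[OF bounded_linear_ident]])

lemma Ck_sum:
  assumes "open U" "\<And>i. i \<in> I \<Longrightarrow> Ck k (f i) U"
  shows "Ck k (\<lambda>x. \<Sum>i\<in>I. f i x) U"
  using assms(2) by (induction I rule: infinite_finite_induct)
    (auto intro: Ck_const Ck_add assms(1))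

lemma Ck_ident: "open U \<Longrightarrow> Ck k (\<lambda>x. x) U"
proof (cases k)
  case (Suc m)
  assume "open U" then show ?thesis unfolding Suc
    by (intro Ck_SucI[where f' = "\<lambda>x v. v"]) (auto intro: Ck_const)
qed auto

lemma has_derivative_comp_Basis:
  fixes f :: "'a::euclidean_space \<Rightarrow> 'b::euclidean_space"
  assumes "(f has_derivative f') (at x)" "(g has_derivative g') (at (f x))"
  shows "((\<lambda>x. g (f x)) has_derivative (\<lambda>v. \<Sum>b\<in>Basis. (f' v \<bullet> b) *\<^sub>R g' b)) (at x)"
proof -
  interpret g: bounded_linear g' using assms(2) by (rule has_derivative_bounded_linear)
  have "g' (f' v) = (\<Sum>b\<in>Basis. (f' v \<bullet> b) *\<^sub>R g' b)" for v
    by (subst euclidean_representation[symmetric, of "f' v"]) (simp add: g.sum g.scaleR)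
  then have "(\<lambda>v. \<Sum>b\<in>Basis. (f' v \<bullet> b) *\<^sub>R g' b) = g' \<circ> f'" by auto
  with has_derivative_compose[OF assms] show ?thesis by (simp add: o_def)
qed

lemma Ck_comp:
  fixes f :: "'a::euclidean_space \<Rightarrow> 'b::euclidean_space"
  assumes "open U" "open V" "Ck k f U" "Ck k g V" "f ` U \<subseteq> V"
  shows "Ck k (\<lambda>x. g (f x)) U"
  using assms(3,4)
proof (induction k arbitrary: g)
  case 0
  then show ?case using continuous_on_compose2 assms(5) by auto
next
  case (Suc k)
  from Suc.prems obtain
    f: "\<And>x. x \<in> U \<Longrightarrow> (f has_derivative frechet_derivative f (at x)) (at x)"
      "\<And>v. Ck k (\<lambda>x. frechet_derivative f (at x) v) U"
    and g: "\<And>x. x \<in> V \<Longrightarrow> (g has_derivative frechet_derivative g (at x)) (at x)"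
      "\<And>v. Ck k (\<lambda>x. frechet_derivative g (at x) v) V"
    using Ck_SucE[OF assms(1)] Ck_SucE[OF assms(2)] by metis
  show ?case
  proof (rule Ck_SucI[OF assms(1)])
    fix x assume "x \<in> U"
    then show "((\<lambda>x. g (f x)) has_derivative (\<lambda>v. \<Sum>b\<in>Basis. (frechet_derivative f (at x) v \<bullet> b)
        *\<^sub>R frechet_derivative g (at (f x)) b)) (at x)"
      using assms(5) by (intro has_derivative_comp_Basis f g) auto
  next
    fix v
    show "Ck k (\<lambda>x. \<Sum>b\<in>Basis. (frechet_derivative f (at x) v \<bullet> b)
        *\<^sub>R frechet_derivative g (at (f x)) b) U"
      by (intro Ck_sum assms(1) Ck_bilinear[OF bounded_bilinear_scaleR] Suc.IH g
          Ck_linear[OF bounded_linear_inner_left] f Ck_SucD[OF Suc.prems(1)])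
  qed
qed

lemma Ck_subset: "open V \<Longrightarrow> V \<subseteq> U \<Longrightarrow> open U \<Longrightarrow> Ck k f U \<Longrightarrow> Ck k f V"
  using Ck_comp[of V U k "\<lambda>x. x" f] by (auto intro: Ck_ident)

lemma Ck_Pair:
  assumes "open U" "Ck k f U" "Ck k g U"
  shows "Ck k (\<lambda>x. (f x, g x)) U"
proof -
  have "Ck k (\<lambda>x. (f x, 0) + (0, g x)) U"
    by (intro Ck_add assms Ck_linear[where h="\<lambda>y. (y,0)"] Ck_linear[where h="\<lambda>y. (0,y)"]
      bounded_linear_Pair bounded_linear_ident bounded_linear_zero)
  then show ?thesis by simp
qed

text \<open>A function whose derivative is as regular as the function itself gains one derivative after
  the other. The derivatives of frames, coframes, coordinates and their inverses are all of this
  kind, being expressed by these maps themselves.\<close>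

lemma smooth_on_bootstrap:
  assumes "open U" "\<And>x. x \<in> U \<Longrightarrow> (f has_derivative f' x) (at x)"
    and "\<And>k v. Ck k f U \<Longrightarrow> Ck k (\<lambda>x. f' x v) U"
  shows "smooth_on f U"
proof -
  have "Ck k f U" for k
  proof (induction k)
    case 0
    show ?case using assms(1,2)
      by (auto intro!: continuous_at_imp_continuous_on has_derivative_continuous)
  next
    case (Suc k)
    show ?case by (rule Ck_SucI[OF assms(1,2)]) (auto intro: assms(3) Suc)
  qed
  then show ?thesis by (simp add: smooth_on_iff_Ck)
qed

subsection \<open>Families of linear maps\<close>

text \<open>The sum of \<open>rank_one b (f b)\<close> over the basis turns a linear map into a bounded operator. For a
  family of linear maps, regularity of the values at each vector becomes regularity in the operator norm.\<close>

definition rank_one :: "'a::euclidean_space \<Rightarrow> 'b::real_normed_vector \<Rightarrow> 'a \<Rightarrow>\<^sub>L 'b" where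
  "rank_one b w = blinfun_scaleR_left w o\<^sub>L blinfun_inner_left b"

lemma rank_one_apply [simp]: "rank_one b w v = (v \<bullet> b) *\<^sub>R w"
  by (simp add: rank_one_def inner_commute)

lemma bounded_linear_rank_one: "bounded_linear (rank_one b)"
  unfolding rank_one_def
  by (intro bounded_linear_compose[OF bounded_bilinear.bounded_linear_left[OF bounded_bilinear_blinfun_compose]]
    bounded_linear_blinfun_scaleR_left)

lemma linear_eq_sum_rank_one:
  assumes "linear f"
  shows "f = blinfun_apply (\<Sum>b\<in>Basis. rank_one b (f b))"
proof
  fix v
  show "f v = blinfun_apply (\<Sum>b\<in>Basis. rank_one b (f b)) v"
    by (subst euclidean_representation[of v, symmetric])
      (simp add: blinfun.sum_left linear_sum[OF assms] linear_scale[OF assms] del: euclidean_representation)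
qed

lemma Ck_blinfun:
  assumes "open U" "\<And>v. Ck k (\<lambda>x. f x v) U"
  shows "Ck k (\<lambda>x. \<Sum>b\<in>Basis. rank_one b (f x b)) U"
  by (intro Ck_sum Ck_linear[OF bounded_linear_rank_one] assms)

lemma Ck_blinfun_apply:
  "open U \<Longrightarrow> Ck k f U \<Longrightarrow> Ck k g U \<Longrightarrow> Ck k (\<lambda>x. blinfun_apply (f x) (g x)) U"
  by (rule Ck_bilinear[OF bounded_bilinear_blinfun_apply])

lemma Ck_Suc_blinfun:
  assumes "open U" "Ck (Suc k) f U"
  obtains f' :: "'a::euclidean_space \<Rightarrow> 'a \<Rightarrow>\<^sub>L 'b::real_normed_vector"
  where "\<And>x. x \<in> U \<Longrightarrow> (f has_derivative blinfun_apply (f' x)) (at x)" "Ck k f' U"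
proof
  let ?f' = "\<lambda>x. \<Sum>b\<in>Basis. rank_one b (frechet_derivative f (at x) b)"
  show "Ck k ?f' U" using assms by (intro Ck_blinfun) auto
  fix x assume "x \<in> U"
  with assms have *: "(f has_derivative frechet_derivative f (at x)) (at x)"
    by (metis Ck_SucE)
  with linear_eq_sum_rank_one[OF has_derivative_linear[OF *]]
  show "(f has_derivative blinfun_apply (?f' x)) (at x)" by simp
qed

text \<open>The map \<open>(x, v) \<mapsto> (x, L x v)\<close> has the inverse \<open>(x, w) \<mapsto> (x, T x w)\<close>. The inverse function theorem gives the
  derivative of the latter, hence of each column of \<open>T\<close>.\<close>

lemma has_derivative_inverse_family:
  fixes L T :: "'a::euclidean_space \<Rightarrow> 'e::euclidean_space \<Rightarrow>\<^sub>L 'e"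
  assumes U: "open U" "x \<in> U" and L: "\<And>y. y \<in> U \<Longrightarrow> (L has_derivative L' y) (at y)"
    and inv: "\<And>y. y \<in> U \<Longrightarrow> T y o\<^sub>L L y = id_blinfun" "\<And>y. y \<in> U \<Longrightarrow> L y o\<^sub>L T y = id_blinfun"
  shows "(T has_derivative (\<lambda>u. - (T x o\<^sub>L L' x u o\<^sub>L T x))) (at x)"
proof -
  have TL: "T y (L y v) = v" "L y (T y v) = v" if "y \<in> U" for y v
    using inv[OF that] by (metis blinfun_apply_blinfun_compose blinfun_apply_id_blinfun)+
  define f where "f z = (fst z, L (fst z) (snd z))" for z
  define h where "h z = (fst z, T (fst z) (snd z))" for z
  define f' where "f' z w = (fst w, L (fst z) (snd w) + L' (fst z) (fst w) (snd z))" for z w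
  define h' where "h' z w = (fst w, T (fst z) (snd w - L' (fst z) (fst w) (snd z)))" for z w
  have h: "(h has_derivative h' (x, T x b)) (at (x, b))" for b
  proof -
    have "(h has_derivative h' (x, T x b)) (at (f (x, T x b)))"
    proof (rule has_derivative_inverse_on[where S = "U \<times> UNIV" and f' = f' and g' = h'])
      fix z :: "'a \<times> 'e" assume z: "z \<in> U \<times> UNIV"
      then have "((\<lambda>w. L (fst w)) has_derivative (\<lambda>w. L' (fst z) (fst w))) (at z)"
        by (intro has_derivative_compose[OF has_derivative_fst[OF has_derivative_ident] L]) auto
      from bounded_bilinear.FDERIV[OF bounded_bilinear_blinfun_apply this has_derivative_snd[OF has_derivative_ident]]
      show "(f has_derivative f' z) (at z)"
        unfolding f_def[abs_def] f'_def by (intro has_derivative_Pair has_derivative_fst has_derivative_ident)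
      show "h (f z) = z"
        using z TL by (auto simp: f_def h_def)
    qed (use U TL in \<open>auto intro: open_Times simp: f'_def h'_def fun_eq_iff\<close>)
    then show ?thesis using TL U by (simp add: f_def)
  qed
  have col: "((\<lambda>y. T y b) has_derivative (\<lambda>u. - T x (L' x u (T x b)))) (at x)" for b
    using has_derivative_snd[OF has_derivative_compose[OF has_derivative_Pair[OF has_derivative_ident
      has_derivative_const[of b]] h]] by (simp add: h_def h'_def blinfun.minus_right)
  have "((\<lambda>y. \<Sum>b\<in>Basis. rank_one b (T y b)) has_derivative
      (\<lambda>u. \<Sum>b\<in>Basis. rank_one b (- T x (L' x u (T x b))))) (at x)"
    by (intro has_derivative_sum bounded_linear.has_derivative[OF bounded_linear_rank_one] col)
  moreover have sum: "(\<Sum>b\<in>Basis. rank_one b (S b)) = S" for S :: "'e \<Rightarrow>\<^sub>L 'e"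
    by (intro blinfun_eqI fun_cong[OF linear_eq_sum_rank_one[symmetric]]
        bounded_linear.linear[OF blinfun.bounded_linear_right])
  moreover have "(\<Sum>b\<in>Basis. rank_one b (- T x (L' x u (T x b)))) = - (T x o\<^sub>L L' x u o\<^sub>L T x)" for u
    using sum[of "- (T x o\<^sub>L L' x u o\<^sub>L T x)"] by (simp add: blinfun.minus_left)
  ultimately show ?thesis by simp
qed

lemma smooth_on_inverse_family:
  fixes L T :: "'a::euclidean_space \<Rightarrow> 'e::euclidean_space \<Rightarrow>\<^sub>L 'e"
  assumes U: "open U" and L: "smooth_on L U"
    and inv: "\<And>y. y \<in> U \<Longrightarrow> T y o\<^sub>L L y = id_blinfun" "\<And>y. y \<in> U \<Longrightarrow> L y o\<^sub>L T y = id_blinfun"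
  shows "smooth_on T U"
proof (rule smooth_on_bootstrap[OF U has_derivative_inverse_family[OF U _ _ inv]])
  have "Ck (Suc 0) L U" using L by (simp add: smooth_on_iff_Ck)
  then show "(L has_derivative frechet_derivative L (at y)) (at y)" if "y \<in> U" for y
    using that by (rule Ck_Suc_has_derivative[OF U])
next
  fix k v assume "Ck k T U"
  moreover have "Ck (Suc k) L U" using L by (simp add: smooth_on_iff_Ck)
  then have "Ck k (\<lambda>x. frechet_derivative L (at x) v) U" by simp
  ultimately show "Ck k (\<lambda>x. - (T x o\<^sub>L frechet_derivative L (at x) v o\<^sub>L T x)) U"
    by (intro Ck_minus Ck_bilinear[OF bounded_bilinear_blinfun_compose] U)
qed

subsection \<open>Primitives of closed forms\<close>

text \<open>The primitive is the integral along segments from the base point. By symmetry of \<open>\<omega>'\<close> the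
  derivative of the integrand \<open>\<omega>(\<gamma>(s))(x - x0)\<close> in \<open>x\<close> is the total derivative of
  \<open>s \<omega>(\<gamma>(s))\<close> in \<open>s\<close>, which integrates to \<open>\<omega>(x)\<close>.\<close>

lemma Poincare_lemma:
  fixes \<omega> :: "'a::euclidean_space \<Rightarrow> 'a \<Rightarrow>\<^sub>L 'b::banach"
  assumes U: "open U" "convex U" "x0 \<in> U"
    and d: "\<And>x. x \<in> U \<Longrightarrow> (\<omega> has_derivative blinfun_apply (\<omega>' x)) (at x)"
    and c: "continuous_on U \<omega>'"
    and closed: "\<And>x u v. x \<in> U \<Longrightarrow> \<omega>' x u v = \<omega>' x v u"
  obtains f where "f x0 = 0" "\<And>x. x \<in> U \<Longrightarrow> (f has_derivative blinfun_apply (\<omega> x)) (at x)"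
proof -
  define \<gamma> where "\<gamma> x s = x0 + s *\<^sub>R (x - x0)" for x and s :: real
  define D where "D x s = s *\<^sub>R \<omega>' (\<gamma> x s) (x - x0) + \<omega> (\<gamma> x s)" for x s
  define f where "f x = integral (cbox 0 1) (\<lambda>s. \<omega> (\<gamma> x s) (x - x0))" for x
  have f0: "f x0 = 0" by (simp add: f_def)
  have \<gamma>: "\<gamma> x s \<in> U" if "x \<in> U" "s \<in> cbox 0 1" for x s
  proof -
    have "\<gamma> x s = (1 - s) *\<^sub>R x0 + s *\<^sub>R x" by (simp add: \<gamma>_def algebra_simps)
    with U that show ?thesis by (auto simp: convex_alt)
  qed
  have c\<gamma>: "continuous_on S (\<lambda>(x, s). \<gamma> x s)" for S
    unfolding \<gamma>_def case_prod_beta by (intro continuous_intros)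
  have c\<omega>: "continuous_on U \<omega>"
    using d by (auto intro!: continuous_at_imp_continuous_on has_derivative_continuous)
  have c1: "continuous_on (U \<times> cbox 0 1) (\<lambda>z. \<omega> (\<gamma> (fst z) (snd z)))"
    using c\<gamma>[of "U \<times> cbox 0 1"] \<gamma> by (intro continuous_on_compose2[OF c\<omega>]) (auto simp: case_prod_beta)
  have c2: "continuous_on (U \<times> cbox 0 1) (\<lambda>z. \<omega>' (\<gamma> (fst z) (snd z)))"
    using c\<gamma>[of "U \<times> cbox 0 1"] \<gamma> by (intro continuous_on_compose2[OF c]) (auto simp: case_prod_beta)
  have df: "(f has_derivative blinfun_apply (\<omega> x)) (at x)" if x: "x \<in> U" for x
  proof -
    have "(f has_derivative blinfun_apply (integral (cbox 0 1) (D x))) (at x within U)"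
      unfolding f_def
    proof (rule leibniz_rule[where fx = D])
      show "continuous_on (U \<times> cbox 0 1) (\<lambda>(x, s). D x s)"
        unfolding D_def case_prod_beta by (intro continuous_intros c1 c2)
      fix y assume y: "y \<in> U"
      have "continuous_on (cbox 0 1) (\<lambda>s. \<omega> (\<gamma> y s))"
        using continuous_on_compose2[OF c1, of "cbox 0 1" "\<lambda>s. (y, s)"] y
        by (force intro: continuous_on_Pair continuous_on_const continuous_on_id)
      then show "(\<lambda>s. blinfun_apply (\<omega> (\<gamma> y s)) (y - x0)) integrable_on cbox 0 1"
        by (intro integrable_continuous continuous_intros)
      fix s :: real assume s: "s \<in> cbox 0 1"
      have "((\<lambda>x. \<gamma> x s) has_derivative (\<lambda>u. s *\<^sub>R u)) (at y within U)"
        unfolding \<gamma>_def by (auto intro!: derivative_eq_intros)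
      from has_derivative_compose[OF this d[OF \<gamma>[OF y s]]]
      have "((\<lambda>x. \<omega> (\<gamma> x s)) has_derivative (\<lambda>u. \<omega>' (\<gamma> y s) (s *\<^sub>R u))) (at y within U)" .
      moreover have "((\<lambda>x. x - x0) has_derivative (\<lambda>u. u)) (at y within U)"
        by (rule has_derivative_eq_rhs, rule has_derivative_diff[OF has_derivative_ident has_derivative_const]) simp
      ultimately have "((\<lambda>x. \<omega> (\<gamma> x s) (x - x0)) has_derivative (\<lambda>u. \<omega> (\<gamma> y s) u + \<omega>' (\<gamma> y s) (s *\<^sub>R u) (y - x0))) (at y within U)"
        by (rule bounded_bilinear.FDERIV[OF bounded_bilinear_blinfun_apply])
      moreover have "(\<lambda>u. \<omega> (\<gamma> y s) u + \<omega>' (\<gamma> y s) (s *\<^sub>R u) (y - x0)) = blinfun_apply (D y s)"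
        unfolding D_def using closed[OF \<gamma>[OF y s], of _ "y - x0"]
        by (simp add: blinfun.add_left blinfun.scaleR_left blinfun.scaleR_right add.commute fun_eq_iff)
      ultimately show "((\<lambda>x. \<omega> (\<gamma> x s) (x - x0)) has_derivative blinfun_apply (D y s)) (at y within U)"
        by simp
    qed (use x U in auto)
    moreover have "(D x has_integral (1 *\<^sub>R \<omega> (\<gamma> x 1) - 0 *\<^sub>R \<omega> (\<gamma> x 0))) {0..1}"
    proof (rule fundamental_theorem_of_calculus)
      fix s :: real assume "s \<in> {0..1}"
      then have s: "s \<in> cbox 0 1" by simp
      have "((\<lambda>s. \<gamma> x s) has_derivative (\<lambda>h. h *\<^sub>R (x - x0))) (at s within {0..1})"
        unfolding \<gamma>_def by (auto intro!: derivative_eq_intros)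
      from has_derivative_compose[OF this d[OF \<gamma>[OF x s]]]
      have "((\<lambda>s. s *\<^sub>R \<omega> (\<gamma> x s)) has_derivative (\<lambda>h. s *\<^sub>R \<omega>' (\<gamma> x s) (h *\<^sub>R (x - x0))
          + h *\<^sub>R \<omega> (\<gamma> x s))) (at s within {0..1})"
        by (rule has_derivative_scaleR[OF has_derivative_ident])
      moreover have "s *\<^sub>R \<omega>' (\<gamma> x s) (h *\<^sub>R (x - x0)) + h *\<^sub>R \<omega> (\<gamma> x s) = h *\<^sub>R D x s" for h
        by (simp add: D_def blinfun.scaleR_right scaleR_add_right mult.commute)
      ultimately show "((\<lambda>s. s *\<^sub>R \<omega> (\<gamma> x s)) has_vector_derivative D x s) (at s within {0..1})"
        unfolding has_vector_derivative_def by simp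
    qed simp
    then have "integral (cbox 0 1) (D x) = \<omega> x"
      by (simp add: \<gamma>_def integral_unique)
    ultimately show ?thesis
      by (simp only: at_within_open[OF x U(1)])
  qed
  from f0 df show thesis by (rule that)
qed

text \<open>Here closedness is checked with whatever derivative of \<open>\<omega>\<close> is at hand at each point.\<close>

lemma smooth_closed_form_has_primitive:
  fixes \<omega> :: "'a::euclidean_space \<Rightarrow> 'a \<Rightarrow>\<^sub>L 'c::banach"
  assumes W: "open W" "convex W" "x0 \<in> W" and s: "Ck (Suc 0) \<omega> W"
    and closed: "\<And>x. x \<in> W \<Longrightarrow> \<exists>\<omega>'. (\<omega> has_derivative \<omega>') (at x) \<and> (\<forall>u v. blinfun_apply (\<omega>' u) v = \<omega>' v u)"
  obtains f where "f x0 = 0" "\<And>x. x \<in> W \<Longrightarrow> (f has_derivative blinfun_apply (\<omega> x)) (at x)"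
proof -
  obtain \<omega>' where d: "\<And>x. x \<in> W \<Longrightarrow> (\<omega> has_derivative blinfun_apply (\<omega>' x)) (at x)" "Ck 0 \<omega>' W"
    by (rule Ck_Suc_blinfun[OF W(1) s]) blast
  have sym: "\<omega>' x u v = \<omega>' x v u" if x: "x \<in> W" for x u v
    using closed[OF x] has_derivative_unique[OF d(1)[OF x]] by metis
  have "continuous_on W \<omega>'" using d(2) by simp
  from Poincare_lemma[OF W d(1) this sym] show thesis using that by blast
qed

section \<open>The matrix exponential\<close>

lemma bounded_bilinear_matrix_matrix_mult:
  "bounded_bilinear ((**) :: real^'n^'m \<Rightarrow> real^'p^'n \<Rightarrow> real^'p^'m)"
  unfolding bilinear_conv_bounded_bilinear[symmetric] bilinear_def
  by (auto intro!: linearI simp: vec_eq_iff matrix_matrix_mult_def algebra_simps sum.distrib sum_distrib_left)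

lemma bounded_bilinear_matrix_vector_mult:
  "bounded_bilinear ((*v) :: real^'n^'m \<Rightarrow> real^'n \<Rightarrow> real^'m)"
  unfolding bilinear_conv_bounded_bilinear[symmetric] bilinear_def
  by (auto intro!: linearI simp: matrix_vector_right_distrib matrix_vector_mult_add_rdistrib
      matrix_vector_mult_scaleR scaleR_matrix_vector_assoc)

lemma has_derivative_matrix_entries:
  fixes f :: "'a::real_normed_vector \<Rightarrow> real^'n^'m"
  assumes "\<And>i j. ((\<lambda>x. f x $ i $ j) has_derivative (\<lambda>h. f' h $ i $ j)) F" and "F = at x within S"
  shows "(f has_derivative f') F"
  unfolding assms(2)
  by (subst has_derivative_componentwise_within)
    (use assms in \<open>auto simp: Basis_vec_def inner_axis\<close>)

primrec mpow :: "real^'n^'n \<Rightarrow> nat \<Rightarrow> real^'n^'n" where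
  "mpow A 0 = mat 1"
| "mpow A (Suc k) = A ** mpow A k"

lemma mpow_Suc_right: "mpow A (Suc k) = mpow A k ** A"
  by (induction k) (simp_all add: matrix_mul_assoc)

text \<open>Each entry is a real power series in \<open>t\<close>, so that the theory of scalar power series applies.\<close>

definition mexp :: "real^'n^'n \<Rightarrow> real \<Rightarrow> real^'n^'n" where
  "mexp A t = (\<chi> i j. \<Sum>k. mpow A k $ i $ j / fact k * t ^ k)"

definition entry_sum :: "real^'n^'n \<Rightarrow> real" where
  "entry_sum A = (\<Sum>i\<in>UNIV. \<Sum>j\<in>UNIV. \<bar>A $ i $ j\<bar>)"

lemma entry_sum_nonneg: "0 \<le> entry_sum A"
  by (simp add: entry_sum_def sum_nonneg)

lemma abs_mpow_entry_le: "\<bar>mpow A k $ i $ j\<bar> \<le> entry_sum A ^ k"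
proof (induction k arbitrary: i j)
  case 0 then show ?case by (simp add: mat_def)
next
  case (Suc k)
  have "\<bar>mpow A (Suc k) $ i $ j\<bar> \<le> (\<Sum>l\<in>UNIV. \<bar>A $ i $ l * mpow A k $ l $ j\<bar>)"
    by (simp add: matrix_matrix_mult_def sum_abs)
  also have "\<dots> \<le> (\<Sum>l\<in>UNIV. \<bar>A $ i $ l\<bar> * entry_sum A ^ k)"
    by (intro sum_mono) (simp add: abs_mult mult_left_mono Suc.IH)
  also have "\<dots> = (\<Sum>l\<in>UNIV. \<bar>A $ i $ l\<bar>) * entry_sum A ^ k" by (simp add: sum_distrib_right)
  also have "\<dots> \<le> entry_sum A * entry_sum A ^ k"
    unfolding entry_sum_def
    by (intro mult_right_mono zero_le_power sum_nonneg
        member_le_sum[of i UNIV "\<lambda>i. \<Sum>j\<in>UNIV. \<bar>A $ i $ j\<bar>"]) auto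
  finally show ?case by simp
qed

lemma abs_mexp_term_le:
  "\<bar>mpow A k $ i $ j / fact k * t ^ k\<bar> \<le> (entry_sum A * \<bar>t\<bar>) ^ k / fact k"
proof -
  have "\<bar>mpow A k $ i $ j\<bar> * \<bar>t\<bar> ^ k \<le> entry_sum A ^ k * \<bar>t\<bar> ^ k"
    by (intro mult_right_mono abs_mpow_entry_le) simp
  then show ?thesis by (simp add: abs_mult power_abs power_mult_distrib divide_right_mono)
qed

lemma summable_mexp: "summable (\<lambda>k. mpow A k $ i $ j / fact k * t ^ k)"
proof (rule summable_comparison_test)
  show "\<exists>N. \<forall>k\<ge>N. norm (mpow A k $ i $ j / fact k * t ^ k) \<le> (entry_sum A * \<bar>t\<bar>) ^ k / fact k"
    unfolding real_norm_def using abs_mexp_term_le by blast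
  show "summable (\<lambda>k. (entry_sum A * \<bar>t\<bar>) ^ k / fact k)"
    using summable_exp[of "entry_sum A * \<bar>t\<bar>"] by (simp add: divide_inverse mult.commute)
qed

lemma diffs_mexp:
  "diffs (\<lambda>k. mpow A k $ i $ j / fact k) k = mpow A (Suc k) $ i $ j / fact k"
  by (simp add: diffs_def fact_Suc del: mpow.simps of_nat_Suc)

lemma mexp_entry_derivative:
  "((\<lambda>t. mexp A t $ i $ j) has_field_derivative (\<Sum>k. mpow A (Suc k) $ i $ j / fact k * t ^ k)) (at t)"
  using termdiffs_strong_converges_everywhere[OF summable_mexp, of A i j t]
  unfolding diffs_mexp by (simp add: mexp_def)

lemma mexp_mult_left: "(A ** mexp A t) $ i $ j = (\<Sum>k. mpow A (Suc k) $ i $ j / fact k * t ^ k)"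
proof -
  have s: "summable (\<lambda>k. A $ i $ l * (mpow A k $ l $ j / fact k * t ^ k))" for l
    by (intro summable_mult summable_mexp)
  have "(\<Sum>k. mpow A (Suc k) $ i $ j / fact k * t ^ k)
      = (\<Sum>k. \<Sum>l\<in>UNIV. A $ i $ l * (mpow A k $ l $ j / fact k * t ^ k))"
    by (simp add: matrix_matrix_mult_def sum_distrib_right sum_divide_distrib mult.assoc)
  also have "\<dots> = (\<Sum>l\<in>UNIV. \<Sum>k. A $ i $ l * (mpow A k $ l $ j / fact k * t ^ k))"
    using s by (rule suminf_sum)
  also have "\<dots> = (A ** mexp A t) $ i $ j"
    by (simp only: suminf_mult[OF summable_mexp]) (simp add: matrix_matrix_mult_def mexp_def)
  finally show ?thesis by simp
qed

lemma mexp_mult_right: "(mexp A t ** A) $ i $ j = (\<Sum>k. mpow A (Suc k) $ i $ j / fact k * t ^ k)"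
proof -
  have s: "summable (\<lambda>k. (mpow A k $ i $ l / fact k * t ^ k) * A $ l $ j)" for l
    by (intro summable_mult2 summable_mexp)
  have "(\<Sum>k. mpow A (Suc k) $ i $ j / fact k * t ^ k)
      = (\<Sum>k. \<Sum>l\<in>UNIV. (mpow A k $ i $ l / fact k * t ^ k) * A $ l $ j)"
    unfolding mpow_Suc_right
    by (simp add: matrix_matrix_mult_def sum_distrib_right sum_distrib_left sum_divide_distrib mult_ac)
  also have "\<dots> = (\<Sum>l\<in>UNIV. \<Sum>k. (mpow A k $ i $ l / fact k * t ^ k) * A $ l $ j)"
    using s by (rule suminf_sum)
  also have "\<dots> = (mexp A t ** A) $ i $ j"
    by (simp only: suminf_mult2[OF summable_mexp, symmetric]) (simp add: matrix_matrix_mult_def mexp_def)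
  finally show ?thesis by simp
qed

lemma mexp_commute: "mexp A t ** A = A ** mexp A t"
  by (simp add: vec_eq_iff mexp_mult_left mexp_mult_right)

lemma mexp_has_derivative:
  "(mexp A has_derivative (\<lambda>h. h *\<^sub>R (A ** mexp A t))) (at t)"
proof (rule has_derivative_matrix_entries)
  fix i j
  show "((\<lambda>t. mexp A t $ i $ j) has_derivative (\<lambda>h. (h *\<^sub>R (A ** mexp A t)) $ i $ j)) (at t)"
    using mexp_entry_derivative[of A i j t] unfolding mexp_mult_left[symmetric]
    by (simp add: has_field_derivative_def mult.commute[of _ "_ $ j"] mult_commute_abs)
qed simp

lemma mexp_zero [simp]: "mexp A 0 = mat 1"
proof -
  have "(\<Sum>k. mpow A k $ i $ j / fact k * 0 ^ k) = mat 1 $ i $ j" for i j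
    using powser_zero[of "\<lambda>k. mpow A k $ i $ j / fact k"] by simp
  then show ?thesis by (simp add: mexp_def vec_eq_iff)
qed

text \<open>The left hand side does not depend on \<open>t\<close>, since its derivative vanishes. This contains both
  the formula for the inverse (\<open>s = 0\<close>) and the addition formula.\<close>

lemma mexp_minus_mult: "mexp A (- t) ** mexp A (t + s) = mexp A s"
proof -
  have "((\<lambda>t. mexp A (- t) ** mexp A (t + s)) has_derivative (\<lambda>h. 0)) (at t within UNIV)" for t
  proof -
    have 1: "((\<lambda>t. mexp A (- t)) has_derivative (\<lambda>h. (- h) *\<^sub>R (A ** mexp A (- t)))) (at t)"
      by (rule has_derivative_compose[of uminus "\<lambda>h. - h" t UNIV, OF _ mexp_has_derivative])
        (auto intro!: derivative_eq_intros)
    have 2: "((\<lambda>t. mexp A (t + s)) has_derivative (\<lambda>h. h *\<^sub>R (A ** mexp A (t + s)))) (at t)"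
      by (rule has_derivative_compose[of "\<lambda>t. t + s" "\<lambda>h. h" t UNIV, OF _ mexp_has_derivative])
        (auto intro!: derivative_eq_intros)
    have eq: "mexp A (- t) ** (h *\<^sub>R (A ** mexp A (t + s))) + ((- h) *\<^sub>R (A ** mexp A (- t))) ** mexp A (t + s) = 0" for h
    proof -
      have "mexp A (- t) ** (h *\<^sub>R (A ** mexp A (t + s))) = h *\<^sub>R ((mexp A (- t) ** A) ** mexp A (t + s))"
        by (simp add: matrix_scalar_ac matrix_mul_assoc scalar_matrix_assoc)
      then show ?thesis unfolding mexp_commute
        by (simp add: bounded_bilinear.minus_left[OF bounded_bilinear_matrix_matrix_mult]
            bounded_bilinear.scaleR_left[OF bounded_bilinear_matrix_matrix_mult])
    qed
    from bounded_bilinear.FDERIV[OF bounded_bilinear_matrix_matrix_mult 1 2, unfolded eq] show ?thesis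
      by simp
  qed
  then have "\<exists>c. \<forall>t\<in>UNIV. mexp A (- t) ** mexp A (t + s) = c"
    by (intro has_derivative_zero_constant) auto
  then show ?thesis by (metis UNIV_I add_0 mexp_zero minus_zero matrix_mul_lid)
qed

lemma mexp_inverse [simp]: "mexp A (- t) ** mexp A t = mat 1" "mexp A t ** mexp A (- t) = mat 1"
  using mexp_minus_mult[of A t 0] mexp_minus_mult[of A "- t" 0] by auto

lemma mexp_add: "mexp A (t + s) = mexp A t ** mexp A s"
proof -
  have "mexp A t ** mexp A s = (mexp A t ** mexp A (- t)) ** mexp A (t + s)"
    by (metis matrix_mul_assoc mexp_minus_mult)
  then show ?thesis by simp
qed

lemma mexp_add_vec: "mexp A (t + s) *v v = mexp A t *v (mexp A s *v v)"
  by (simp add: mexp_add matrix_vector_mul_assoc)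

lemma mexp_inverse_vec [simp]:
  "mexp A (- t) *v (mexp A t *v v) = v" "mexp A t *v (mexp A (- t) *v v) = v"
  by (simp_all add: matrix_vector_mul_assoc)

lemma smooth_mexp: "smooth_on (mexp A) UNIV"
proof (rule smooth_on_bootstrap[OF open_UNIV mexp_has_derivative])
  fix k v assume "Ck k (mexp A) UNIV"
  then show "Ck k (\<lambda>t. v *\<^sub>R (A ** mexp A t)) UNIV"
    by (intro Ck_linear[OF bounded_linear_scaleR_right] open_UNIV
        Ck_linear[OF bounded_bilinear.bounded_linear_right[OF bounded_bilinear_matrix_matrix_mult]])
qed

lemma continuous_on_mpow: "continuous_on S (\<lambda>A. mpow A k)"
  by (induction k)
    (auto intro!: continuous_intros bounded_bilinear.continuous_on[OF bounded_bilinear_matrix_matrix_mult])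

text \<open>Joint continuity in the matrix and the time is what makes the geometry depend continuously
  on the bracket.\<close>

lemma continuous_on_mexp: "continuous_on UNIV (\<lambda>z. mexp (fst z) (snd z))"
proof -
  have "continuous_on S (\<lambda>z. mexp (fst z) (snd z) $ i $ j)"
    if S: "S = {z. entry_sum (fst z) < R \<and> \<bar>snd z\<bar> < R}" for i j R S
  proof (cases "S = {}")
    case False
    then have R: "0 \<le> R" using S entry_sum_nonneg by (auto intro: order_trans less_imp_le)
    \<comment> \<open>the series is dominated by the one of \<open>exp (R\<^sup>2)\<close> on \<open>S\<close>, and these sets exhaust the space\<close>
    have "uniform_limit S (\<lambda>n z. \<Sum>k<n. mpow (fst z) k $ i $ j / fact k * snd z ^ k)
        (\<lambda>z. \<Sum>k. mpow (fst z) k $ i $ j / fact k * snd z ^ k) sequentially"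
    proof (rule Weierstrass_m_test)
      show "norm (mpow (fst z) k $ i $ j / fact k * snd z ^ k) \<le> (R * R) ^ k / fact k" if "z \<in> S" for z k
      proof -
        have "(entry_sum (fst z) * \<bar>snd z\<bar>) ^ k \<le> (R * R) ^ k"
          using that R entry_sum_nonneg[of "fst z"] by (intro power_mono mult_mono) (auto simp: S)
        then have "(entry_sum (fst z) * \<bar>snd z\<bar>) ^ k / fact k \<le> (R * R) ^ k / fact k"
          by (intro divide_right_mono) auto
        with abs_mexp_term_le[of "fst z" k i j "snd z"] show ?thesis
          unfolding real_norm_def by (rule order_trans)
      qed
      show "summable (\<lambda>k. (R * R) ^ k / fact k)"
        using summable_exp[of "R * R"] by (simp add: divide_inverse mult.commute)
    qed
    then have "continuous_on S (\<lambda>z. \<Sum>k. mpow (fst z) k $ i $ j / fact k * snd z ^ k)"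
      by (rule uniform_limit_theorem[rotated])
        (auto intro!: always_eventually continuous_intros continuous_on_compose2[OF continuous_on_mpow[of UNIV]])
    then show ?thesis by (simp add: mexp_def)
  qed simp
  moreover have "open {z :: (real^'n^'n) \<times> real. entry_sum (fst z) < R \<and> \<bar>snd z\<bar> < R}" for R
    unfolding entry_sum_def by (intro open_Collect_conj open_Collect_less continuous_intros)
  ultimately have un: "continuous_on (\<Union>R. {z :: (real^'n^'n) \<times> real. entry_sum (fst z) < R \<and> \<bar>snd z\<bar> < R})
      (\<lambda>z. mexp (fst z) (snd z) $ i $ j)" for i j
    by (intro continuous_on_open_UN) blast+
  have UNIV: "(\<Union>R. {z :: (real^'n^'n) \<times> real. entry_sum (fst z) < R \<and> \<bar>snd z\<bar> < R}) = UNIV"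
  proof (intro equalityI subsetI)
    fix z :: "(real^'n^'n) \<times> real"
    have "z \<in> {z. entry_sum (fst z) < max (entry_sum (fst z)) \<bar>snd z\<bar> + 1
        \<and> \<bar>snd z\<bar> < max (entry_sum (fst z)) \<bar>snd z\<bar> + 1}" by auto
    then show "z \<in> (\<Union>R. {z. entry_sum (fst z) < R \<and> \<bar>snd z\<bar> < R})" by blast
  qed simp
  have "continuous_on UNIV (\<lambda>z :: (real^'n^'n) \<times> real. mexp (fst z) (snd z) $ i $ j)" for i j
    using un[of i j] unfolding UNIV .
  from continuous_on_vec_lambda[OF continuous_on_vec_lambda[OF this], of "\<lambda>i j. i" "\<lambda>i j. j"]
  have "continuous_on UNIV (\<lambda>z :: (real^'n^'n) \<times> real. \<chi> i j. mexp (fst z) (snd z) $ i $ j)" .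
  then show ?thesis by simp
qed

section \<open>The left-invariant metric in global coordinates\<close>

text \<open>The metric \<open>dt\<^sup>2 + |e\<^bsup>-tA\<^esup>dx|\<^sup>2\<close> on \<open>\<real> \<times> \<real>\<^sup>n\<close>.\<close>

definition model_metric ::
  "real^'n^'n \<Rightarrow> real \<times> (real^'n) \<Rightarrow> real \<times> (real^'n) \<Rightarrow> real \<times> (real^'n) \<Rightarrow> real" where
  "model_metric A x v w = fst v * fst w + (mexp A (- fst x) *v snd v) \<bullet> (mexp A (- fst x) *v snd w)"

text \<open>\<open>twisted_form A Q\<close> is the bilinear form \<open>Q\<close> transported by \<open>e\<^bsup>-tA\<^esup>\<close>. Its derivative is
  again of this kind, with \<open>Q\<close> replaced by \<open>form_derivative A Q\<close>, which gives all higher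
  derivatives at once.\<close>

definition twisted_form :: "real^'n^'n \<Rightarrow> real^'n^'n \<Rightarrow> real \<Rightarrow> real^'n \<Rightarrow> real^'n \<Rightarrow> real" where
  "twisted_form A Q t v w = (Q *v (mexp A (- t) *v v)) \<bullet> (mexp A (- t) *v w)"

definition form_derivative :: "real^'n^'n \<Rightarrow> real^'n^'n \<Rightarrow> real^'n^'n" where
  "form_derivative A Q = - (Q ** A + transpose A ** Q)"

lemma mexp_minus_has_derivative:
  "((\<lambda>t. mexp A (- t) *v v) has_derivative (\<lambda>h. - (h *\<^sub>R (A *v (mexp A (- t) *v v))))) (at t)"
proof -
  have 1: "((\<lambda>t. mexp A (- t)) has_derivative (\<lambda>h. (- h) *\<^sub>R (A ** mexp A (- t)))) (at t)"
    by (rule has_derivative_compose[of uminus "\<lambda>h. - h" t UNIV, OF _ mexp_has_derivative])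
      (auto intro!: derivative_eq_intros)
  from bounded_linear.has_derivative[OF bounded_bilinear.bounded_linear_left[OF
      bounded_bilinear_matrix_vector_mult] this, of v]
  show ?thesis
    by (simp add: matrix_vector_mul_assoc scaleR_matrix_vector_assoc
        bounded_bilinear.minus_left[OF bounded_bilinear_matrix_vector_mult])
qed

lemma twisted_form_has_derivative:
  fixes A :: "real^'n^'n"
  shows "((\<lambda>t. twisted_form A Q t v w) has_derivative (\<lambda>h. h * twisted_form A (form_derivative A Q) t v w)) (at t)"
proof -
  let ?e = "mexp A (- t)"
  have "((\<lambda>t. Q *v (mexp A (- t) *v v)) has_derivative (\<lambda>h. Q *v (- (h *\<^sub>R (A *v (?e *v v)))))) (at t)"
    by (rule bounded_linear.has_derivative[OF bounded_bilinear.bounded_linear_right[OF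
      bounded_bilinear_matrix_vector_mult] mexp_minus_has_derivative])
  from has_derivative_inner[OF this mexp_minus_has_derivative[of A w t]]
  have "((\<lambda>t. twisted_form A Q t v w) has_derivative
     (\<lambda>h. (Q *v (?e *v v)) \<bullet> (- (h *\<^sub>R (A *v (?e *v w)))) + (Q *v (- (h *\<^sub>R (A *v (?e *v v))))) \<bullet> (?e *v w))) (at t)"
    unfolding twisted_form_def .
  moreover have "(Q *v a) \<bullet> (A *v b) = (transpose A *v (Q *v a)) \<bullet> b" for a b :: "real^'n"
    by (metis dot_lmul_matrix transpose_matrix_vector)
  then have "(Q *v a) \<bullet> (- (h *\<^sub>R (A *v b))) + (Q *v (- (h *\<^sub>R (A *v a)))) \<bullet> b
      = h * ((form_derivative A Q *v a) \<bullet> b)" for h and a b :: "real^'n"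
    unfolding form_derivative_def
    by (simp add: matrix_vector_mul_assoc[symmetric] matrix_vector_mult_scaleR matrix_vector_mult_add_rdistrib
      bounded_bilinear.minus_left[OF bounded_bilinear_matrix_vector_mult]
      bounded_bilinear.minus_right[OF bounded_bilinear_matrix_vector_mult] inner_add_left algebra_simps)
  ultimately show ?thesis unfolding twisted_form_def by simp
qed

lemma dderivs_twisted_form:
  fixes A :: "real^'n^'n"
  shows "dderivs vs (\<lambda>x :: real \<times> (real^'n). c + twisted_form A Q (fst x) v w) = (\<lambda>x. (if vs = [] then c else 0) +
     prod_list (map fst vs) * twisted_form A ((form_derivative A ^^ length vs) Q) (fst x) v w)"
proof (induction vs)
  case (Cons u us)
  let ?Q = "(form_derivative A ^^ length us) Q"
  have "((\<lambda>x :: real \<times> (real^'n). (if us = [] then c else 0) +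
     prod_list (map fst us) * twisted_form A ?Q (fst x) v w) has_derivative
     (\<lambda>h. prod_list (map fst us) * (fst h * twisted_form A (form_derivative A ?Q) (fst x) v w))) (at x)" for x
    by (rule has_derivative_eq_rhs, rule has_derivative_add[OF has_derivative_const
        has_derivative_mult_right[OF has_derivative_compose[OF has_derivative_fst[OF has_derivative_ident]
        twisted_form_has_derivative]]]) simp
  note deriv = frechet_derivative_at[OF this, symmetric]
  show ?case unfolding dderivs.simps Cons.IH deriv
    by (simp add: fun_eq_iff mult_ac)
qed simp

lemma model_metric_twisted_form:
  "model_metric A x v w = fst v * fst w + twisted_form A (mat 1) (fst x) (snd v) (snd w)"
  by (simp add: model_metric_def twisted_form_def)

lemma smooth_model_metric:
  fixes A :: "real^'n^'n"
  shows "smooth_on (\<lambda>x. model_metric A x v w) UNIV"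
  unfolding smooth_on_def model_metric_twisted_form dderivs_twisted_form
proof
  fix vs :: "(real \<times> (real^'n)) list"
  have "(\<lambda>x::real \<times> (real^'n). twisted_form A Q (fst x) (snd v) (snd w)) differentiable at x" for x Q
    by (rule differentiableI, rule has_derivative_compose[OF has_derivative_fst[OF has_derivative_ident]
      twisted_form_has_derivative])
  then show "(\<lambda>x :: real \<times> (real^'n). (if vs = [] then fst v * fst w else 0) + prod_list (map fst vs) *
      twisted_form A ((form_derivative A ^^ length vs) (mat 1)) (fst x) (snd v) (snd w)) differentiable_on UNIV"
    unfolding differentiable_on_def by (auto intro!: derivative_intros)
qed

text \<open>By the formula for the derivatives, this is uniform convergence of a jointly continuous function of
  the parameters \<open>(B k, Q (B k))\<close> and of the point, when the parameters converge.\<close>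

lemma model_metric_uniform_limit:
  fixes B :: "nat \<Rightarrow> real^'n^'n"
  assumes B: "B \<longlonglongrightarrow> A" and K: "compact K"
  shows "uniform_limit K (\<lambda>k. dderivs vs (\<lambda>x. model_metric (B k) x v w))
     (dderivs vs (\<lambda>x. model_metric A x v w)) sequentially"
proof -
  define Q where "Q C = (form_derivative C ^^ length vs) (mat 1)" for C :: "real^'n^'n"
  define F where "F z x = (if vs = [] then fst v * fst w else 0) + prod_list (map fst vs) *
      twisted_form (fst z) (snd z) (fst x) (snd v) (snd w)" for z and x :: "real \<times> (real^'n)"
  have mexp: "continuous_on S (\<lambda>y. mexp (p y) (q y))" if "continuous_on S p" "continuous_on S q"
    for S :: "(((real^'n^'n) \<times> (real^'n^'n)) \<times> (real \<times> (real^'n))) set" and p q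
    using continuous_on_compose2[OF continuous_on_mexp continuous_on_Pair[OF that]] by simp
  have cont: "continuous_on (UNIV \<times> K) (\<lambda>(z, x). F z x)"
    unfolding F_def twisted_form_def case_prod_beta
    by (intro continuous_intros bounded_bilinear.continuous_on[OF bounded_bilinear_matrix_vector_mult] mexp)
  have QB: "(\<lambda>k. (form_derivative (B k) ^^ m) (mat 1)) \<longlonglongrightarrow> (form_derivative A ^^ m) (mat 1)" for m
    by (induction m) (auto simp: form_derivative_def transpose_def intro!: tendsto_intros B
        bounded_bilinear.tendsto[OF bounded_bilinear_matrix_matrix_mult])
  then have "(\<lambda>k. (B k, Q (B k))) \<longlonglongrightarrow> (A, Q A)"
    unfolding Q_def by (intro tendsto_intros B)
  have "uniform_limit K (\<lambda>k. F (B k, Q (B k))) (F (A, Q A)) sequentially"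
  proof (rule uniform_limitI)
    fix e :: real assume "0 < e"
    then have "0 < e / 2" by simp
    obtain X where X: "(A, Q A) \<in> X" "open X" "\<forall>z\<in>X \<inter> UNIV. \<forall>x\<in>K. dist (F z x) (F (A, Q A) x) \<le> e / 2"
      by (rule continuous_on_prod_compactE[OF cont K UNIV_I \<open>0 < e / 2\<close>, of "(A, Q A)"])
        (rule that, assumption+, simp only: prod.case)
    have "\<forall>\<^sub>F k in sequentially. (B k, Q (B k)) \<in> X"
      by (rule topological_tendstoD) fact+
    then show "\<forall>\<^sub>F k in sequentially. \<forall>x\<in>K. dist (F (B k, Q (B k)) x) (F (A, Q A) x) < e"
    proof eventually_elim
      case (elim k)
      show ?case
      proof
        fix x assume "x \<in> K"
        with X(3) elim have "dist (F (B k, Q (B k)) x) (F (A, Q A) x) \<le> e / 2" by blast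
        also have "\<dots> < e" using \<open>0 < e\<close> by simp
        finally show "dist (F (B k, Q (B k)) x) (F (A, Q A) x) < e" .
      qed
    qed
  qed
  then show ?thesis
    unfolding model_metric_twisted_form dderivs_twisted_form F_def Q_def by simp
qed

text \<open>For skew-symmetric \<open>A\<close> the identity matrix satisfies \<open>form_derivative A 1 = - (A + A\<^sup>t) = 0\<close>, so
  the transported inner product is constant.\<close>

lemma model_metric_skew:
  fixes A :: "real^'n^'n"
  assumes "transpose A = - A"
  shows "model_metric A x v w = v \<bullet> w"
proof -
  have "form_derivative A (mat 1) = 0"
    by (simp add: form_derivative_def assms)
  then have "((\<lambda>t. twisted_form A (mat 1) t a b) has_derivative (\<lambda>h. 0)) (at t within UNIV)" for a b t
    using twisted_form_has_derivative[of A "mat 1" a b t] by (simp add: twisted_form_def)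
  then have "\<exists>c. \<forall>t\<in>UNIV. twisted_form A (mat 1) t a b = c" for a b
    by (intro has_derivative_zero_constant) auto
  then have "twisted_form A (mat 1) t a b = twisted_form A (mat 1) 0 a b" for a b t
    by (metis UNIV_I)
  then show ?thesis by (simp add: model_metric_twisted_form inner_prod_def) (simp add: twisted_form_def)
qed

lemma bilinear_model_metric: "bilinear (model_metric A x)"
  unfolding bilinear_def model_metric_def
  by (auto intro!: linearI simp: matrix_vector_right_distrib matrix_vector_mult_scaleR inner_add_left inner_add_right algebra_simps)

lemma model_metric_commute: "model_metric A x v w = model_metric A x w v"
  by (simp add: model_metric_def inner_commute mult.commute)

lemma model_metric_pos:
  assumes "v \<noteq> 0"
  shows "0 < model_metric A x v v"
proof -
  let ?y = "mexp A (- fst x) *v snd v"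
  have "snd v = mexp A (fst x) *v ?y" by simp
  then have "fst v \<noteq> 0 \<or> ?y \<noteq> 0" using assms by (metis matrix_vector_mult_0_right prod_eq_iff zero_prod_def fst_conv snd_conv)
  then show ?thesis unfolding model_metric_def
    by (metis add_nonneg_pos add_pos_nonneg inner_ge_zero inner_gt_zero_iff not_real_square_gt_zero zero_le_square)
qed

section \<open>Limits of the bracket flow\<close>

lemma trace_matrix_inner:
  fixes A B :: "real^'n^'n"
  shows "A \<bullet> B = trace (A ** transpose B)"
  by (simp add: inner_vec_def trace_def matrix_matrix_mult_def transpose_def)

text \<open>If \<open>r \<noteq> 0\<close>, then eventually the component of \<open>f\<close> along \<open>r\<close> grows by at least \<open>|r|\<^sup>2 / 2\<close> on each
  interval of length one, which contradicts convergence.\<close>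

lemma limit_of_derivative_is_zero:
  fixes f :: "real \<Rightarrow> 'a::real_inner"
  assumes f: "(f \<longlongrightarrow> l) at_top" and f': "(f' \<longlongrightarrow> r) at_top"
    and d: "\<And>t. 0 < t \<Longrightarrow> (f has_vector_derivative f' t) (at t)"
  shows "r = 0"
proof (rule ccontr)
  assume "r \<noteq> 0"
  then have r: "0 < r \<bullet> r" by simp
  have "((\<lambda>t. f' t \<bullet> r) \<longlongrightarrow> r \<bullet> r) at_top" by (intro tendsto_intros f')
  then have "\<forall>\<^sub>F t in at_top. r \<bullet> r / 2 < f' t \<bullet> r" by (rule order_tendstoD) (use r in simp)
  then obtain T where T: "\<And>t. T \<le> t \<Longrightarrow> r \<bullet> r / 2 < f' t \<bullet> r"
    by (auto simp: eventually_at_top_linorder)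
  have step: "r \<bullet> r / 2 \<le> f (t + 1) \<bullet> r - f t \<bullet> r" if t: "max T 1 \<le> t" for t
  proof -
    have "\<exists>z>t. z < t + 1 \<and> f (t + 1) \<bullet> r - f t \<bullet> r = (t + 1 - t) * (f' z \<bullet> r)"
    proof (rule MVT2)
      fix x assume "t \<le> x"
      with t have "(f has_vector_derivative f' x) (at x)" by (intro d) auto
      then have "((\<lambda>t. f t \<bullet> r) has_derivative (\<lambda>h. h *\<^sub>R f' x \<bullet> r)) (at x)"
        unfolding has_vector_derivative_def by (rule has_derivative_inner_left)
      then show "((\<lambda>t. f t \<bullet> r) has_field_derivative f' x \<bullet> r) (at x)"
        by (simp add: has_field_derivative_def mult.commute[of "f' x \<bullet> r"] fun_eq_iff mult_commute_abs)
    qed simp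
    then obtain z where "t < z" "f (t + 1) \<bullet> r - f t \<bullet> r = f' z \<bullet> r" by auto
    with T[of z] t show ?thesis by simp
  qed
  have "filterlim (\<lambda>t::real. t + 1) at_top at_top"
    by (rule filterlim_at_top_mono[OF filterlim_ident]) simp
  then have "((\<lambda>t. f (t + 1) \<bullet> r - f t \<bullet> r) \<longlongrightarrow> l \<bullet> r - l \<bullet> r) at_top"
    by (intro tendsto_intros f filterlim_compose[OF f])
  moreover have "\<forall>\<^sub>F t in at_top. r \<bullet> r / 2 \<le> f (t + 1) \<bullet> r - f t \<bullet> r"
    using eventually_ge_at_top[of "max T 1"] by eventually_elim (rule step)
  ultimately have "r \<bullet> r / 2 \<le> l \<bullet> r - l \<bullet> r"
    by (rule tendsto_lowerbound) simp
  with r show False by linarith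
qed

text \<open>Pairing the right hand side of the bracket flow with \<open>A\<close> gives
  \<open>- tr(S(A)\<^sup>2) |A|\<^sup>2 - |[A, A\<^sup>t]|\<^sup>2 / 2\<close>, so that at a stationary point \<open>S(A) = 0\<close> or \<open>A = 0\<close>.\<close>

lemma stationary_imp_skew:
  fixes A :: "real^'n^'n"
  assumes "- trace (sym_part A ** sym_part A) *\<^sub>R A
        + (1/2) *\<^sub>R commutator A (commutator A (transpose A))
        - (1/2 * trace A) *\<^sub>R commutator A (transpose A) = 0"
  shows "transpose A = - A"
proof -
  let ?B = "transpose A" and ?S = "sym_part A"
  define P where "P = commutator A ?B"
  have sub: "(X - Y) ** Z = X ** Z - Y ** Z" "Z ** (X - Y) = Z ** X - Z ** Y" for X Y Z :: "real^'n^'n"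
    using bounded_bilinear.diff_left[OF bounded_bilinear_matrix_matrix_mult]
      bounded_bilinear.diff_right[OF bounded_bilinear_matrix_matrix_mult] by blast+
  have trd: "transpose (X - Y) = transpose X - transpose Y"
    "transpose (X + Y) = transpose X + transpose Y" for X Y :: "real^'n^'n"
    by (simp_all add: transpose_def vec_eq_iff)
  have trP: "transpose P = P"
    by (simp add: P_def commutator_def trd matrix_transpose_mul)
  have trS: "transpose ?S = ?S"
    by (simp add: sym_part_def trd transpose_scalar add.commute)
  have "P \<bullet> A = trace (A ** ?B ** ?B) - trace (?B ** (A ** ?B))"
    by (simp add: trace_matrix_inner P_def commutator_def sub trace_sub matrix_mul_assoc)
  then have 1: "P \<bullet> A = 0"
    by (simp add: trace_mul_sym[of ?B])
  have "commutator A P \<bullet> A = trace (A ** (P ** ?B)) - trace (P ** A ** ?B)"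
    by (simp add: trace_matrix_inner commutator_def sub trace_sub matrix_mul_assoc)
  also have "trace (A ** (P ** ?B)) = trace (P ** ?B ** A)"
    by (rule trace_mul_sym)
  also have "trace (P ** ?B ** A) - trace (P ** A ** ?B) = - trace (P ** P)"
    by (simp add: P_def[unfolded commutator_def] sub trace_sub matrix_mul_assoc)
  also have "\<dots> = - (P \<bullet> P)" by (simp add: trace_matrix_inner trP)
  finally have 2: "commutator A P \<bullet> A = - (P \<bullet> P)" .
  have "trace (?S ** ?S) = ?S \<bullet> ?S" by (simp add: trace_matrix_inner trS)
  with assms[folded P_def] have "(- (?S \<bullet> ?S) *\<^sub>R A + (1/2) *\<^sub>R commutator A P - (1/2 * trace A) *\<^sub>R P) \<bullet> A = 0"
    by simp
  then have "(?S \<bullet> ?S) * (A \<bullet> A) + (P \<bullet> P) / 2 = 0"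
    by (simp add: inner_add_left inner_diff_left 1 2)
  moreover have "0 \<le> (?S \<bullet> ?S) * (A \<bullet> A)" by (intro mult_nonneg_nonneg inner_ge_zero)
  moreover have "0 \<le> P \<bullet> P" by (rule inner_ge_zero)
  ultimately have "(?S \<bullet> ?S) * (A \<bullet> A) = 0" by linarith
  then have "?S = 0 \<or> A = 0" by simp
  then show ?thesis
  proof
    assume "?S = 0"
    then have "A + ?B = 0" by (simp add: sym_part_def)
    then show ?thesis by (simp add: eq_neg_iff_add_eq_0 add.commute)
  qed (simp add: transpose_def vec_eq_iff)
qed

lemma bracket_flow_limit_skew:
  fixes A :: "real \<Rightarrow> real^'n^'n"
  assumes flow: "bracket_flow A0 A" and lim: "(A \<longlongrightarrow> Ainf) at_top"
  shows "transpose Ainf = - Ainf"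
proof -
  define R where "R A = - trace (sym_part A ** sym_part A) *\<^sub>R A
        + (1/2) *\<^sub>R commutator A (commutator A (transpose A))
        - (1/2 * trace A) *\<^sub>R commutator A (transpose A)" for A :: "real^'n^'n"
  have tr: "((\<lambda>t. transpose (f t)) \<longlongrightarrow> transpose a) at_top" if "(f \<longlongrightarrow> a) at_top" for f :: "real \<Rightarrow> real^'n^'n" and a
    unfolding transpose_def by (intro tendsto_intros that)
  have trc: "((\<lambda>t. trace (f t)) \<longlongrightarrow> trace a) at_top" if "(f \<longlongrightarrow> a) at_top" for f :: "real \<Rightarrow> real^'n^'n" and a
    unfolding trace_def by (intro tendsto_intros that)
  have "((\<lambda>t. R (A t)) \<longlongrightarrow> R Ainf) at_top"
    unfolding R_def sym_part_def commutator_def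
    by (intro tendsto_intros bounded_bilinear.tendsto[OF bounded_bilinear_matrix_matrix_mult] tr trc lim)
  moreover have "(A has_vector_derivative R (A t)) (at t)" if "0 < t" for t
  proof -
    have "(A has_vector_derivative R (A t)) (at t within {0..})"
      using flow that by (simp add: bracket_flow_def R_def)
    then have "(A has_vector_derivative R (A t)) (at t within {0<..})"
      by (rule has_vector_derivative_within_subset) auto
    then show ?thesis using that by (simp add: at_within_open[of t "{0<..}"])
  qed
  ultimately have "R Ainf = 0" by (rule limit_of_derivative_is_zero[OF lim])
  then show ?thesis unfolding R_def by (rule stationary_imp_skew)
qed

section \<open>Extending local homomorphisms of topological groups\<close>

locale topological_group = group G for G (structure) +
  fixes X :: "'a topology"
  assumes topspace_eq: "topspace X = carrier G"
    and continuous_mult: "continuous_map (prod_topology X X) X (\<lambda>(a, b). a \<otimes> b)"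
    and continuous_inv: "continuous_map X X (\<lambda>a. inv a)"
begin

lemma continuous_map_mult:
  "continuous_map Y X f \<Longrightarrow> continuous_map Y X g \<Longrightarrow> continuous_map Y X (\<lambda>y. f y \<otimes> g y)"
  using continuous_map_compose[OF continuous_map_pairedI continuous_mult, of Y f g]
  by (simp add: o_def)

lemma continuous_map_inv: "continuous_map Y X f \<Longrightarrow> continuous_map Y X (\<lambda>y. inv f y)"
  using continuous_map_compose[OF _ continuous_inv, of Y f] by (simp add: o_def)

lemma continuous_map_closed:
  "continuous_map Y X f \<Longrightarrow> y \<in> topspace Y \<Longrightarrow> f y \<in> carrier G"
  using continuous_map_funspace topspace_eq by fastforce

lemma pathin_closed: "pathin X \<gamma> \<Longrightarrow> s \<in> {0..1} \<Longrightarrow> \<gamma> s \<in> carrier G"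
  unfolding pathin_def by (rule continuous_map_closed) auto

text \<open>Uniform continuity: the pairs whose quotient is not in \<open>V\<close> form a compact set which
  misses the diagonal.\<close>

lemma uniformly_small_quotients:
  fixes f :: "'z::heine_borel \<Rightarrow> 'a"
  assumes S: "compact S" and f: "continuous_map (top_of_set S) X f"
    and V: "openin X V" "\<one> \<in> V"
  obtains \<delta> where "0 < \<delta>" "\<And>s s'. s \<in> S \<Longrightarrow> s' \<in> S \<Longrightarrow> dist s s' < \<delta> \<Longrightarrow> inv f s \<otimes> f s' \<in> V"
proof -
  define q where "q = (\<lambda>z. inv f (fst z) \<otimes> f (snd z))"
  let ?SS = "prod_topology (top_of_set S) (top_of_set S)"
  have "continuous_map ?SS X q"
    unfolding q_def
    by (intro continuous_map_mult continuous_map_inv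
        continuous_map_compose[OF continuous_map_fst f, unfolded o_def]
        continuous_map_compose[OF continuous_map_snd f, unfolded o_def])
  from openin_continuous_map_preimage[OF this V(1)]
  have "openin (top_of_set (S \<times> S)) {z \<in> S \<times> S. q z \<in> V}"
    by (simp add: subtopology_Times[symmetric] euclidean_product_topology)
  then have "closedin (top_of_set (S \<times> S)) (S \<times> S - {z \<in> S \<times> S. q z \<in> V})"
    by (intro closedin_diff) auto
  then have "closed (S \<times> S - {z \<in> S \<times> S. q z \<in> V})"
    by (rule closedin_closed_trans) (intro closed_Times compact_imp_closed S)
  moreover have "compact ((\<lambda>s. (s, s)) ` S)"
    by (intro compact_continuous_image S continuous_intros)
  moreover have "q (s, s) \<in> V" if "s \<in> S" for s
    using continuous_map_closed[OF f] that V(2) by (simp add: q_def)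
  then have "(\<lambda>s. (s, s)) ` S \<inter> (S \<times> S - {z \<in> S \<times> S. q z \<in> V}) = {}" by auto
  ultimately have "\<exists>d>0. \<forall>x\<in>(\<lambda>s. (s, s)) ` S. \<forall>y\<in>S \<times> S - {z \<in> S \<times> S. q z \<in> V}. d \<le> dist x y"
    by (intro separate_compact_closed)
  then obtain d where d: "0 < d" "\<And>x y. x \<in> (\<lambda>s. (s, s)) ` S \<Longrightarrow> y \<in> S \<times> S - {z \<in> S \<times> S. q z \<in> V} \<Longrightarrow> d \<le> dist x y"
    by meson
  have "inv f s \<otimes> f s' \<in> V" if "s \<in> S" "s' \<in> S" "dist s s' < d" for s s'
  proof (rule ccontr)
    assume "inv f s \<otimes> f s' \<notin> V"
    with that(1,2) have "d \<le> dist (s, s) (s, s')" by (intro d(2)) (auto simp: q_def)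
    with that(3) show False by (simp add: dist_Pair_Pair)
  qed
  with d(1) show thesis by (rule that)
qed

lemma uniformly_small_steps:
  assumes \<gamma>: "pathin X \<gamma>" and V: "openin X V" "\<one> \<in> V"
  shows "\<forall>\<^sub>F N in sequentially. \<forall>s\<in>{0..1}. \<forall>s'\<in>{0..1}. \<bar>s - s'\<bar> \<le> 1 / real N \<longrightarrow> inv \<gamma> s \<otimes> \<gamma> s' \<in> V"
proof -
  obtain d where d: "0 < d" "\<And>s s'. s \<in> {0..1} \<Longrightarrow> s' \<in> {0..1} \<Longrightarrow> dist s s' < d \<Longrightarrow> inv \<gamma> s \<otimes> \<gamma> s' \<in> V"
    using uniformly_small_quotients[OF compact_Icc _ V] \<gamma> unfolding pathin_def by metis
  have "(\<lambda>N. 1 / real N) \<longlonglongrightarrow> 0" by (rule lim_1_over_n)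
  then have "\<forall>\<^sub>F N in sequentially. 1 / real N < d" using d(1) by (rule order_tendstoD)
  then show ?thesis
    by eventually_elim (use d(2) in \<open>force simp: dist_real_def\<close>)
qed

end

lemma successive_dist:
  "\<bar>real (Suc i) / real N - real i / real N\<bar> \<le> 1 / real N"
  "\<bar>real i / real N - real (Suc i) / real N\<bar> \<le> 1 / real N"
  by (simp_all add: diff_divide_distrib[symmetric])

text \<open>The value at \<open>x(0)\<^sup>-\<^sup>1 x(n)\<close> of a homomorphism extending \<open>\<phi>\<close>, expressed by \<open>\<phi>\<close> near the
  identity.\<close>

primrec step_prod :: "('a, 'c) monoid_scheme \<Rightarrow> ('b, 'd) monoid_scheme \<Rightarrow> ('a \<Rightarrow> 'b) \<Rightarrow> (nat \<Rightarrow> 'a) \<Rightarrow> nat \<Rightarrow> 'b" where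
  "step_prod G H \<phi> x 0 = \<one>\<^bsub>H\<^esub>"
| "step_prod G H \<phi> x (Suc n) = step_prod G H \<phi> x n \<otimes>\<^bsub>H\<^esub> \<phi> (inv\<^bsub>G\<^esub> x n \<otimes>\<^bsub>G\<^esub> x (Suc n))"

locale local_hom = topological_group G X + H: group H
  for G (structure) and X :: "'a topology" and H :: "('b, 'd) monoid_scheme" (structure) +
  fixes V :: "'a set" and \<phi> :: "'a \<Rightarrow> 'b"
  assumes openV: "openin X V" and oneV: "\<one>\<^bsub>G\<^esub> \<in> V"
    and \<phi>_closed: "a \<in> V \<Longrightarrow> \<phi> a \<in> carrier H"
    and \<phi>_mult: "a \<in> V \<Longrightarrow> b \<in> V \<Longrightarrow> a \<otimes>\<^bsub>G\<^esub> b \<in> V \<Longrightarrow> \<phi> (a \<otimes>\<^bsub>G\<^esub> b) = \<phi> a \<otimes>\<^bsub>H\<^esub> \<phi> b"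
begin

abbreviation quot :: "'a \<Rightarrow> 'a \<Rightarrow> 'a" where "quot a b \<equiv> inv\<^bsub>G\<^esub> a \<otimes>\<^bsub>G\<^esub> b"

lemma V_subset: "V \<subseteq> carrier G" using openin_subset[OF openV] topspace_eq by simp

lemma \<phi>_one [simp]: "\<phi> \<one>\<^bsub>G\<^esub> = \<one>\<^bsub>H\<^esub>"
  using \<phi>_mult[OF oneV oneV] \<phi>_closed[OF oneV] oneV by (simp add: H.l_cancel_one')

lemma \<phi>_chain:
  assumes "a \<in> carrier G" "b \<in> carrier G" "c \<in> carrier G" "quot a b \<in> V" "quot b c \<in> V" "quot a c \<in> V"
  shows "\<phi> (quot a b) \<otimes>\<^bsub>H\<^esub> \<phi> (quot b c) = \<phi> (quot a c)"
proof -
  have "quot a b \<otimes>\<^bsub>G\<^esub> quot b c = quot a c"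
    using assms(1-3) by (simp add: m_assoc inv_solve_left' ) (metis inv_closed m_assoc m_closed r_inv l_one)
  with assms \<phi>_mult[of "quot a b" "quot b c"] show ?thesis by simp
qed

abbreviation sp :: "(nat \<Rightarrow> 'a) \<Rightarrow> nat \<Rightarrow> 'b" where "sp \<equiv> step_prod G H \<phi>"

lemma sp_closed: "(\<And>i. i < n \<Longrightarrow> quot (x i) (x (Suc i)) \<in> V) \<Longrightarrow> sp x n \<in> carrier H"
  by (induction n) (auto intro: \<phi>_closed)

lemma sp_cong: "(\<And>i. i \<le> n \<Longrightarrow> x i = y i) \<Longrightarrow> sp x n = sp y n"
  by (induction n) auto

lemma sp_append:
  assumes "\<And>i. i < m + n \<Longrightarrow> quot (x i) (x (Suc i)) \<in> V"
  shows "sp x (m + n) = sp x m \<otimes>\<^bsub>H\<^esub> sp (\<lambda>i. x (m + i)) n"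
  using assms
proof (induction n)
  case 0
  then show ?case by (simp add: sp_closed)
next
  case (Suc n)
  then show ?case by (simp add: H.m_assoc sp_closed \<phi>_closed)
qed

lemma sp_translate:
  assumes "a \<in> carrier G" "\<And>i. i \<le> n \<Longrightarrow> x i \<in> carrier G"
  shows "sp (\<lambda>i. a \<otimes>\<^bsub>G\<^esub> x i) n = sp x n"
  using assms(2)
proof (induction n)
  case (Suc n)
  have "quot (a \<otimes>\<^bsub>G\<^esub> x n) (a \<otimes>\<^bsub>G\<^esub> x (Suc n)) = quot (x n) (x (Suc n))"
    using Suc.prems[of n] Suc.prems[of "Suc n"] assms(1)
    by (simp add: inv_mult_group m_assoc) (metis inv_closed l_inv l_one m_assoc m_closed)
  with Suc show ?case by simp
qed simp

lemma sp_telescope: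
  assumes "\<And>i. i \<le> n \<Longrightarrow> x i \<in> carrier G" "\<And>i j. i \<le> n \<Longrightarrow> j \<le> n \<Longrightarrow> quot (x i) (x j) \<in> V"
  shows "sp x n = \<phi> (quot (x 0) (x n))"
  using assms
proof (induction n)
  case (Suc n)
  then have "sp x n = \<phi> (quot (x 0) (x n))" by simp
  then show ?case using \<phi>_chain[of "x 0" "x n" "x (Suc n)"] Suc.prems by simp
qed simp

definition small_mesh :: "(real \<Rightarrow> 'a) \<Rightarrow> nat \<Rightarrow> bool" where
  "small_mesh \<gamma> N \<longleftrightarrow> 0 < N \<and> (\<forall>s\<in>{0..1}. \<forall>s'\<in>{0..1}. \<bar>s - s'\<bar> \<le> 1 / real N \<longrightarrow> quot (\<gamma> s) (\<gamma> s') \<in> V)"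

abbreviation path_prod :: "(real \<Rightarrow> 'a) \<Rightarrow> nat \<Rightarrow> 'b" where "path_prod \<gamma> N \<equiv> sp (\<lambda>i. \<gamma> (real i / real N)) N"

lemma eventually_small_mesh: "pathin X \<gamma> \<Longrightarrow> \<forall>\<^sub>F N in sequentially. small_mesh \<gamma> N"
  unfolding small_mesh_def
  by (intro eventually_conj uniformly_small_steps openV oneV eventually_gt_at_top)

lemma small_mesh_step:
  assumes "small_mesh \<gamma> N" "i < N"
  shows "quot (\<gamma> (real i / real N)) (\<gamma> (real (Suc i) / real N)) \<in> V"
    "quot (\<gamma> (real (Suc i) / real N)) (\<gamma> (real i / real N)) \<in> V"
proof -
  show "quot (\<gamma> (real i / real N)) (\<gamma> (real (Suc i) / real N)) \<in> V"
    "quot (\<gamma> (real (Suc i) / real N)) (\<gamma> (real i / real N)) \<in> V"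
    using assms successive_dist[of i N] by (auto simp: small_mesh_def)
qed

lemma path_prod_closed: "small_mesh \<gamma> N \<Longrightarrow> path_prod \<gamma> N \<in> carrier H"
  by (intro sp_closed small_mesh_step)

text \<open>The part of the finer product which belongs to one step of the coarser subdivision telescopes.\<close>

lemma path_prod_refine:
  assumes \<gamma>: "pathin X \<gamma>" and N: "small_mesh \<gamma> N" and M: "0 < M"
  shows "path_prod \<gamma> (N * M) = path_prod \<gamma> N"
proof -
  let ?x = "\<lambda>i. \<gamma> (real i / real (N * M))"
  have N0: "0 < N" using N by (simp add: small_mesh_def)
  have NM: "small_mesh \<gamma> (N * M)"
  proof -
    have "1 / real (N * M) \<le> 1 / real N"
      using N0 M by (intro divide_left_mono) (auto simp: Suc_le_eq)
    with N M show ?thesis unfolding small_mesh_def by (meson mult_pos_pos order_trans)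
  qed
  have "sp ?x (n * M) = sp (\<lambda>i. \<gamma> (real i / real N)) n" if "n \<le> N" for n
    using that
  proof (induction n)
    case (Suc n)
    have in01: "real (n * M + i) / real (N * M) \<in> {0..1}" if "i \<le> M" for i
    proof -
      have "n * M + i \<le> Suc n * M" using that by simp
      also have "\<dots> \<le> N * M" using Suc.prems by (rule mult_le_mono1)
      finally have "real (n * M + i) \<le> real (N * M)" by (rule of_nat_mono)
      then show ?thesis using N0 M by (simp add: divide_le_eq del: of_nat_add of_nat_mult)
    qed
    have "sp (\<lambda>i. ?x (n * M + i)) M = \<phi> (quot (?x (n * M + 0)) (?x (n * M + M)))"
    proof (rule sp_telescope)
      fix i j assume ij: "i \<le> M" "j \<le> M"
      have "real (n * M + i) / real (N * M) - real (n * M + j) / real (N * M) = (real i - real j) / (real N * real M)"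
        by (simp add: diff_divide_distrib add_divide_distrib)
      moreover have "\<bar>real i - real j\<bar> \<le> real M" using ij by linarith
      then have "\<bar>(real i - real j) / (real N * real M)\<bar> \<le> real M / (real N * real M)"
        unfolding abs_divide abs_mult abs_of_nat by (rule divide_right_mono) simp
      ultimately have "\<bar>real (n * M + i) / real (N * M) - real (n * M + j) / real (N * M)\<bar> \<le> 1 / real N"
        using M by simp
      then show "quot (?x (n * M + i)) (?x (n * M + j)) \<in> V"
        using N in01[OF ij(1)] in01[OF ij(2)] unfolding small_mesh_def by blast
    qed (auto intro!: pathin_closed[OF \<gamma>] in01[simplified])
    also have "?x (n * M + 0) = \<gamma> (real n / real N)" using M by simp
    also have "?x (n * M + M) = \<gamma> (real (Suc n) / real N)"
    proof -
      have "real (n * M + M) / real (N * M) = real (Suc n) * real M / (real N * real M)" by (simp add: algebra_simps)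
      also have "\<dots> = real (Suc n) / real N" using M by simp
      finally show ?thesis by simp
    qed
    finally have step: "sp (\<lambda>i. ?x (n * M + i)) M = \<phi> (quot (\<gamma> (real n / real N)) (\<gamma> (real (Suc n) / real N)))" .
    have "sp ?x (n * M + M) = sp ?x (n * M) \<otimes>\<^bsub>H\<^esub> sp (\<lambda>i. ?x (n * M + i)) M"
    proof (rule sp_append)
      fix i assume "i < n * M + M"
      also have "\<dots> = Suc n * M" by simp
      also have "\<dots> \<le> N * M" using Suc.prems by (rule mult_le_mono1)
      finally show "quot (?x i) (?x (Suc i)) \<in> V" by (rule small_mesh_step[OF NM])
    qed
    with Suc step show ?case by (simp add: add.commute)
  qed simp
  from this[of N] show ?thesis by simp
qed

lemma path_prod_mesh_indep:
  assumes "pathin X \<gamma>" "small_mesh \<gamma> N" "small_mesh \<gamma> M"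
  shows "path_prod \<gamma> N = path_prod \<gamma> M"
  using path_prod_refine[OF assms(1,2), of M] path_prod_refine[OF assms(1,3), of N] assms(2,3)
  by (simp add: small_mesh_def mult.commute)

text \<open>On a fine grid, replacing the path at \<open>u\<close> by the one at \<open>u'\<close> changes the product only by the
  values of \<open>\<phi>\<close> at the quotients of the end points, and these are fixed.\<close>

lemma path_prod_homotopy:
  assumes h: "continuous_map (prod_topology (top_of_set {0..1}) (top_of_set {0..1})) X h"
    and ends: "\<And>u. u \<in> {0..1} \<Longrightarrow> h (u, 0) = a" "\<And>u. u \<in> {0..1} \<Longrightarrow> h (u, 1) = b"
  obtains N where "small_mesh (\<lambda>s. h (0, s)) N" "path_prod (\<lambda>s. h (0, s)) N = path_prod (\<lambda>s. h (1::real, s::real)) N"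
proof -
  have h': "continuous_map (top_of_set ({0..1} \<times> {0..1})) X h"
    using h by (simp add: subtopology_Times[symmetric] euclidean_product_topology)
  have "compact ({0..1::real} \<times> {0..1::real})" by (intro compact_Times compact_Icc)
  from uniformly_small_quotients[OF this h' openV oneV]
  obtain d where d: "0 < d" "\<And>z z'. z \<in> {0..1} \<times> {0..1} \<Longrightarrow> z' \<in> {0..1} \<times> {0..1} \<Longrightarrow> dist z z' < d \<Longrightarrow> quot (h z) (h z') \<in> V"
    by metis
  have "(\<lambda>N. 1 / real N) \<longlonglongrightarrow> 0" by (rule lim_1_over_n)
  then have "\<forall>\<^sub>F N in sequentially. 1 / real N < d / 2 \<and> 0 < N"
    using d(1) by (intro eventually_conj order_tendstoD eventually_gt_at_top) auto
  then obtain N where N: "1 / real N < d / 2" "0 < N"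
    by (auto simp: eventually_sequentially)
  have small: "quot (h (u, s)) (h (u', s')) \<in> V"
    if "u \<in> {0..1}" "u' \<in> {0..1}" "s \<in> {0..1}" "s' \<in> {0..1}" "\<bar>u - u'\<bar> \<le> 1 / real N" "\<bar>s - s'\<bar> \<le> 1 / real N" for u u' s s'
  proof (rule d(2))
    have "dist (u, s) (u', s') \<le> \<bar>u - u'\<bar> + \<bar>s - s'\<bar>"
      by (simp add: dist_Pair_Pair dist_real_def sqrt_sum_squares_le_sum_abs)
    also have "\<dots> < d" using that N by linarith
    finally show "dist (u, s) (u', s') < d" .
  qed (use that in auto)
  have cl: "h (u, s) \<in> carrier G" if "u \<in> {0..1}" "s \<in> {0..1}" for u s
    using continuous_map_closed[OF h] that by simp
  have small_mesh: "small_mesh (\<lambda>s. h (u, s)) N" if "u \<in> {0..1}" for u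
    unfolding small_mesh_def using N small that by auto
  have move: "path_prod (\<lambda>s. h (u, s)) N = path_prod (\<lambda>s. h (u', s)) N"
    if u: "u \<in> {0..1}" "u' \<in> {0..1}" "\<bar>u - u'\<bar> \<le> 1 / real N" for u u'
  proof -
    let ?x = "\<lambda>i. h (u, real i / real N)" and ?y = "\<lambda>i. h (u', real i / real N)"
    \<comment> \<open>the two ways around the grid square with corners \<open>?x n\<close>, \<open>?x (Suc n)\<close>, \<open>?y n\<close>, \<open>?y (Suc n)\<close> agree by \<open>\<phi>_chain\<close>\<close>
    have *: "sp ?x n \<otimes>\<^bsub>H\<^esub> \<phi> (quot (?x n) (?y n)) = \<phi> (quot (?x 0) (?y 0)) \<otimes>\<^bsub>H\<^esub> sp ?y n" if "n \<le> N" for n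
      using that
    proof (induction n)
      case 0
      have "quot (?x 0) (?y 0) \<in> V" using u by (intro small) auto
      then show ?case by (simp add: \<phi>_closed)
    next
      case (Suc n)
      have i: "real n / real N \<in> {0..1}" "real (Suc n) / real N \<in> {0..1}"
        using Suc.prems N by (auto simp: divide_le_eq)
      note st = successive_dist(2)[of n N]
      have q: "quot (?x n) (?x (Suc n)) \<in> V" "quot (?x (Suc n)) (?y (Suc n)) \<in> V" "quot (?x n) (?y (Suc n)) \<in> V"
        "quot (?x n) (?y n) \<in> V" "quot (?y n) (?y (Suc n)) \<in> V"
        using u i st by (intro small; simp)+
      have c: "?x n \<in> carrier G" "?x (Suc n) \<in> carrier G" "?y n \<in> carrier G" "?y (Suc n) \<in> carrier G"
        using u i by (auto intro!: cl)
      have "i < n \<Longrightarrow> quot (?x i) (?x (Suc i)) \<in> V" "i < n \<Longrightarrow> quot (?y i) (?y (Suc i)) \<in> V" for i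
        using small_mesh_step(1)[OF small_mesh[OF u(1)]] small_mesh_step(1)[OF small_mesh[OF u(2)]] Suc.prems by auto
      then have s: "sp ?x n \<in> carrier H" "sp ?y n \<in> carrier H" by (auto intro: sp_closed)
      have f: "\<phi> (quot (?x n) (?x (Suc n))) \<in> carrier H" "\<phi> (quot (?x (Suc n)) (?y (Suc n))) \<in> carrier H"
        "\<phi> (quot (?x n) (?y n)) \<in> carrier H" "\<phi> (quot (?y n) (?y (Suc n))) \<in> carrier H"
        using q by (auto intro: \<phi>_closed)
      have f0: "\<phi> (quot (?x 0) (?y 0)) \<in> carrier H"
        using u by (intro \<phi>_closed small) auto
      have "sp ?x (Suc n) \<otimes>\<^bsub>H\<^esub> \<phi> (quot (?x (Suc n)) (?y (Suc n)))
          = sp ?x n \<otimes>\<^bsub>H\<^esub> (\<phi> (quot (?x n) (?x (Suc n))) \<otimes>\<^bsub>H\<^esub> \<phi> (quot (?x (Suc n)) (?y (Suc n))))"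
        using s f by (simp add: H.m_assoc)
      also have "\<dots> = sp ?x n \<otimes>\<^bsub>H\<^esub> (\<phi> (quot (?x n) (?y n)) \<otimes>\<^bsub>H\<^esub> \<phi> (quot (?y n) (?y (Suc n))))"
        using \<phi>_chain[OF c(1,2,4) q(1,2,3)] \<phi>_chain[OF c(1,3,4) q(4,5,3)] by simp
      also have "\<dots> = (sp ?x n \<otimes>\<^bsub>H\<^esub> \<phi> (quot (?x n) (?y n))) \<otimes>\<^bsub>H\<^esub> \<phi> (quot (?y n) (?y (Suc n)))"
        using s f by (simp add: H.m_assoc)
      also have "\<dots> = \<phi> (quot (?x 0) (?y 0)) \<otimes>\<^bsub>H\<^esub> sp ?y (Suc n)"
        using Suc s f f0 by (simp add: H.m_assoc)
      finally show ?case .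
    qed
    have "quot (?x 0) (?y 0) = \<one>\<^bsub>G\<^esub>" "quot (?x N) (?y N) = \<one>\<^bsub>G\<^esub>"
      using ends u N cl[of u 0] cl[of u 1] by auto
    with *[of N] path_prod_closed[OF small_mesh] u show ?thesis by simp
  qed
  have "path_prod (\<lambda>s. h (0, s)) N = path_prod (\<lambda>s. h (real j / real N, s)) N" if "j \<le> N" for j
    using that
  proof (induction j)
    case (Suc j)
    have i: "real j / real N \<in> {0..1}" "real (Suc j) / real N \<in> {0..1}"
      using Suc.prems N by (auto simp: divide_le_eq)
    from move[OF i successive_dist(2)] Suc show ?case by simp
  qed simp
  from this[of N] N have "path_prod (\<lambda>s. h (0, s)) N = path_prod (\<lambda>s. h (1, s)) N" by simp
  with small_mesh[of 0] show thesis by (intro that) auto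
qed

definition path_value :: "(real \<Rightarrow> 'a) \<Rightarrow> 'b \<Rightarrow> bool" where
  "path_value \<gamma> v \<longleftrightarrow> (\<exists>N. small_mesh \<gamma> N \<and> path_prod \<gamma> N = v)"

lemma path_value_path_prod: "pathin X \<gamma> \<Longrightarrow> path_value \<gamma> v \<Longrightarrow> small_mesh \<gamma> N \<Longrightarrow> path_prod \<gamma> N = v"
  unfolding path_value_def using path_prod_mesh_indep by blast

lemma path_value_closed: "path_value \<gamma> v \<Longrightarrow> v \<in> carrier H"
  unfolding path_value_def using path_prod_closed by blast

lemma path_value_ex: "pathin X \<gamma> \<Longrightarrow> \<exists>v. path_value \<gamma> v"
  unfolding path_value_def using eventually_small_mesh[of \<gamma>] by (auto simp: eventually_sequentially)

lemma path_value_loop: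
  assumes sc: "simply_connected_space X" and \<gamma>: "pathin X \<gamma>" "\<gamma> 0 = \<gamma> 1"
  shows "path_value \<gamma> \<one>\<^bsub>H\<^esub>"
proof -
  have "homotopic_with (\<lambda>\<delta>. \<delta> 0 = \<gamma> 0 \<and> \<delta> 1 = \<gamma> 0) (top_of_set {0..1}) X \<gamma> (\<lambda>t. \<gamma> 0)"
    using sc \<gamma> unfolding simply_connected_space_def by blast
  then obtain h where h: "continuous_map (prod_topology (top_of_set {0..1}) (top_of_set {0..1::real})) X h"
    "\<And>x. h (0, x) = \<gamma> x" "\<And>x. h (1::real, x) = \<gamma> 0" "\<And>u. u \<in> {0..1} \<Longrightarrow> h (u, 0) = \<gamma> 0" "\<And>u. u \<in> {0..1} \<Longrightarrow> h (u, 1) = \<gamma> 0"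
    unfolding homotopic_with_def by blast
  obtain N where N: "small_mesh \<gamma> N" "path_prod \<gamma> N = sp (\<lambda>i. \<gamma> 0) N"
    using path_prod_homotopy[OF h(1,4,5)] unfolding h(2,3) by blast
  have "\<gamma> 0 \<in> carrier G" using \<gamma> by (intro pathin_closed) auto
  then have "sp (\<lambda>i. \<gamma> 0) N = \<one>\<^bsub>H\<^esub>" by (subst sp_telescope) (auto simp: oneV)
  with N show ?thesis unfolding path_value_def by auto
qed

lemma pathin_compose:
  assumes "pathin X \<gamma>" "continuous_on {0..1} p" "p ` {0..1} \<subseteq> {0..1}"
  shows "continuous_map (top_of_set {0..1}) X (\<lambda>s. \<gamma> (p s))"
  using continuous_map_compose[of "top_of_set {0..1}" "top_of_set {0..1}" p X \<gamma>] assms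
  unfolding pathin_def by (auto simp: o_def continuous_map_in_subtopology)

text \<open>The path follows \<open>\<gamma>\<close> and then the translate of \<open>\<delta>\<close>. Written as a product in the group it is
  continuous without gluing.\<close>

lemma path_value_mult:
  assumes \<gamma>: "pathin X \<gamma>" "path_value \<gamma> v" "\<gamma> 0 = \<one>\<^bsub>G\<^esub>" and \<delta>: "pathin X \<delta>" "path_value \<delta> w" "\<delta> 0 = \<one>\<^bsub>G\<^esub>"
  obtains \<epsilon> where "pathin X \<epsilon>" "path_value \<epsilon> (v \<otimes>\<^bsub>H\<^esub> w)" "\<epsilon> 0 = \<one>\<^bsub>G\<^esub>" "\<epsilon> 1 = \<gamma> 1 \<otimes>\<^bsub>G\<^esub> \<delta> 1"
proof -
  define \<epsilon> where "\<epsilon> s = \<gamma> (min 1 (2 * s)) \<otimes>\<^bsub>G\<^esub> \<delta> (max 0 (2 * s - 1))" for s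
  have cl: "\<gamma> s \<in> carrier G" "\<delta> s \<in> carrier G" if "s \<in> {0..1}" for s
    using \<gamma>(1) \<delta>(1) that by (auto intro: pathin_closed)
  have \<epsilon>1: "\<epsilon> s = \<gamma> (2 * s)" if "0 \<le> s" "s \<le> 1 / 2" for s
  proof -
    have "max 0 (2 * s - 1) = 0" "min 1 (2 * s) = 2 * s" using that by auto
    then show ?thesis using that cl[of "2 * s"] \<delta>(3) by (simp add: \<epsilon>_def)
  qed
  have \<epsilon>2: "\<epsilon> s = \<gamma> 1 \<otimes>\<^bsub>G\<^esub> \<delta> (2 * s - 1)" if "1 / 2 \<le> s" "s \<le> 1" for s
    using that by (simp add: \<epsilon>_def)
  have p: "pathin X \<epsilon>"
    unfolding pathin_def \<epsilon>_def
    by (intro continuous_map_mult pathin_compose \<gamma> \<delta> continuous_intros) auto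
  then obtain e where val: "path_value \<epsilon> e" using path_value_ex by blast
  have "\<forall>\<^sub>F N in sequentially. small_mesh \<gamma> N \<and> small_mesh \<delta> N \<and> small_mesh \<epsilon> N"
    using eventually_small_mesh[OF p] eventually_small_mesh[OF \<gamma>(1)] eventually_small_mesh[OF \<delta>(1)] by eventually_elim simp
  then obtain N0 where N0: "\<And>N. N0 \<le> N \<Longrightarrow> small_mesh \<gamma> N \<and> small_mesh \<delta> N \<and> small_mesh \<epsilon> N"
    by (auto simp: eventually_sequentially)
  define N where "N = max N0 1"
  have N: "small_mesh \<gamma> N" "small_mesh \<delta> N" "small_mesh \<epsilon> (N + N)" "0 < N"
    using N0[of N] N0[of "N + N"] by (auto simp: N_def)
  have "path_prod \<epsilon> (N + N) = sp (\<lambda>i. \<epsilon> (real i / real (N + N))) N \<otimes>\<^bsub>H\<^esub> sp (\<lambda>i. \<epsilon> (real (N + i) / real (N + N))) N"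
    by (rule sp_append) (rule small_mesh_step[OF N(3)])
  also have "sp (\<lambda>i. \<epsilon> (real i / real (N + N))) N = path_prod \<gamma> N"
    by (rule sp_cong) (use N(4) in \<open>subst \<epsilon>1; simp add: field_simps\<close>)
  also have "sp (\<lambda>i. \<epsilon> (real (N + i) / real (N + N))) N = sp (\<lambda>i. \<gamma> 1 \<otimes>\<^bsub>G\<^esub> \<delta> (real i / real N)) N"
  proof (rule sp_cong)
    fix i assume "i \<le> N"
    then have "2 * (real (N + i) / real (N + N)) - 1 = real i / real N"
      using N(4) by (simp add: field_simps)
    moreover have "\<epsilon> (real (N + i) / real (N + N)) = \<gamma> 1 \<otimes>\<^bsub>G\<^esub> \<delta> (2 * (real (N + i) / real (N + N)) - 1)"
      using N(4) \<open>i \<le> N\<close> by (intro \<epsilon>2) (simp_all add: field_simps)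
    ultimately show "\<epsilon> (real (N + i) / real (N + N)) = \<gamma> 1 \<otimes>\<^bsub>G\<^esub> \<delta> (real i / real N)" by (simp only:)
  qed
  also have "\<dots> = path_prod \<delta> N"
    by (rule sp_translate) (use N(4) in \<open>auto intro!: cl simp: divide_le_eq\<close>)
  finally have "e = v \<otimes>\<^bsub>H\<^esub> w"
    using path_value_path_prod[OF p val N(3)] path_value_path_prod[OF \<gamma>(1,2) N(1)] path_value_path_prod[OF \<delta>(1,2) N(2)] by simp
  with val have "path_value \<epsilon> (v \<otimes>\<^bsub>H\<^esub> w)" by simp
  then show thesis
    using that[OF p] \<epsilon>1[of 0] \<epsilon>2[of 1] \<gamma>(3) by simp
qed

text \<open>For paths \<open>\<gamma>\<close> and \<open>\<delta>\<close> from \<open>1\<close> to \<open>y\<close>, the path \<open>\<eta>(s) = y\<^sup>-\<^sup>1 \<delta>(1 - s)\<close> from \<open>1\<close> to \<open>y\<^sup>-\<^sup>1\<close>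
  closes up both of them to loops, whose values are trivial. So both values are inverse to the
  value of \<open>\<eta>\<close>.\<close>

lemma path_value_unique:
  assumes sc: "simply_connected_space X"
    and \<gamma>: "pathin X \<gamma>" "path_value \<gamma> v" "\<gamma> 0 = \<one>\<^bsub>G\<^esub>"
    and \<delta>: "pathin X \<delta>" "path_value \<delta> w" "\<delta> 0 = \<one>\<^bsub>G\<^esub>" and ends: "\<gamma> 1 = \<delta> 1"
  shows "v = w"
proof -
  define \<eta> where "\<eta> s = inv\<^bsub>G\<^esub> \<delta> 1 \<otimes>\<^bsub>G\<^esub> \<delta> (1 - s)" for s
  have y: "\<delta> 1 \<in> carrier G" using \<delta>(1) by (rule pathin_closed) simp
  have \<eta>: "pathin X \<eta>" "\<eta> 0 = \<one>\<^bsub>G\<^esub>" "\<eta> 1 = inv\<^bsub>G\<^esub> \<delta> 1"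
    unfolding pathin_def \<eta>_def using y \<delta>(3)
    by (auto intro!: continuous_map_mult pathin_compose \<delta> continuous_intros simp: topspace_eq)
  obtain z where z: "path_value \<eta> z" using path_value_ex[OF \<eta>(1)] by blast
  have loop: "u \<otimes>\<^bsub>H\<^esub> z = \<one>\<^bsub>H\<^esub>"
    if \<alpha>: "pathin X \<alpha>" "path_value \<alpha> u" "\<alpha> 0 = \<one>\<^bsub>G\<^esub>" "\<alpha> 1 = \<delta> 1" for \<alpha> u
  proof -
    obtain \<epsilon> where \<epsilon>: "pathin X \<epsilon>" "path_value \<epsilon> (u \<otimes>\<^bsub>H\<^esub> z)" "\<epsilon> 0 = \<one>\<^bsub>G\<^esub>" "\<epsilon> 1 = \<alpha> 1 \<otimes>\<^bsub>G\<^esub> \<eta> 1"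
      by (rule path_value_mult[OF \<alpha>(1-3) \<eta>(1) z \<eta>(2)])
    have "\<epsilon> 0 = \<epsilon> 1" using \<epsilon>(3,4) \<alpha>(4) \<eta>(3) y by simp
    then have "path_value \<epsilon> \<one>\<^bsub>H\<^esub>" by (rule path_value_loop[OF sc \<epsilon>(1)])
    with \<epsilon>(1,2) show ?thesis using path_value_path_prod unfolding path_value_def by metis
  qed
  have "v \<otimes>\<^bsub>H\<^esub> z = w \<otimes>\<^bsub>H\<^esub> z" using loop[OF \<gamma> ends] loop[OF \<delta> refl] by simp
  then show ?thesis using path_value_closed[OF \<gamma>(2)] path_value_closed[OF \<delta>(2)] path_value_closed[OF z] by simp
qed

text \<open>The value at \<open>y\<close> is the product along any path from \<open>1\<close> to \<open>y\<close>. The conclusion says that \<open>F\<close>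
  agrees with \<open>\<phi>\<close> at those points which can be reached by a path that is short compared with \<open>V\<close>; such
  points form a neighbourhood of the identity if the group is locally path connected.\<close>

theorem extension:
  assumes sc: "simply_connected_space X"
  shows "\<exists>F\<in>hom G H. \<forall>\<gamma>. pathin X \<gamma> \<longrightarrow> \<gamma> 0 = \<one>\<^bsub>G\<^esub> \<longrightarrow>
    (\<forall>s\<in>{0..1}. \<forall>s'\<in>{0..1}. quot (\<gamma> s) (\<gamma> s') \<in> V) \<longrightarrow> F (\<gamma> 1) = \<phi> (\<gamma> 1)"
proof -
  define F where "F y = (SOME v. \<exists>\<gamma>. pathin X \<gamma> \<and> \<gamma> 0 = \<one>\<^bsub>G\<^esub> \<and> \<gamma> 1 = y \<and> path_value \<gamma> v)" for y
  have F: "F (\<gamma> 1) = v" if "pathin X \<gamma>" "\<gamma> 0 = \<one>\<^bsub>G\<^esub>" "path_value \<gamma> v" for \<gamma> v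
    unfolding F_def
  proof (rule some_equality)
    show "\<exists>\<gamma>'. pathin X \<gamma>' \<and> \<gamma>' 0 = \<one>\<^bsub>G\<^esub> \<and> \<gamma>' 1 = \<gamma> 1 \<and> path_value \<gamma>' v" using that by blast
    fix w assume "\<exists>\<gamma>'. pathin X \<gamma>' \<and> \<gamma>' 0 = \<one>\<^bsub>G\<^esub> \<and> \<gamma>' 1 = \<gamma> 1 \<and> path_value \<gamma>' w"
    with that show "w = v" using path_value_unique[OF sc] by metis
  qed
  have path: "\<exists>\<gamma>. pathin X \<gamma> \<and> \<gamma> 0 = \<one>\<^bsub>G\<^esub> \<and> \<gamma> 1 = y" if "y \<in> carrier G" for y
    using sc that unfolding simply_connected_space_def path_connected_space_def topspace_eq by blast
  show ?thesis
  proof (intro bexI[of _ F] allI impI)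
    show "F \<in> hom G H"
    proof (rule homI)
      fix x assume "x \<in> carrier G"
      with path obtain \<gamma> where "pathin X \<gamma>" "\<gamma> 0 = \<one>\<^bsub>G\<^esub>" "\<gamma> 1 = x" by blast
      then show "F x \<in> carrier H" using F path_value_closed path_value_ex by metis
    next
      fix x y assume "x \<in> carrier G" "y \<in> carrier G"
      with path obtain \<gamma> \<delta> where \<gamma>: "pathin X \<gamma>" "\<gamma> 0 = \<one>\<^bsub>G\<^esub>" "\<gamma> 1 = x"
        and \<delta>: "pathin X \<delta>" "\<delta> 0 = \<one>\<^bsub>G\<^esub>" "\<delta> 1 = y" by metis
      obtain v w where v: "path_value \<gamma> v" and w: "path_value \<delta> w" using \<gamma> \<delta> path_value_ex by metis
      obtain \<epsilon> where "pathin X \<epsilon>" "path_value \<epsilon> (v \<otimes>\<^bsub>H\<^esub> w)" "\<epsilon> 0 = \<one>\<^bsub>G\<^esub>" "\<epsilon> 1 = \<gamma> 1 \<otimes>\<^bsub>G\<^esub> \<delta> 1"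
        by (rule path_value_mult[OF \<gamma>(1) v \<gamma>(2) \<delta>(1) w \<delta>(2)])
      with F[of \<epsilon>] F[OF \<gamma>(1,2) v] F[OF \<delta>(1,2) w] show "F (x \<otimes>\<^bsub>G\<^esub> y) = F x \<otimes>\<^bsub>H\<^esub> F y"
        by (simp add: \<gamma> \<delta>)
    qed
  next
    fix \<gamma> assume \<gamma>: "pathin X \<gamma>" "\<gamma> 0 = \<one>\<^bsub>G\<^esub>" and s: "\<forall>s\<in>{0..1}. \<forall>s'\<in>{0..1}. quot (\<gamma> s) (\<gamma> s') \<in> V"
    have "small_mesh \<gamma> 1" unfolding small_mesh_def using s by simp
    moreover have "path_prod \<gamma> 1 = \<phi> (\<gamma> 1)"
    proof -
      have "quot (\<gamma> 0) (\<gamma> 1) \<in> V" using s by simp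
      then have "\<gamma> 1 \<in> V" using \<gamma> pathin_closed[OF \<gamma>(1), of 1] by simp
      then show ?thesis using \<gamma> V_subset by (auto simp: \<phi>_closed)
    qed
    ultimately have "path_value \<gamma> (\<phi> (\<gamma> 1))" unfolding path_value_def by blast
    then show "F (\<gamma> 1) = \<phi> (\<gamma> 1)" by (rule F[OF \<gamma>])
  qed
qed

end

text \<open>The end point of a path from the identity is a product of small quotients, on which the
  homomorphisms agree.\<close>

lemma (in topological_group) homs_eqI:
  assumes H: "group H" and FK: "F \<in> hom G H" "K \<in> hom G H" and X: "path_connected_space X"
    and V: "openin X V" "\<one> \<in> V" and eq: "\<And>a. a \<in> V \<Longrightarrow> F a = K a" and y: "y \<in> carrier G"
  shows "F y = K y"
proof -
  obtain \<gamma> where \<gamma>: "pathin X \<gamma>" "\<gamma> 0 = \<one>" "\<gamma> 1 = y"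
    using X y unfolding path_connected_space_def topspace_eq by blast
  have "\<forall>\<^sub>F N in sequentially. (\<forall>s\<in>{0..1}. \<forall>s'\<in>{0..1}. \<bar>s - s'\<bar> \<le> 1 / real N \<longrightarrow> inv \<gamma> s \<otimes> \<gamma> s' \<in> V) \<and> 0 < N"
    by (intro eventually_conj uniformly_small_steps \<gamma> V eventually_gt_at_top)
  then have "\<exists>N. (\<forall>s\<in>{0..1}. \<forall>s'\<in>{0..1}. \<bar>s - s'\<bar> \<le> 1 / real N \<longrightarrow> inv \<gamma> s \<otimes> \<gamma> s' \<in> V) \<and> 0 < N"
    using eventually_happens'[OF sequentially_bot] by blast
  then obtain N where N: "\<And>s s'. s \<in> {0..1} \<Longrightarrow> s' \<in> {0..1} \<Longrightarrow> \<bar>s - s'\<bar> \<le> 1 / real N \<Longrightarrow> inv \<gamma> s \<otimes> \<gamma> s' \<in> V" "0 < N"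
    by meson
  have "F (\<gamma> (real i / real N)) = K (\<gamma> (real i / real N))" if "i \<le> N" for i
    using that
  proof (induction i)
    case 0
    show ?case using hom_one[OF FK(1) is_group H] hom_one[OF FK(2) is_group H] \<gamma>(2) by simp
  next
    case (Suc i)
    have i: "real i / real N \<in> {0..1}" "real (Suc i) / real N \<in> {0..1}"
      using Suc.prems N by (auto simp: divide_le_eq)
    let ?a = "\<gamma> (real i / real N)" and ?b = "\<gamma> (real (Suc i) / real N)"
    have c: "?a \<in> carrier G" "?b \<in> carrier G"
      using i by (auto intro: pathin_closed[OF \<gamma>(1)] simp del: of_nat_Suc)
    have "inv ?a \<otimes> ?b \<in> V" using i by (intro N(1) successive_dist)
    then have "F (inv ?a \<otimes> ?b) = K (inv ?a \<otimes> ?b)" by (rule eq)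
    moreover have "K' ?b = K' ?a \<otimes>\<^bsub>H\<^esub> K' (inv ?a \<otimes> ?b)" if "K' \<in> hom G H" for K'
    proof -
      have "?b = ?a \<otimes> (inv ?a \<otimes> ?b)" using c by (simp flip: m_assoc del: of_nat_Suc)
      then show ?thesis using hom_mult[OF that, of ?a "inv ?a \<otimes> ?b"] c by simp
    qed
    moreover have "F ?a = K ?a" using Suc by simp
    ultimately show ?case using FK by metis
  qed
  from this[of N] N(2) \<gamma>(3) show ?thesis by simp
qed

section \<open>The group \<open>\<real> \<ltimes> \<real>\<^sup>n\<close>\<close>

definition model_mult :: "real^'n^'n \<Rightarrow> real \<times> (real^'n) \<Rightarrow> real \<times> (real^'n) \<Rightarrow> real \<times> (real^'n)" where
  "model_mult B x y = (fst x + fst y, snd x + mexp B (fst x) *v snd y)"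

definition model_group :: "real^'n^'n \<Rightarrow> (real \<times> (real^'n)) monoid" where
  "model_group B = \<lparr>carrier = UNIV, mult = model_mult B, one = 0\<rparr>"

definition model_inv :: "real^'n^'n \<Rightarrow> real \<times> (real^'n) \<Rightarrow> real \<times> (real^'n)" where
  "model_inv B x = (- fst x, - (mexp B (- fst x) *v snd x))"

lemma model_group_simps [simp]:
  "carrier (model_group B) = UNIV" "mult (model_group B) = model_mult B" "one (model_group B) = 0"
  by (simp_all add: model_group_def)

lemma mexp_mult_minus: "mexp B t *v (- v) = - (mexp B t *v v)"
  by (rule bounded_bilinear.minus_right[OF bounded_bilinear_matrix_vector_mult])

lemma model_mult_assoc: "model_mult B (model_mult B x y) z = model_mult B x (model_mult B y z)"
  by (simp add: model_mult_def mexp_add_vec matrix_vector_right_distrib algebra_simps)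

lemma model_mult_zero [simp]: "model_mult B 0 x = x" "model_mult B x 0 = x"
  by (simp_all add: model_mult_def)

lemma model_mult_inv [simp]: "model_mult B (model_inv B x) x = 0" "model_mult B x (model_inv B x) = 0"
  by (simp_all add: model_mult_def model_inv_def mexp_mult_minus zero_prod_def)

lemma model_mult_cancel [simp]:
  "model_mult B (model_inv B x) (model_mult B x y) = y" "model_mult B x (model_mult B (model_inv B x) y) = y"
  by (simp_all flip: model_mult_assoc)

lemma group_model_group: "group (model_group B)"
  by (rule groupI) (auto simp: model_mult_assoc simp del: split_paired_Ex intro: model_mult_inv(1))

lemma inv_model_group [simp]: "inv\<^bsub>model_group B\<^esub> x = model_inv B x"
  by (rule group.inv_equality[OF group_model_group]) auto

lemma continuous_on_mexp_fst [continuous_intros]: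
  assumes "continuous_on S f" shows "continuous_on S (\<lambda>x. mexp B (f x))"
  using continuous_on_compose2[OF continuous_on_mexp continuous_on_Pair[OF continuous_on_const[of _ B] assms]] by simp

lemma continuous_on_matrix_vector_mult [continuous_intros]:
  "continuous_on S f \<Longrightarrow> continuous_on S g \<Longrightarrow> continuous_on S (\<lambda>x. f x *v g x)"
  for f :: "'a::topological_space \<Rightarrow> real^'n^'m"
  by (rule bounded_bilinear.continuous_on[OF bounded_bilinear_matrix_vector_mult])

lemma topological_group_model: "topological_group (model_group B) euclidean"
proof (intro topological_group.intro group_model_group topological_group_axioms.intro)
  have "continuous_on UNIV (\<lambda>z. model_mult B (fst z) (snd z))"
    unfolding model_mult_def by (intro continuous_intros)
  then show "continuous_map (prod_topology euclidean euclidean) euclidean (\<lambda>(a, b). a \<otimes>\<^bsub>model_group B\<^esub> b)"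
    by (simp add: euclidean_product_topology case_prod_beta)
  have "continuous_on UNIV (model_inv B)"
    unfolding model_inv_def by (intro continuous_intros)
  then show "continuous_map euclidean euclidean (\<lambda>a. inv\<^bsub>model_group B\<^esub> a)"
    by simp
qed simp

lemma simply_connected_euclidean:
  "simply_connected_space (euclidean :: 'a::real_normed_vector topology)"
  unfolding simply_connected_space_def
proof (intro conjI allI impI)
  show "path_connected_space (euclidean :: 'a topology)"
  proof -
    have "pathin euclidean (linepath x y) \<and> linepath x y 0 = x \<and> linepath x y 1 = y" for x y :: 'a
      by (simp add: pathin_def linepath_0' linepath_1' continuous_on_linepath)
    then show ?thesis unfolding path_connected_space_def by blast
  qed
  fix \<gamma> :: "real \<Rightarrow> 'a" assume \<gamma>: "pathin euclidean \<gamma> \<and> \<gamma> 0 = \<gamma> 1"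
  then have c: "continuous_on {0..1} \<gamma>" by (simp add: pathin_def)
  define h where "h z = (1 - fst z) *\<^sub>R (\<gamma> (snd z) - \<gamma> 0) + \<gamma> 0" for z
  have "continuous_on ({0..1} \<times> {0..1}) h"
    unfolding h_def by (intro continuous_intros continuous_on_compose2[OF c]) auto
  then have "continuous_map (prod_topology (top_of_set {0..1}) (top_of_set {0..1})) euclidean h"
    by (simp add: subtopology_Times[symmetric] euclidean_product_topology)
  then show "homotopic_with (\<lambda>\<delta>. \<delta> 0 = \<gamma> 0 \<and> \<delta> 1 = \<gamma> 0) (top_of_set {0..1}) euclidean \<gamma> (\<lambda>t. \<gamma> 0)"
    unfolding homotopic_with_def using \<gamma> by (intro exI[of _ h]) (auto simp: h_def)
qed

text \<open>\<open>model_frame B x v\<close> is the value at \<open>x\<close> of the left-invariant vector field on the model which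
  is \<open>v\<close> at the origin; \<open>model_coframe B x\<close> is inverse to it.\<close>

definition model_frame :: "real^'n^'n \<Rightarrow> real \<times> (real^'n) \<Rightarrow> real \<times> (real^'n) \<Rightarrow> real \<times> (real^'n)" where
  "model_frame B x v = (fst v, mexp B (fst x) *v snd v)"

definition model_coframe :: "real^'n^'n \<Rightarrow> real \<times> (real^'n) \<Rightarrow> real \<times> (real^'n) \<Rightarrow> real \<times> (real^'n)" where
  "model_coframe B x v = (fst v, mexp B (- fst x) *v snd v)"

lemma model_frame_coframe [simp]:
  "model_frame B x (model_coframe B x v) = v" "model_coframe B x (model_frame B x v) = v"
  by (simp_all add: model_frame_def model_coframe_def)

lemma model_metric_coframe: "model_metric B x v w = model_coframe B x v \<bullet> model_coframe B x w"
  by (simp add: model_metric_def model_coframe_def inner_prod_def)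

lemma linear_model_frame: "linear (model_frame B x)" "linear (model_coframe B x)"
  by (auto intro!: linearI simp: model_frame_def model_coframe_def matrix_vector_right_distrib matrix_vector_mult_scaleR)

lemma model_mult_has_derivative:
  "(model_mult B x has_derivative model_frame B x) (at y)"
proof -
  have "bounded_linear (model_frame B x)"
    using linear_model_frame(1) by (simp add: linear_conv_bounded_linear)
  then have "((\<lambda>y. x + model_frame B x y) has_derivative model_frame B x) (at y)"
    using has_derivative_add[OF has_derivative_const bounded_linear_imp_has_derivative] by fastforce
  moreover have "model_mult B x = (\<lambda>y. x + model_frame B x y)"
    by (simp add: model_mult_def model_frame_def fun_eq_iff plus_prod_def)
  ultimately show ?thesis by simp
qed

lemma Ck_mexp:
  assumes "open U" "Ck k f U"
  shows "Ck k (\<lambda>x. mexp B (f x)) U"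
  using smooth_mexp by (intro Ck_comp[OF assms(1) open_UNIV assms(2)]) (auto simp: smooth_on_iff_Ck)

lemma Ck_matrix_vector_mult:
  "open U \<Longrightarrow> Ck k f U \<Longrightarrow> Ck k g U \<Longrightarrow> Ck k (\<lambda>x. f x *v g x) U"
  for f :: "'a::euclidean_space \<Rightarrow> real^'n^'m"
  by (rule Ck_bilinear[OF bounded_bilinear_matrix_vector_mult])

lemma Ck_model_frame:
  assumes "open U" "Ck k f U" "Ck k h U"
  shows "Ck k (\<lambda>x. model_frame B (f x) (h x)) U" "Ck k (\<lambda>x. model_coframe B (f x) (h x)) U"
  unfolding model_frame_def model_coframe_def
  by (intro Ck_Pair Ck_matrix_vector_mult Ck_mexp Ck_minus assms
      Ck_linear[OF bounded_linear_fst] Ck_linear[OF bounded_linear_snd])+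

section \<open>Local coordinates adapted to a frame\<close>

definition matrix_blinfun :: "real^'n^'m \<Rightarrow> ((real^'n) \<Rightarrow>\<^sub>L (real^'m))" where
  "matrix_blinfun M = (\<Sum>b\<in>Basis. rank_one b (M *v b))"

lemma matrix_blinfun_apply [simp]: "matrix_blinfun M v = M *v v"
proof -
  have "linear ((*v) M)" by simp
  from linear_eq_sum_rank_one[OF this] show ?thesis by (metis matrix_blinfun_def)
qed

lemma bounded_linear_matrix_blinfun: "bounded_linear matrix_blinfun"
  unfolding matrix_blinfun_def
  by (intro bounded_linear_sum bounded_linear_compose[OF bounded_linear_rank_one]
    bounded_bilinear.bounded_linear_left[OF bounded_bilinear_matrix_vector_mult])

text \<open>\<open>L x v\<close> is the value at \<open>x\<close> of the \<open>v\<close>-th vector field of a frame, and \<open>T\<close> is the dual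
  coframe.\<close>

locale mu_frame =
  fixes B :: "real^'n^'n" and U :: "(real \<times> (real^'n)) set"
    and L T :: "real \<times> (real^'n) \<Rightarrow> ((real \<times> (real^'n)) \<Rightarrow>\<^sub>L (real \<times> (real^'n)))"
  assumes openU: "open U" and smoothL: "smooth_on L U"
    and TL: "\<And>x. x \<in> U \<Longrightarrow> T x o\<^sub>L L x = id_blinfun" and LT: "\<And>x. x \<in> U \<Longrightarrow> L x o\<^sub>L T x = id_blinfun"
    and bracket: "\<And>x v w. x \<in> U \<Longrightarrow>
      frechet_derivative L (at x) (L x v) w - frechet_derivative L (at x) (L x w) v = L x (mu B v w)"
begin

lemma TL_apply: "x \<in> U \<Longrightarrow> T x (L x v) = v" and LT_apply: "x \<in> U \<Longrightarrow> L x (T x v) = v"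
  using TL LT by (metis blinfun_apply_blinfun_compose blinfun_apply_id_blinfun)+

lemma smoothT: "smooth_on T U"
  by (rule smooth_on_inverse_family[OF openU smoothL TL LT])

text \<open>The Maurer-Cartan equation, obtained by differentiating the inverse \<open>T\<close> of \<open>L\<close>.\<close>

lemma maurer_cartan:
  assumes x: "x \<in> U"
  obtains T' where "(T has_derivative T') (at x)" "\<And>u v. T' u v - T' v u = - mu B (T x u) (T x v)"
proof
  let ?L' = "frechet_derivative L (at x)"
  have "Ck (Suc 0) L U" using smoothL by (simp add: smooth_on_iff_Ck)
  from has_derivative_inverse_family[OF openU x Ck_Suc_has_derivative[OF openU this] TL LT]
  show "(T has_derivative (\<lambda>u. - (T x o\<^sub>L ?L' u o\<^sub>L T x))) (at x)" .
  fix u v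
  have "?L' u (T x v) - ?L' v (T x u) = L x (mu B (T x u) (T x v))"
    using bracket[OF x, of "T x u" "T x v"] by (simp add: LT_apply[OF x])
  then have "T x (?L' u (T x v)) - T x (?L' v (T x u)) = mu B (T x u) (T x v)"
    by (metis TL_apply[OF x] blinfun.diff_right)
  then show "(- (T x o\<^sub>L ?L' u o\<^sub>L T x)) v - (- (T x o\<^sub>L ?L' v o\<^sub>L T x)) u = - mu B (T x u) (T x v)"
    by (simp add: blinfun.bilinear_simps algebra_simps)
qed

text \<open>Since \<open>mu B\<close> has no component along \<open>e\<^sub>0\<close>, the form \<open>\<omega>0\<close>, the component of \<open>T\<close> along \<open>e\<^sub>0\<close>, is closed; let
  \<open>\<tau>\<close> be a primitive. The remaining part of \<open>T\<close> is not closed, but the integrating factor \<open>e\<^bsup>\<tau>B\<^esup>\<close>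
  makes it so: the term from differentiating the factor cancels the bracket.\<close>

lemma adapted_coordinates:
  assumes W: "open W" "convex W" "x0 \<in> W" "W \<subseteq> U"
  obtains \<psi> where "\<psi> x0 = 0"
    "\<And>x. x \<in> W \<Longrightarrow> (\<psi> has_derivative (\<lambda>u. model_frame B (\<psi> x) (T x u))) (at x)"
proof -
  have CkT: "Ck k T W" for k
    using smoothT by (intro Ck_subset[OF W(1,4) openU]) (simp add: smooth_on_iff_Ck)
  define \<omega>0 where "\<omega>0 x = fst_blinfun o\<^sub>L T x" for x
  have bl0: "bounded_linear (\<lambda>S::(real \<times> (real^'n)) \<Rightarrow>\<^sub>L (real \<times> (real^'n)). fst_blinfun o\<^sub>L S)"
    and bl1: "bounded_linear (\<lambda>S::(real \<times> (real^'n)) \<Rightarrow>\<^sub>L (real \<times> (real^'n)). snd_blinfun o\<^sub>L S)"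
    by (rule bounded_bilinear.bounded_linear_right[OF bounded_bilinear_blinfun_compose])+
  have closed0: "\<exists>\<omega>'. (\<omega>0 has_derivative \<omega>') (at x) \<and> (\<forall>u v. blinfun_apply (\<omega>' u) v = \<omega>' v u)" if "x \<in> W" for x
  proof -
    have "x \<in> U" using W(4) that by blast
    then obtain T' where T': "(T has_derivative T') (at x)" "\<And>u v. T' u v - T' v u = - mu B (T x u) (T x v)"
      by (rule maurer_cartan) (rule that)
    have "fst (T' u v) = fst (T' v u)" for u v
      using arg_cong[OF T'(2)[of u v], of fst] by (simp add: mu_def)
    with bounded_linear.has_derivative[OF bl0 T'(1)] show ?thesis
      unfolding \<omega>0_def by (intro exI conjI) auto
  qed
  have Ck0: "Ck (Suc 0) \<omega>0 W"
    unfolding \<omega>0_def by (rule Ck_linear[OF bl0 W(1) CkT])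
  obtain \<tau> where \<tau>: "\<tau> x0 = 0" "\<And>x. x \<in> W \<Longrightarrow> (\<tau> has_derivative blinfun_apply (\<omega>0 x)) (at x)"
    by (rule smooth_closed_form_has_primitive[OF W(1-3) Ck0 closed0]) (assumption, rule that)
  have Ck\<tau>: "Ck (Suc k) \<tau> W" for k
  proof (rule Ck_SucI[OF W(1) \<tau>(2)])
    show "Ck k (\<lambda>x. blinfun_apply (\<omega>0 x) v) W" for v
      unfolding \<omega>0_def
      by (intro Ck_blinfun_apply[OF W(1)] Ck_linear[OF bl0 W(1) CkT] Ck_const W)
  qed
  define E where "E x = matrix_blinfun (mexp B (\<tau> x))" for x
  define \<omega>1 where "\<omega>1 x = E x o\<^sub>L (snd_blinfun o\<^sub>L T x)" for x
  have closed1: "\<exists>\<omega>'. (\<omega>1 has_derivative \<omega>') (at x) \<and> (\<forall>u v. blinfun_apply (\<omega>' u) v = \<omega>' v u)" if x: "x \<in> W" for x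
  proof -
    have "x \<in> U" using W(4) x by blast
    then obtain T' where T': "(T has_derivative T') (at x)" "\<And>u v. T' u v - T' v u = - mu B (T x u) (T x v)"
      by (rule maurer_cartan) (rule that)
    let ?M = "mexp B (\<tau> x)"
    have "((\<lambda>x. mexp B (\<tau> x)) has_derivative (\<lambda>u. \<omega>0 x u *\<^sub>R (B ** ?M))) (at x)"
      by (rule has_derivative_compose[OF \<tau>(2)[OF x] mexp_has_derivative])
    from bounded_linear.has_derivative[OF bounded_linear_matrix_blinfun this]
    have "(E has_derivative (\<lambda>u. matrix_blinfun (\<omega>0 x u *\<^sub>R (B ** ?M)))) (at x)"
      unfolding E_def .
    from bounded_bilinear.FDERIV[OF bounded_bilinear_blinfun_compose this bounded_linear.has_derivative[OF bl1 T'(1)]]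
    have d: "(\<omega>1 has_derivative (\<lambda>u. (E x o\<^sub>L (snd_blinfun o\<^sub>L T' u)) + (matrix_blinfun (\<omega>0 x u *\<^sub>R (B ** ?M)) o\<^sub>L (snd_blinfun o\<^sub>L T x)))) (at x)"
      unfolding \<omega>1_def .
    have "((E x o\<^sub>L (snd_blinfun o\<^sub>L T' u)) + (matrix_blinfun (\<omega>0 x u *\<^sub>R (B ** ?M)) o\<^sub>L (snd_blinfun o\<^sub>L T x))) v
      = ((E x o\<^sub>L (snd_blinfun o\<^sub>L T' v)) + (matrix_blinfun (\<omega>0 x v *\<^sub>R (B ** ?M)) o\<^sub>L (snd_blinfun o\<^sub>L T x))) u" for u v
    proof -
      let ?u = "T x u" and ?v = "T x v"
      have "snd (T' u v) - snd (T' v u) = - (fst ?u *\<^sub>R (B *v snd ?v) - fst ?v *\<^sub>R (B *v snd ?u))"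
        using arg_cong[OF T'(2)[of u v], of snd] by (simp add: mu_def)
      then have eq: "?M *v (snd (T' u v) - snd (T' v u)) = - (fst ?u *\<^sub>R (?M *v (B *v snd ?v)) - fst ?v *\<^sub>R (?M *v (B *v snd ?u)))"
        by (simp add: mexp_mult_minus matrix_vector_mult_diff_distrib matrix_vector_mult_scaleR)
      have "?M *v (B *v w) = (B ** ?M) *v w" for w
        by (simp add: matrix_vector_mul_assoc mexp_commute)
      from eq[unfolded this] show ?thesis
        by (simp add: E_def \<omega>0_def blinfun.add_left scaleR_matrix_vector_assoc[symmetric] matrix_vector_mult_diff_distrib
          fst_blinfun.rep_eq snd_blinfun.rep_eq algebra_simps)
    qed
    with d show ?thesis by blast
  qed
  have Ck1: "Ck (Suc 0) \<omega>1 W"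
    unfolding \<omega>1_def E_def
    by (intro Ck_bilinear[OF bounded_bilinear_blinfun_compose W(1)] Ck_linear[OF bl1 W(1) CkT]
      Ck_linear[OF bounded_linear_matrix_blinfun W(1)] Ck_mexp[OF W(1)] Ck\<tau>)
  obtain f where f: "f x0 = 0" "\<And>x. x \<in> W \<Longrightarrow> (f has_derivative blinfun_apply (\<omega>1 x)) (at x)"
    by (rule smooth_closed_form_has_primitive[OF W(1-3) Ck1 closed1]) (assumption, rule that)
  show thesis
  proof (rule that[of "\<lambda>x. (\<tau> x, f x)"])
    show "(\<tau> x0, f x0) = 0" using \<tau>(1) f(1) by (simp add: zero_prod_def)
    fix x assume "x \<in> W"
    from has_derivative_Pair[OF \<tau>(2)[OF this] f(2)[OF this]]
    show "((\<lambda>x. (\<tau> x, f x)) has_derivative (\<lambda>u. model_frame B (\<tau> x, f x) (T x u))) (at x)"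
      by (simp add: model_frame_def \<omega>0_def \<omega>1_def E_def fst_blinfun.rep_eq snd_blinfun.rep_eq)
  qed
qed

text \<open>Two maps which pull back the invariant coframe of the model to the same coframe differ by a
  left translation of the model.\<close>

lemma adapted_coordinates_unique:
  assumes W: "open W" "convex W" "x0 \<in> W" and "\<psi> x0 = 0"
    and \<psi>: "\<And>x. x \<in> W \<Longrightarrow> (\<psi> has_derivative (\<lambda>u. model_frame B (\<psi> x) (T x u))) (at x)"
    and f: "\<And>x. x \<in> W \<Longrightarrow> (f has_derivative (\<lambda>u. model_frame B (f x) (T x u))) (at x)"
    and x: "x \<in> W"
  shows "f x = model_mult B (f x0) (\<psi> x)"
proof -
  have "((\<lambda>x. fst (f x) - fst (\<psi> x)) has_derivative (\<lambda>u. 0)) (at x within W)" if "x \<in> W" for x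
    using has_derivative_diff[OF has_derivative_fst[OF f[OF that]] has_derivative_fst[OF \<psi>[OF that]]]
    by (simp add: model_frame_def has_derivative_at_withinI)
  then have "\<exists>c. \<forall>x\<in>W. fst (f x) - fst (\<psi> x) = c"
    by (rule has_derivative_zero_constant[OF W(2)])
  then have 1: "fst (f x) = fst (f x0) + fst (\<psi> x)" if "x \<in> W" for x
    using W(3) that \<open>\<psi> x0 = 0\<close> by (metis add.commute add_diff_cancel_right' diff_add_cancel diff_zero fst_zero)
  let ?E = "mexp B (fst (f x0))"
  have "((\<lambda>x. snd (f x) - ?E *v snd (\<psi> x)) has_derivative (\<lambda>u. 0)) (at x within W)" if x: "x \<in> W" for x
  proof -
    have "((\<lambda>x. ?E *v snd (\<psi> x)) has_derivative (\<lambda>u. ?E *v snd (model_frame B (\<psi> x) (T x u)))) (at x)"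
      by (rule bounded_linear.has_derivative[OF bounded_bilinear.bounded_linear_right[OF bounded_bilinear_matrix_vector_mult]
        has_derivative_snd[OF \<psi>[OF x]]])
    from has_derivative_diff[OF has_derivative_snd[OF f[OF x]] this]
    show ?thesis
      by (simp add: model_frame_def 1[OF x] mexp_add_vec has_derivative_at_withinI)
  qed
  then have "\<exists>c. \<forall>x\<in>W. snd (f x) - ?E *v snd (\<psi> x) = c"
    by (rule has_derivative_zero_constant[OF W(2)])
  then have "snd (f x) - ?E *v snd (\<psi> x) = snd (f x0) - ?E *v snd (\<psi> x0)"
    using W(3) x by metis
  then have 2: "snd (f x) = snd (f x0) + ?E *v snd (\<psi> x)"
    using \<open>\<psi> x0 = 0\<close> by (simp add: algebra_simps)
  show ?thesis unfolding model_mult_def 1[OF x, symmetric] 2[symmetric] by simp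
qed

end

section \<open>Charts\<close>

lemma open_preimage:
  assumes "continuous_map (top_of_set S) X f" "open S" "openin X U"
  shows "open {x \<in> S. f x \<in> U}"
proof -
  have "openin (top_of_set S) {x \<in> S. f x \<in> U}"
    using openin_continuous_map_preimage[OF assms(1,3)] by simp
  then show ?thesis using assms(2) openin_open_trans by blast
qed

lemma chart_inv_chart: "is_chart X c \<Longrightarrow> p \<in> fst c \<Longrightarrow> chart_inv c (snd c p) = p"
proof -
  assume c: "is_chart X c" and p: "p \<in> fst c"
  then have "topspace X \<inter> fst c = fst c" using openin_subset by (fastforce simp: is_chart_def)
  with c have "inj_on (snd c) (fst c)" by (simp add: is_chart_def homeomorphic_eq_everything_map)
  then show ?thesis using p by (rule inv_into_f_f)
qed

lemma chart_chart_inv: "x \<in> snd c ` fst c \<Longrightarrow> snd c (chart_inv c x) = x"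
  by (rule f_inv_into_f)

lemma chart_inv_in: "x \<in> snd c ` fst c \<Longrightarrow> chart_inv c x \<in> fst c"
  by (rule inv_into_into)

lemma is_chart_openD: "is_chart X c \<Longrightarrow> openin X (fst c)" "is_chart X c \<Longrightarrow> open (snd c ` fst c)"
  by (simp_all add: is_chart_def)

lemma continuous_chart:
  assumes "is_chart X c"
  shows "continuous_map (subtopology X (fst c)) euclidean (snd c)"
proof -
  have "continuous_map (subtopology X (fst c)) (top_of_set (snd c ` fst c)) (snd c)"
    using assms by (simp add: is_chart_def homeomorphic_imp_continuous_map)
  then show ?thesis by (simp add: continuous_map_in_subtopology)
qed

lemma continuous_chart_inv:
  assumes c: "is_chart X c"
  shows "continuous_map (top_of_set (snd c ` fst c)) X (chart_inv c)"
proof -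
  obtain h where h: "homeomorphic_maps (subtopology X (fst c)) (top_of_set (snd c ` fst c)) (snd c) h"
    using c by (auto simp: is_chart_def homeomorphic_map_maps)
  have D: "topspace (subtopology X (fst c)) = fst c"
    using is_chart_openD(1)[OF c] by (intro topspace_subtopology_subset openin_subset)
  have "continuous_map (top_of_set (snd c ` fst c)) (subtopology X (fst c)) h"
    using h by (simp add: homeomorphic_maps_def)
  moreover have "h x = chart_inv c x" if "x \<in> snd c ` fst c" for x
    using h D that chart_inv_chart[OF c] by (auto simp: homeomorphic_maps_def)
  ultimately have "continuous_map (top_of_set (snd c ` fst c)) (subtopology X (fst c)) (chart_inv c)"
    by (rule continuous_map_eq) simp
  then show ?thesis by (simp add: continuous_map_in_subtopology)
qed

lemma openin_chart_preimage:
  assumes c: "is_chart X c" and S: "open S"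
  shows "openin X {p \<in> fst c. snd c p \<in> S}"
proof -
  have D: "topspace (subtopology X (fst c)) = fst c"
    using is_chart_openD(1)[OF c] by (intro topspace_subtopology_subset openin_subset)
  have "openin (subtopology X (fst c)) {p \<in> fst c. snd c p \<in> S}"
    using openin_continuous_map_preimage[OF continuous_chart[OF c], of S] S unfolding D by simp
  then show ?thesis using is_chart_openD(1)[OF c] by (rule openin_trans_full)
qed

lemma open_chart_image:
  assumes c: "is_chart X c" and U: "openin X U"
  shows "open (snd c ` (fst c \<inter> U))"
proof -
  have "snd c ` (fst c \<inter> U) = {x \<in> snd c ` fst c. chart_inv c x \<in> U}"
    using chart_inv_chart[OF c] by (auto simp: image_iff)
  then show ?thesis using open_preimage[OF continuous_chart_inv[OF c] is_chart_openD(2)[OF c] U] by simp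
qed

lemma smooth_on_has_derivative:
  assumes "smooth_on f U" "open U" "x \<in> U"
  shows "(f has_derivative frechet_derivative f (at x)) (at x)"
proof -
  have "Ck (Suc 0) f U" using assms(1) by (simp add: smooth_on_iff_Ck)
  then show ?thesis by (rule Ck_Suc_has_derivative[OF assms(2) _ assms(3)])
qed

section \<open>Lie groups\<close>

lemma (in topological_group) nbhd_quotients:
  assumes V: "openin X V" "\<one> \<in> V"
  obtains N where "openin X N" "\<one> \<in> N" "\<And>a b. a \<in> N \<Longrightarrow> b \<in> N \<Longrightarrow> inv a \<otimes> b \<in> V"
proof -
  have "continuous_map (prod_topology X X) X (\<lambda>z. inv fst z \<otimes> snd z)"
    by (intro continuous_map_mult continuous_map_inv continuous_map_fst continuous_map_snd)
  from openin_continuous_map_preimage[OF this V(1)]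
  have op: "openin (prod_topology X X) {z \<in> carrier G \<times> carrier G. inv fst z \<otimes> snd z \<in> V}"
    by (simp add: topspace_eq)
  have one: "(\<one>, \<one>) \<in> {z \<in> carrier G \<times> carrier G. inv fst z \<otimes> snd z \<in> V}" using V(2) by simp
  obtain N1 N2 where N: "openin X N1" "openin X N2" "\<one> \<in> N1" "\<one> \<in> N2"
    "N1 \<times> N2 \<subseteq> {z \<in> carrier G \<times> carrier G. inv fst z \<otimes> snd z \<in> V}"
    using op[unfolded openin_prod_topology_alt, rule_format, OF one] by (elim exE conjE)
  show thesis
  proof (rule that[of "N1 \<inter> N2"])
    fix a b assume "a \<in> N1 \<inter> N2" "b \<in> N1 \<inter> N2"
    then have "(a, b) \<in> N1 \<times> N2" by blast
    with N(5) have "(a, b) \<in> {z \<in> carrier G \<times> carrier G. inv fst z \<otimes> snd z \<in> V}" by blast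
    then show "inv a \<otimes> b \<in> V" by simp
  qed (use N in auto)
qed

lemma (in topological_group) nbhd_products:
  assumes V: "openin X V" "\<one> \<in> V"
  obtains N where "openin X N" "\<one> \<in> N" "\<And>a b. a \<in> N \<Longrightarrow> b \<in> N \<Longrightarrow> a \<otimes> b \<in> V"
proof -
  obtain N where N: "openin X N" "\<one> \<in> N" "\<And>a b. a \<in> N \<Longrightarrow> b \<in> N \<Longrightarrow> inv a \<otimes> b \<in> V"
    using nbhd_quotients[OF V] by metis
  obtain K where K: "openin X K" "\<one> \<in> K" "\<And>a b. a \<in> K \<Longrightarrow> b \<in> K \<Longrightarrow> inv a \<otimes> b \<in> N"
    using nbhd_quotients[OF N(1,2)] by metis
  have Kc: "K \<subseteq> carrier G" using openin_subset[OF K(1)] topspace_eq by simp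
  show thesis
  proof (rule that[of K])
    fix a b assume ab: "a \<in> K" "b \<in> K"
    have "inv a \<in> N" using K(3)[OF ab(1) K(2)] ab Kc by auto
    moreover have "b \<in> N" using K(3)[OF K(2) ab(2)] ab Kc by auto
    ultimately show "a \<otimes> b \<in> V" using N(3)[of "inv a" b] ab Kc by auto
  qed (use K in auto)
qed

text \<open>Near \<open>x\<close> one has \<open>F y = F x \<cdot> F(x\<^sup>-\<^sup>1 y)\<close>, which reduces continuity at \<open>x\<close> to continuity near the
  identity.\<close>

lemma continuous_map_hom:
  assumes G: "topological_group G X" and H: "topological_group H Y" and F: "F \<in> hom G H"
    and V: "openin X V" "\<one>\<^bsub>G\<^esub> \<in> V" and cont: "continuous_map (subtopology X V) Y F"
  shows "continuous_map X Y F"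
proof -
  interpret G: topological_group G X by fact
  interpret H: topological_group H Y by fact
  have Vc: "V \<subseteq> carrier G" using openin_subset[OF V(1)] G.topspace_eq by simp
  show ?thesis
    unfolding continuous_map_def
  proof (intro conjI allI impI)
    show "F \<in> topspace X \<rightarrow> topspace Y"
      using F by (auto simp: G.topspace_eq H.topspace_eq hom_def)
    fix U assume U: "openin Y U"
    show "openin X {x \<in> topspace X. F x \<in> U}"
    proof (subst openin_subopen, intro ballI)
      fix x assume "x \<in> {x \<in> topspace X. F x \<in> U}"
      then have x: "x \<in> carrier G" "F x \<in> U" by (auto simp: G.topspace_eq)
      define N where "N = {y \<in> topspace X. inv\<^bsub>G\<^esub> x \<otimes>\<^bsub>G\<^esub> y \<in> V}"
      have l: "continuous_map X X (\<lambda>y. inv\<^bsub>G\<^esub> x \<otimes>\<^bsub>G\<^esub> y)"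
        using x by (intro G.continuous_map_mult) (auto simp: G.topspace_eq)
      have N: "openin X N"
        unfolding N_def using l V(1) by (rule openin_continuous_map_preimage)
      have tN: "topspace (subtopology X N) = N"
        using openin_subset[OF N] by (rule topspace_subtopology_subset)
      have "continuous_map (subtopology X N) (subtopology X V) (\<lambda>y. inv\<^bsub>G\<^esub> x \<otimes>\<^bsub>G\<^esub> y)"
        unfolding continuous_map_in_subtopology
        using continuous_map_from_subtopology[OF l] tN by (auto simp: N_def)
      from continuous_map_compose[OF this cont]
      have "continuous_map (subtopology X N) Y (\<lambda>y. F (inv\<^bsub>G\<^esub> x \<otimes>\<^bsub>G\<^esub> y))" by (simp add: o_def)
      moreover have "F x \<in> topspace Y" using F x by (auto simp: hom_def H.topspace_eq)
      ultimately have "continuous_map (subtopology X N) Y (\<lambda>y. F x \<otimes>\<^bsub>H\<^esub> F (inv\<^bsub>G\<^esub> x \<otimes>\<^bsub>G\<^esub> y))"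
        by (intro H.continuous_map_mult) auto
      from openin_continuous_map_preimage[OF this U]
      have "openin (subtopology X N) {y \<in> N. F x \<otimes>\<^bsub>H\<^esub> F (inv\<^bsub>G\<^esub> x \<otimes>\<^bsub>G\<^esub> y) \<in> U}"
        unfolding tN .
      moreover have "F x \<otimes>\<^bsub>H\<^esub> F (inv\<^bsub>G\<^esub> x \<otimes>\<^bsub>G\<^esub> y) = F y" if "y \<in> N" for y
      proof -
        have y: "y \<in> carrier G" using that by (simp add: N_def G.topspace_eq)
        have "F x \<otimes>\<^bsub>H\<^esub> F (inv\<^bsub>G\<^esub> x \<otimes>\<^bsub>G\<^esub> y) = F (x \<otimes>\<^bsub>G\<^esub> (inv\<^bsub>G\<^esub> x \<otimes>\<^bsub>G\<^esub> y))"
          using F x y by (simp add: hom_mult)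
        then show ?thesis using x y by (simp flip: G.m_assoc)
      qed
      ultimately have "openin (subtopology X N) {y \<in> N. F y \<in> U}" by (simp cong: conj_cong)
      then have "openin X {y \<in> N. F y \<in> U}" using N by (rule openin_trans_full)
      moreover have "x \<in> {y \<in> N. F y \<in> U}" using x V(2) by (simp add: N_def G.topspace_eq)
      moreover have "{y \<in> N. F y \<in> U} \<subseteq> {x \<in> topspace X. F x \<in> U}" by (auto simp: N_def)
      ultimately show "\<exists>T. openin X T \<and> x \<in> T \<and> T \<subseteq> {x \<in> topspace X. F x \<in> U}" by blast
    qed
  qed
qed

locale lie_grp =
  fixes G :: "('m, 'e::euclidean_space) lie_group" (structure)
  assumes lie: "is_lie_group G"
begin

abbreviation X where "X \<equiv> mtop (lmfd G)"

lemma carrier_topspace: "topspace X = carrier G"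
  using lie by (simp add: is_lie_group_def)

lemma chart: "c \<in> atlas (lmfd G) \<Longrightarrow> is_chart X c"
  using lie by (simp add: is_lie_group_def smooth_manifold_def)

lemma chart_subset: "c \<in> atlas (lmfd G) \<Longrightarrow> fst c \<subseteq> carrier G"
  using openin_subset[OF is_chart_openD(1)[OF chart]] carrier_topspace by simp

lemma ex_chart: "p \<in> carrier G \<Longrightarrow> \<exists>c. c \<in> charts_at (lmfd G) p"
  using lie carrier_topspace unfolding is_lie_group_def smooth_manifold_def charts_at_def by blast

end

sublocale lie_grp \<subseteq> topological_group G X
proof (intro topological_group.intro topological_group_axioms.intro)
  show "group G" using lie by (simp add: is_lie_group_def)
  show "topspace X = carrier G" by (rule carrier_topspace)
  have "continuous_map (subtopology (prod_topology X X) (carrier G \<times> carrier G)) X (\<lambda>(a, b). a \<otimes> b)"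
    using lie unfolding is_lie_group_def smooth_map_def product_mfd_def mfd.select_convs
    by (elim conjE)
  moreover have "carrier G \<times> carrier G = topspace (prod_topology X X)" by (simp add: carrier_topspace)
  ultimately show "continuous_map (prod_topology X X) X (\<lambda>(a, b). a \<otimes> b)"
    by (simp only: subtopology_topspace)
  have "continuous_map (subtopology X (carrier G)) X (\<lambda>a. inv a)"
    using lie unfolding is_lie_group_def smooth_map_def by (elim conjE)
  then show "continuous_map X X (\<lambda>a. inv a)" by (simp add: flip: carrier_topspace)
qed

context lie_grp
begin

text \<open>A left translation is the restriction of the multiplication, read in a product chart, to a
  slice.\<close>

lemma left_translation_smooth:
  assumes a: "a \<in> carrier G" and c: "c \<in> atlas (lmfd G)" and d: "d \<in> atlas (lmfd G)"
  shows "open {x \<in> snd c ` fst c. a \<otimes> chart_inv c x \<in> fst d}"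
    and "smooth_on (\<lambda>x. snd d (a \<otimes> chart_inv c x)) {x \<in> snd c ` fst c. a \<otimes> chart_inv c x \<in> fst d}"
proof -
  obtain e where e: "e \<in> atlas (lmfd G)" "a \<in> fst e" using ex_chart[OF a] by (auto simp: charts_at_def)
  let ?Oc = "snd c ` fst c" and ?Oe = "snd e ` fst e"
  let ?S = "{x \<in> ?Oc. a \<otimes> chart_inv c x \<in> fst d}"
  define R where "R = {z \<in> ?Oe \<times> ?Oc. chart_inv e (fst z) \<otimes> chart_inv c (snd z) \<in> fst d}"
  have cont: "continuous_map (top_of_set ?Oc) X (chart_inv c)" "continuous_map (top_of_set ?Oe) X (chart_inv e)"
    using c e by (auto intro: continuous_chart_inv chart)
  have "continuous_map (top_of_set ?Oc) X (\<lambda>x. a \<otimes> chart_inv c x)"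
    using a by (intro continuous_map_mult cont) (simp add: carrier_topspace)
  then show op: "open ?S"
    by (rule open_preimage[OF _ is_chart_openD(2)[OF chart[OF c]] is_chart_openD(1)[OF chart[OF d]]])
  have "continuous_map (prod_topology (top_of_set ?Oe) (top_of_set ?Oc)) X
      (\<lambda>z. chart_inv e (fst z) \<otimes> chart_inv c (snd z))"
    by (intro continuous_map_mult
        continuous_map_compose[OF continuous_map_fst cont(2), unfolded o_def]
        continuous_map_compose[OF continuous_map_snd cont(1), unfolded o_def])
  then have "continuous_map (top_of_set (?Oe \<times> ?Oc)) X (\<lambda>z. chart_inv e (fst z) \<otimes> chart_inv c (snd z))"
    by (simp add: subtopology_Times[symmetric] euclidean_product_topology)
  from open_preimage[OF this open_Times[OF is_chart_openD(2)[OF chart[OF e(1)]] is_chart_openD(2)[OF chart[OF c]]]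
      is_chart_openD(1)[OF chart[OF d]]]
  have openR: "open R" unfolding R_def .
  let ?pc = "(fst e \<times> fst c, map_prod (snd e) (snd c))"
  have "?pc \<in> atlas (product_mfd (lmfd G) (lmfd G))"
    using c e unfolding product_mfd_def mfd.select_convs by blast
  then have "smooth_on (snd d \<circ> (\<lambda>(a, b). a \<otimes> b) \<circ> chart_inv ?pc)
      (snd ?pc ` {p \<in> fst ?pc \<inter> carrier G \<times> carrier G. (\<lambda>(a, b). a \<otimes> b) p \<in> fst d})"
    using lie d unfolding is_lie_group_def smooth_map_def by blast
  moreover have inv: "chart_inv ?pc (x, y) = (chart_inv e x, chart_inv c y)" if "x \<in> ?Oe" "y \<in> ?Oc" for x y
  proof -
    have "inj_on (map_prod (snd e) (snd c)) (fst e \<times> fst c)"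
    proof (rule inj_onI)
      fix z z' assume "z \<in> fst e \<times> fst c" "z' \<in> fst e \<times> fst c" "map_prod (snd e) (snd c) z = map_prod (snd e) (snd c) z'"
      then show "z = z'"
        using chart_inv_chart[OF chart[OF e(1)]] chart_inv_chart[OF chart[OF c]]
        by (cases z, cases z') (simp, metis)
    qed
    then have "inv_into (fst e \<times> fst c) (map_prod (snd e) (snd c)) (map_prod (snd e) (snd c) (chart_inv e x, chart_inv c y))
      = (chart_inv e x, chart_inv c y)"
      using that by (intro inv_into_f_f) (auto intro: chart_inv_in)
    then show ?thesis using that by (simp add: chart_chart_inv)
  qed
  moreover have "snd ?pc ` {p \<in> fst ?pc \<inter> carrier G \<times> carrier G. (\<lambda>(a, b). a \<otimes> b) p \<in> fst d} = R"
  proof (intro equalityI subsetI)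
    fix z assume "z \<in> snd ?pc ` {p \<in> fst ?pc \<inter> carrier G \<times> carrier G. (\<lambda>(a, b). a \<otimes> b) p \<in> fst d}"
    then show "z \<in> R"
      using chart_inv_chart[OF chart[OF e(1)]] chart_inv_chart[OF chart[OF c]] by (auto simp: R_def)
  next
    fix z assume z: "z \<in> R"
    then have "z = snd ?pc (chart_inv e (fst z), chart_inv c (snd z))"
      by (auto simp: R_def chart_chart_inv)
    moreover have "(chart_inv e (fst z), chart_inv c (snd z)) \<in> {p \<in> fst ?pc \<inter> carrier G \<times> carrier G. (\<lambda>(a, b). a \<otimes> b) p \<in> fst d}"
      using z chart_subset[OF c] chart_subset[OF e(1)] by (auto simp: R_def chart_inv_in subset_iff)
    ultimately show "z \<in> snd ?pc ` {p \<in> fst ?pc \<inter> carrier G \<times> carrier G. (\<lambda>(a, b). a \<otimes> b) p \<in> fst d}" by (rule image_eqI)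
  qed
  ultimately have sm: "smooth_on (snd d \<circ> (\<lambda>(a, b). a \<otimes> b) \<circ> chart_inv ?pc) R" by simp
  define H where "H = snd d \<circ> (\<lambda>(a, b). a \<otimes> b) \<circ> chart_inv ?pc"
  have CkH: "Ck k H R" for k
    using sm unfolding smooth_on_iff_Ck H_def by (rule spec)
  have ea: "chart_inv e (snd e a) = a" by (rule chart_inv_chart[OF chart[OF e(1)] e(2)])
  have sub: "(\<lambda>x. (snd e a, x)) ` ?S \<subseteq> R" using e ea by (auto simp: R_def)
  have "Ck k (\<lambda>x. H (snd e a, x)) ?S" for k
    by (intro Ck_comp[OF op openR _ CkH sub] Ck_Pair Ck_const Ck_ident op)
  moreover have "H (snd e a, x) = snd d (a \<otimes> chart_inv c x)" if "x \<in> ?S" for x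
    using inv[of "snd e a" x] that e ea unfolding H_def by simp
  ultimately have "Ck k (\<lambda>x. snd d (a \<otimes> chart_inv c x)) ?S" for k
    by (subst Ck_cong[OF op, where g = "\<lambda>x. H (snd e a, x)"]) simp_all
  then show "smooth_on (\<lambda>x. snd d (a \<otimes> chart_inv c x)) ?S" by (simp add: smooth_on_iff_Ck)
qed

lemma left_translation_has_derivative:
  assumes a: "a \<in> carrier G" and c: "c \<in> charts_at (lmfd G) p" and d: "d \<in> charts_at (lmfd G) (a \<otimes> p)"
  shows "((\<lambda>x. snd d (a \<otimes> chart_inv c x)) has_derivative differential c d (\<lambda>b. a \<otimes> b) p) (at (snd c p))"
proof -
  have c': "c \<in> atlas (lmfd G)" "p \<in> fst c" and d': "d \<in> atlas (lmfd G)" "a \<otimes> p \<in> fst d"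
    using c d by (auto simp: charts_at_def)
  have "snd c p \<in> {x \<in> snd c ` fst c. a \<otimes> chart_inv c x \<in> fst d}"
    using c' d' chart_inv_chart[OF chart[OF c'(1)]] by simp
  from smooth_on_has_derivative[OF left_translation_smooth(2,1)[OF a c'(1) d'(1)] this]
  show ?thesis by (simp add: differential_def o_def)
qed

end

section \<open>Global coordinates on \<open>G\<^sub>\<mu>\<close>\<close>

locale G_mu = lie_grp G for G :: "('m, real \<times> (real^'n)) lie_group" (structure) +
  fixes B :: "real^'n^'n" and g :: "('m, real \<times> (real^'n)) metric"
    and \<xi> :: "real \<times> (real^'n) \<Rightarrow> ('m, real \<times> (real^'n)) vfield"
  assumes sc: "simply_connected_space X"
    and metric: "left_invariant_metric G g"
    and iso: "lie_algebra_iso (mu B) G \<xi>"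
    and orth: "\<And>c v w. c \<in> charts_at (lmfd G) \<one> \<Longrightarrow> g c \<one> (\<xi> v c \<one>) (\<xi> w c \<one>) = v \<bullet> w"
begin

lemma left_invariant: "left_invariant_vfield G (\<xi> v)"
  using iso unfolding lie_algebra_iso_def by blast

lemma frame_left_translation:
  assumes "a \<in> carrier G" "p \<in> carrier G" "c \<in> charts_at (lmfd G) p" "d \<in> charts_at (lmfd G) (a \<otimes> p)"
  shows "\<xi> v d (a \<otimes> p) = differential c d (\<lambda>b. a \<otimes> b) p (\<xi> v c p)"
  using left_invariant[of v] assms unfolding left_invariant_vfield_def by blast

text \<open>The values of the frame at \<open>p\<close> are the images of those at the identity under the differential
  of a left translation.\<close>

lemma frame_linear:
  assumes p: "p \<in> carrier G" and d: "d \<in> charts_at (lmfd G) p"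
  shows "linear (\<lambda>v. \<xi> v d p)"
proof -
  obtain c where c: "c \<in> charts_at (lmfd G) \<one>" using ex_chart[OF one_closed] by blast
  have d': "d \<in> charts_at (lmfd G) (p \<otimes> \<one>)" using p d by simp
  have "linear (differential c d (\<lambda>b. p \<otimes> b) \<one>)"
    using left_translation_has_derivative[OF p c d'] by (rule has_derivative_linear)
  moreover have "linear (\<lambda>v. \<xi> v c \<one>)" using iso c unfolding lie_algebra_iso_def by blast
  ultimately have "linear (differential c d (\<lambda>b. p \<otimes> b) \<one> \<circ> (\<lambda>v. \<xi> v c \<one>))" by (intro linear_compose)
  moreover have "\<xi> v d p = differential c d (\<lambda>b. p \<otimes> b) \<one> (\<xi> v c \<one>)" for v
    using frame_left_translation[OF p one_closed c d', of v] p by simp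
  ultimately show ?thesis by (simp add: o_def)
qed

lemma metric_compatible:
  assumes "p \<in> carrier G" "c \<in> charts_at (lmfd G) p" "d \<in> charts_at (lmfd G) p"
  shows "g c p v w = g d p (differential c d id p v) (differential c d id p w)"
proof -
  have "riemannian_metric (lmfd G) g" using metric by (simp add: left_invariant_metric_def)
  then have "\<forall>p\<in>topspace X. \<forall>c\<in>charts_at (lmfd G) p. \<forall>d\<in>charts_at (lmfd G) p. \<forall>v w.
       g c p v w = g d p (differential c d id p v) (differential c d id p w)"
    unfolding riemannian_metric_def by blast
  then show ?thesis using assms unfolding carrier_topspace by blast
qed

lemma frame_change_of_chart:
  assumes "p \<in> carrier G" "c \<in> charts_at (lmfd G) p" "d \<in> charts_at (lmfd G) p"
  shows "\<xi> v d p = differential c d id p (\<xi> v c p)"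
  using left_invariant[of v] assms carrier_topspace
  unfolding left_invariant_vfield_def smooth_vfield_def by blast

text \<open>Orthonormality propagates from the identity, because left translations preserve both the metric
  and the frame. It also provides the linear independence of the frame at all points.\<close>

lemma frame_orthonormal:
  assumes p: "p \<in> carrier G" and d: "d \<in> charts_at (lmfd G) p"
  shows "g d p (\<xi> v d p) (\<xi> w d p) = v \<bullet> w"
proof -
  obtain c where c: "c \<in> charts_at (lmfd G) \<one>" using ex_chart[OF one_closed] by blast
  define e where "e = (SOME e. e \<in> charts_at (lmfd G) (p \<otimes> \<one>))"
  have e: "e \<in> charts_at (lmfd G) (p \<otimes> \<one>)"
    unfolding e_def using ex_chart[of "p \<otimes> \<one>"] p by (intro someI_ex[of "\<lambda>e. e \<in> charts_at (lmfd G) (p \<otimes> \<one>)"]) simp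
  have "pullback (\<lambda>b. p \<otimes> b) (lmfd G) g c \<one> (\<xi> v c \<one>) (\<xi> w c \<one>) = g c \<one> (\<xi> v c \<one>) (\<xi> w c \<one>)"
    using metric p c unfolding left_invariant_metric_def by blast
  also have "\<dots> = v \<bullet> w" by (rule orth[OF c])
  also have "pullback (\<lambda>b. p \<otimes> b) (lmfd G) g c \<one> (\<xi> v c \<one>) (\<xi> w c \<one>)
      = g e (p \<otimes> \<one>) (\<xi> v e (p \<otimes> \<one>)) (\<xi> w e (p \<otimes> \<one>))"
    unfolding pullback_def Let_def e_def[symmetric] frame_left_translation[OF p one_closed c e] ..
  finally have 1: "g e p (\<xi> v e p) (\<xi> w e p) = v \<bullet> w" using p by simp
  have e': "e \<in> charts_at (lmfd G) p" using e p by simp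
  show ?thesis
    unfolding metric_compatible[OF p d e'] frame_change_of_chart[OF p d e', symmetric] by (rule 1)
qed

lemma frame_inj:
  assumes "p \<in> carrier G" "d \<in> charts_at (lmfd G) p"
  shows "inj (\<lambda>v. \<xi> v d p)"
proof -
  have "v = 0" if "\<xi> v d p = 0" for v
  proof -
    have "\<xi> 0 d p = 0" using linear_0[OF frame_linear[OF assms]] .
    with frame_orthonormal[OF assms, of v v] frame_orthonormal[OF assms, of 0 0] that
    show ?thesis by simp
  qed
  then show ?thesis using linear_injective_0[OF frame_linear[OF assms]] by blast
qed

subsection \<open>The frame in a chart\<close>

definition chart_frame :: "('m, real \<times> (real^'n)) chart \<Rightarrow> real \<times> (real^'n) \<Rightarrow> ((real \<times> (real^'n)) \<Rightarrow>\<^sub>L (real \<times> (real^'n)))" where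
  "chart_frame c x = (\<Sum>b\<in>Basis. rank_one b (\<xi> b c (chart_inv c x)))"

definition chart_coframe :: "('m, real \<times> (real^'n)) chart \<Rightarrow> real \<times> (real^'n) \<Rightarrow> ((real \<times> (real^'n)) \<Rightarrow>\<^sub>L (real \<times> (real^'n)))" where
  "chart_coframe c x = (\<Sum>b\<in>Basis. rank_one b (inv_into UNIV (blinfun_apply (chart_frame c x)) b))"

lemma chart_inv_charts_at:
  assumes "c \<in> atlas (lmfd G)" "x \<in> snd c ` fst c"
  shows "c \<in> charts_at (lmfd G) (chart_inv c x)" "chart_inv c x \<in> carrier G"
  using assms(1) chart_inv_in[OF assms(2)] chart_subset[OF assms(1)] by (auto simp: charts_at_def)

lemma chart_frame_apply:
  assumes "c \<in> atlas (lmfd G)" "x \<in> snd c ` fst c"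
  shows "chart_frame c x v = \<xi> v c (chart_inv c x)"
  using linear_eq_sum_rank_one[OF frame_linear[OF chart_inv_charts_at(2,1)[OF assms]]]
  unfolding chart_frame_def by metis

lemma chart_frame_chart:
  assumes "p \<in> carrier G" "c \<in> charts_at (lmfd G) p"
  shows "chart_frame c (snd c p) v = \<xi> v c p"
  using assms chart_inv_chart[OF chart] by (subst chart_frame_apply) (auto simp: charts_at_def)

lemma bij_chart_frame:
  assumes "c \<in> atlas (lmfd G)" "x \<in> snd c ` fst c"
  shows "bij (blinfun_apply (chart_frame c x))"
proof -
  have "blinfun_apply (chart_frame c x) = (\<lambda>v. \<xi> v c (chart_inv c x))" using chart_frame_apply[OF assms] by auto
  then have "inj (blinfun_apply (chart_frame c x))" using frame_inj[OF chart_inv_charts_at(2,1)[OF assms]] by simp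
  then show ?thesis
    by (intro bijI linear_injective_imp_surjective) (auto simp: bounded_linear.linear[OF blinfun.bounded_linear_right])
qed

lemma chart_coframe_apply:
  assumes "c \<in> atlas (lmfd G)" "x \<in> snd c ` fst c"
  shows "blinfun_apply (chart_coframe c x) = inv_into UNIV (blinfun_apply (chart_frame c x))"
proof -
  have l: "linear (blinfun_apply (chart_frame c x))" by (rule bounded_linear.linear[OF blinfun.bounded_linear_right])
  have "linear (inv_into UNIV (blinfun_apply (chart_frame c x)))"
    using bij_chart_frame[OF assms] l by (intro inj_linear_imp_inv_linear bij_is_inj)
  from linear_eq_sum_rank_one[OF this] show ?thesis by (simp add: chart_coframe_def)
qed

lemma mu_frame_chart:
  assumes c: "c \<in> atlas (lmfd G)"
  shows "mu_frame B (snd c ` fst c) (chart_frame c) (chart_coframe c)"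
proof
  let ?O = "snd c ` fst c"
  show O: "open ?O" by (rule is_chart_openD(2)[OF chart[OF c]])
  have s: "smooth_on (\<lambda>x. \<xi> v c (chart_inv c x)) ?O" for v
    using left_invariant[of v] c unfolding left_invariant_vfield_def smooth_vfield_def by blast
  then show smooth: "smooth_on (chart_frame c) ?O"
    unfolding chart_frame_def[abs_def] smooth_on_iff_Ck
    by (intro allI Ck_blinfun[OF O, where f = "\<lambda>x v. \<xi> v c (chart_inv c x)"]) (rule spec)
  fix x assume x: "x \<in> ?O"
  have b: "bij (blinfun_apply (chart_frame c x))" by (rule bij_chart_frame[OF c x])
  show "chart_coframe c x o\<^sub>L chart_frame c x = id_blinfun" "chart_frame c x o\<^sub>L chart_coframe c x = id_blinfun"
    by (auto intro!: blinfun_eqI simp: chart_coframe_apply[OF c x] inv_f_f[OF bij_is_inj[OF b]] surj_f_inv_f[OF bij_is_surj[OF b]])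
  fix v w
  have d: "frechet_derivative (\<lambda>x. \<xi> w c (chart_inv c x)) (at x) u = frechet_derivative (chart_frame c) (at x) u w" for u w
  proof -
    have "frechet_derivative (\<lambda>x. \<xi> w c (chart_inv c x)) (at x) = frechet_derivative (\<lambda>x. chart_frame c x w) (at x)"
      by (rule frechet_derivative_cong_open[OF O x]) (simp add: chart_frame_apply[OF c])
    moreover have "((\<lambda>x. chart_frame c x w) has_derivative (\<lambda>u. frechet_derivative (chart_frame c) (at x) u w)) (at x)"
      by (rule bounded_linear.has_derivative[OF bounded_bilinear.bounded_linear_left[OF bounded_bilinear_blinfun_apply]
        smooth_on_has_derivative[OF smooth O x]])
    from frechet_derivative_at[OF this, symmetric]
    have "frechet_derivative (\<lambda>x. chart_frame c x w) (at x) = (\<lambda>u. frechet_derivative (chart_frame c) (at x) u w)" .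
    ultimately show ?thesis by (simp only:)
  qed
  have "vfield_bracket (\<xi> v) (\<xi> w) c (chart_inv c x) = \<xi> (mu B v w) c (chart_inv c x)"
    using iso chart_inv_charts_at[OF c x] unfolding lie_algebra_iso_def by blast
  then show "frechet_derivative (chart_frame c) (at x) (chart_frame c x v) w - frechet_derivative (chart_frame c) (at x) (chart_frame c x w) v = chart_frame c x (mu B v w)"
    unfolding vfield_bracket_def chart_chart_inv[OF x] d chart_frame_apply[OF c x] .
qed

subsection \<open>The local isomorphism with the model\<close>

text \<open>At the identity the derivative of the adapted coordinates is the coframe, which is invertible, so
  the inverse function theorem applies; the derivative of the inverse is the frame.\<close>

lemma local_coordinates:
  obtains c \<psi> \<sigma> U V where "c \<in> charts_at (lmfd G) \<one>" "open U" "snd c \<one> \<in> U" "U \<subseteq> snd c ` fst c"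
    "open V" "\<psi> (snd c \<one>) = 0" "homeomorphism U V \<psi> \<sigma>"
    "\<And>x. x \<in> U \<Longrightarrow> (\<psi> has_derivative (\<lambda>u. model_frame B (\<psi> x) (chart_coframe c x u))) (at x)"
    "(\<sigma> has_derivative (\<lambda>v. \<xi> v c \<one>)) (at 0)"
proof -
  obtain c where c: "c \<in> charts_at (lmfd G) \<one>" using ex_chart[OF one_closed] by blast
  then have c': "c \<in> atlas (lmfd G)" "\<one> \<in> fst c" by (auto simp: charts_at_def)
  interpret mu_frame B "snd c ` fst c" "chart_frame c" "chart_coframe c" by (rule mu_frame_chart[OF c'(1)])
  let ?x1 = "snd c \<one>"
  have x1: "?x1 \<in> snd c ` fst c" using c' by blast
  obtain r where r: "0 < r" "ball ?x1 r \<subseteq> snd c ` fst c"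
    using openU x1 open_contains_ball by blast
  obtain \<psi> where \<psi>: "\<psi> ?x1 = 0"
    "\<And>x. x \<in> ball ?x1 r \<Longrightarrow> (\<psi> has_derivative (\<lambda>u. model_frame B (\<psi> x) (chart_coframe c x u))) (at x)"
    using adapted_coordinates[OF open_ball convex_ball _ r(2), of ?x1] r(1) by auto
  have CkT: "Ck k (chart_coframe c) (ball ?x1 r)" for k
    using smoothT by (intro Ck_subset[OF open_ball r(2) openU]) (simp add: smooth_on_iff_Ck)
  have "smooth_on \<psi> (ball ?x1 r)"
  proof (rule smooth_on_bootstrap[OF open_ball \<psi>(2)])
    fix k v assume "Ck k \<psi> (ball ?x1 r)"
    then show "Ck k (\<lambda>x. model_frame B (\<psi> x) (chart_coframe c x v)) (ball ?x1 r)"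
      by (intro Ck_model_frame Ck_blinfun_apply CkT Ck_const open_ball)
  qed
  then have "Ck (Suc 0) \<psi> (ball ?x1 r)" by (simp add: smooth_on_iff_Ck)
  then obtain f' where f': "\<And>x. x \<in> ball ?x1 r \<Longrightarrow> (\<psi> has_derivative blinfun_apply (f' x)) (at x)"
    "Ck 0 f' (ball ?x1 r)"
    by (rule Ck_Suc_blinfun[OF open_ball]) (rule that)
  have f'_eq: "blinfun_apply (f' x) = (\<lambda>u. model_frame B (\<psi> x) (chart_coframe c x u))" if "x \<in> ball ?x1 r" for x
    using has_derivative_unique[OF f'(1)[OF that] \<psi>(2)[OF that]] .
  have x1r: "?x1 \<in> ball ?x1 r" using r(1) by simp
  have f'1: "blinfun_apply (f' ?x1) = blinfun_apply (chart_coframe c ?x1)"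
    unfolding f'_eq[OF x1r] \<psi>(1) by (simp add: model_frame_def fun_eq_iff)
  have "chart_frame c ?x1 o\<^sub>L f' ?x1 = id_blinfun"
    by (intro blinfun_eqI) (simp add: f'1 LT_apply[OF x1])
  moreover have "continuous_on (ball ?x1 r) f'" using f'(2) by simp
  ultimately obtain U V \<sigma> \<sigma>' where U: "open U" "U \<subseteq> ball ?x1 r" "?x1 \<in> U" and V: "open V" "\<psi> ?x1 \<in> V"
    and hom: "homeomorphism U V \<psi> \<sigma>"
    and \<sigma>': "\<And>y. y \<in> V \<Longrightarrow> (\<sigma> has_derivative (\<sigma>' y)) (at y)" "\<And>y. y \<in> V \<Longrightarrow> \<sigma>' y = inv_into UNIV (blinfun_apply (f' (\<sigma> y)))"
    using inverse_function_theorem[OF open_ball f'(1) _ x1r, of "chart_frame c ?x1"] by metis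
  have "\<sigma> 0 = ?x1" using hom U(3) \<psi>(1) by (auto simp: homeomorphism_def)
  moreover have "bij (blinfun_apply (chart_frame c ?x1))" by (rule bij_chart_frame[OF c'(1) x1])
  ultimately have "\<sigma>' 0 = blinfun_apply (chart_frame c ?x1)"
    using \<sigma>'(2)[of 0] V(2) \<psi>(1) f'1 chart_coframe_apply[OF c'(1) x1] by (simp add: inv_inv_eq)
  then have "(\<sigma> has_derivative (\<lambda>v. \<xi> v c \<one>)) (at 0)"
    using \<sigma>'(1)[of 0] V(2) \<psi>(1) chart_frame_chart[OF one_closed c] by (metis ext)
  with c U V \<psi> hom show thesis by (intro that) (use r(2) in auto)
qed

end

context G_mu
begin

text \<open>Both the coordinates near the identity and their local inverse are local homomorphisms, so
  they extend to homomorphisms between the simply connected groups, which are inverse to each other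
  because they are so near the identity.\<close>

lemma global_isomorphism:
  obtains F \<Phi> c \<rho> \<sigma> where "F \<in> hom (model_group B) G" "\<Phi> \<in> hom G (model_group B)"
    "\<And>p. p \<in> carrier G \<Longrightarrow> F (\<Phi> p) = p" "\<And>x. \<Phi> (F x) = x"
    "continuous_map euclidean X F" "continuous_map X euclidean \<Phi>"
    "c \<in> charts_at (lmfd G) \<one>" "0 < \<rho>"
    "\<And>y. y \<in> ball 0 \<rho> \<Longrightarrow> F y \<in> fst c" "\<And>y. y \<in> ball 0 \<rho> \<Longrightarrow> snd c (F y) = \<sigma> y"
    "(\<sigma> has_derivative (\<lambda>v. \<xi> v c \<one>)) (at 0)"
proof -
  obtain c \<psi> \<sigma> U V where c: "c \<in> charts_at (lmfd G) \<one>" and U: "open U" "snd c \<one> \<in> U" "U \<subseteq> snd c ` fst c"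
    and V: "open V" and \<psi>0: "\<psi> (snd c \<one>) = 0" and hom: "homeomorphism U V \<psi> \<sigma>"
    and d\<psi>: "\<And>x. x \<in> U \<Longrightarrow> (\<psi> has_derivative (\<lambda>u. model_frame B (\<psi> x) (chart_coframe c x u))) (at x)"
    and d\<sigma>: "(\<sigma> has_derivative (\<lambda>v. \<xi> v c \<one>)) (at 0)"
    by (rule local_coordinates) (rule that)
  have c': "c \<in> atlas (lmfd G)" "\<one> \<in> fst c" using c by (auto simp: charts_at_def)
  have ch: "is_chart X c" by (rule chart[OF c'(1)])
  interpret mu_frame B "snd c ` fst c" "chart_frame c" "chart_coframe c" by (rule mu_frame_chart[OF c'(1)])
  let ?x1 = "snd c \<one>" and ?O = "snd c ` fst c"
  have x1: "?x1 \<in> ?O" using c'(2) by blast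
  have h: "\<And>x. x \<in> U \<Longrightarrow> \<psi> x \<in> V \<and> \<sigma> (\<psi> x) = x" "\<And>y. y \<in> V \<Longrightarrow> \<sigma> y \<in> U \<and> \<psi> (\<sigma> y) = y"
    "continuous_on U \<psi>" "continuous_on V \<sigma>"
    using hom by (auto simp: homeomorphism_def)
  have \<sigma>0: "0 \<in> V" "\<sigma> 0 = ?x1" using h(1)[OF U(2)] \<psi>0 by auto
  have ci: "chart_inv c (snd c p) = p" if "p \<in> fst c" for p using that by (rule chart_inv_chart[OF ch])
  have ci1: "chart_inv c ?x1 = \<one>" by (rule ci[OF c'(2)])
  have cU: "chart_inv c x \<in> fst c" "snd c (chart_inv c x) = x" if "x \<in> U" for x
    using chart_inv_in[of x c] chart_chart_inv[of x c] subsetD[OF U(3) that] by blast+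
  have fc: "p \<in> carrier G" if "p \<in> fst c" for p using that chart_subset[OF c'(1)] by blast
  have small: "\<exists>e>0. ball ?x1 e \<subseteq> U \<and> (\<forall>p\<in>fst c. snd c p \<in> ball ?x1 e \<longrightarrow> p \<in> N)"
    if "openin X N" "\<one> \<in> N" for N
  proof -
    have "open (snd c ` (fst c \<inter> N) \<inter> U)" using open_chart_image[OF ch that(1)] U(1) by (rule open_Int)
    moreover have "?x1 \<in> snd c ` (fst c \<inter> N) \<inter> U" using that(2) c'(2) U(2) by blast
    ultimately obtain e where e: "0 < e" "ball ?x1 e \<subseteq> snd c ` (fst c \<inter> N) \<inter> U"
      using open_contains_ball by blast
    have "p \<in> N" if p: "p \<in> fst c" "snd c p \<in> ball ?x1 e" for p
    proof -
      obtain q where q: "q \<in> fst c" "q \<in> N" "snd c p = snd c q" using e(2) p by blast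
      then show ?thesis using ci[OF q(1)] ci[OF p(1)] by simp
    qed
    with e show ?thesis by blast
  qed
  define P where "P = {p \<in> fst c. snd c p \<in> U}"
  have P: "openin X P" "\<one> \<in> P"
    unfolding P_def using openin_chart_preimage[OF ch U(1)] c'(2) U(2) by auto
  obtain N0 where N0: "openin X N0" "\<one> \<in> N0" "\<And>a b. a \<in> N0 \<Longrightarrow> b \<in> N0 \<Longrightarrow> a \<otimes> b \<in> P"
    using nbhd_products[OF P] by metis
  obtain e where e: "0 < e" "ball ?x1 e \<subseteq> U" "\<And>p. p \<in> fst c \<Longrightarrow> snd c p \<in> ball ?x1 e \<Longrightarrow> p \<in> N0"
    using small[OF N0(1,2)] by blast
  define W where "W = {p \<in> fst c. snd c p \<in> ball ?x1 e}"
  have W: "openin X W" "\<one> \<in> W"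
    unfolding W_def using openin_chart_preimage[OF ch open_ball] c'(2) e(1) by auto
  have WW: "a \<otimes> b \<in> fst c" "snd c (a \<otimes> b) \<in> U" if "a \<in> W" "b \<in> W" for a b
    using N0(3)[of a b] that e(3) by (auto simp: W_def P_def)
  have Wc: "a \<in> carrier G" if "a \<in> W" for a using that fc by (simp add: W_def)
  define \<phi> where "\<phi> p = \<psi> (snd c p)" for p
  \<comment> \<open>the coordinates of \<open>a \<otimes> x\<close> as a function of \<open>x\<close> are adapted to the frame again, by left invariance, hence
    they are a left translate of the coordinates of \<open>x\<close>\<close>
  have \<phi>_mult: "\<phi> (a \<otimes> b) = model_mult B (\<phi> a) (\<phi> b)" if a: "a \<in> W" and b: "b \<in> W" for a b
  proof -
    define f where "f x = \<psi> (snd c (a \<otimes> chart_inv c x))" for x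
    have ballW: "chart_inv c x \<in> W" if "x \<in> ball ?x1 e" for x
      using that cU[of x] e(2) by (auto simp: W_def)
    have "f (snd c b) = model_mult B (f ?x1) (\<psi> (snd c b))"
    proof (rule adapted_coordinates_unique[where W = "ball ?x1 e", OF open_ball convex_ball])
      show "\<psi> ?x1 = 0" by (rule \<psi>0)
      show "?x1 \<in> ball ?x1 e" using e(1) by simp
      show "snd c b \<in> ball ?x1 e" using b by (simp add: W_def)
      show "(\<psi> has_derivative (\<lambda>u. model_frame B (\<psi> x) (chart_coframe c x u))) (at x)" if "x \<in> ball ?x1 e" for x
        using that e(2) by (intro d\<psi>) auto
      fix x assume x: "x \<in> ball ?x1 e"
      let ?p = "chart_inv c x" and ?D = "differential c c (\<lambda>b. a \<otimes> b) (chart_inv c x)"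
      have xU: "x \<in> U" and xO: "x \<in> ?O" using x e(2) U(3) by auto
      have p: "?p \<in> fst c" "snd c ?p = x" "?p \<in> carrier G" "?p \<in> W" using cU[OF xU] fc ballW[OF x] by auto
      have cp: "c \<in> charts_at (lmfd G) ?p" "c \<in> charts_at (lmfd G) (a \<otimes> ?p)"
        using c' p WW(1)[OF a p(4)] by (auto simp: charts_at_def)
      let ?y = "snd c (a \<otimes> ?p)"
      have y: "?y \<in> U" by (rule WW(2)[OF a p(4)])
      have "((\<lambda>x. snd c (a \<otimes> chart_inv c x)) has_derivative ?D) (at x)"
        using left_translation_has_derivative[OF Wc[OF a] cp] p by simp
      from has_derivative_compose[OF this d\<psi>[OF y]]
      have "(f has_derivative (\<lambda>u. model_frame B (f x) (chart_coframe c ?y (?D u)))) (at x)"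
        unfolding f_def .
      moreover have "chart_coframe c ?y (?D u) = chart_coframe c x u" for u
      proof -
        have "u = chart_frame c x (chart_coframe c x u)" by (simp add: LT_apply[OF xO])
        also have "\<dots> = \<xi> (chart_coframe c x u) c ?p" by (rule chart_frame_apply[OF c'(1) xO])
        finally have "?D u = ?D (\<xi> (chart_coframe c x u) c ?p)" by simp
        also have "\<dots> = \<xi> (chart_coframe c x u) c (a \<otimes> ?p)"
          by (rule frame_left_translation[OF Wc[OF a] p(3) cp, symmetric])
        also have "\<dots> = chart_frame c ?y (chart_coframe c x u)"
          using chart_frame_chart[OF _ cp(2)] Wc[OF a] p(3) by simp
        finally show ?thesis using TL_apply[OF subsetD[OF U(3) y]] by simp
      qed
      ultimately show "(f has_derivative (\<lambda>u. model_frame B (f x) (chart_coframe c x u))) (at x)" by simp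
    qed
    moreover have "b \<in> fst c" using b by (simp add: W_def)
    ultimately show ?thesis using Wc[OF a] by (simp add: f_def \<phi>_def ci ci1)
  qed
  interpret LG: local_hom G X "model_group B" W \<phi>
    by (intro local_hom.intro local_hom_axioms.intro topological_group_axioms group_model_group)
      (use W \<phi>_mult in auto)
  obtain \<Phi> where \<Phi>: "\<Phi> \<in> hom G (model_group B)"
    "\<And>\<gamma>. pathin X \<gamma> \<Longrightarrow> \<gamma> 0 = \<one> \<Longrightarrow> (\<forall>s\<in>{0..1}. \<forall>s'\<in>{0..1}. inv \<gamma> s \<otimes> \<gamma> s' \<in> W)
      \<Longrightarrow> \<Phi> (\<gamma> 1) = \<phi> (\<gamma> 1)"
    using LG.extension[OF sc] by blast
  obtain N3 where N3: "openin X N3" "\<one> \<in> N3" "\<And>a b. a \<in> N3 \<Longrightarrow> b \<in> N3 \<Longrightarrow> inv a \<otimes> b \<in> W"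
    using nbhd_quotients[OF W] by metis
  obtain e3 where e3: "0 < e3" "ball ?x1 e3 \<subseteq> U" "\<And>p. p \<in> fst c \<Longrightarrow> snd c p \<in> ball ?x1 e3 \<Longrightarrow> p \<in> N3"
    using small[OF N3(1,2)] by blast
  \<comment> \<open>a straight segment in the chart is a short path from the identity to \<open>y\<close>\<close>
  have \<Phi>\<phi>: "\<Phi> y = \<phi> y" if y: "y \<in> fst c" "snd c y \<in> ball ?x1 e3" for y
  proof -
    define \<gamma> where "\<gamma> s = chart_inv c (?x1 + s *\<^sub>R (snd c y - ?x1))" for s :: real
    have in_ball: "?x1 + s *\<^sub>R (snd c y - ?x1) \<in> ball ?x1 e3" if "s \<in> {0..1}" for s
    proof -
      have "norm (s *\<^sub>R (snd c y - ?x1)) \<le> 1 * norm (snd c y - ?x1)"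
        unfolding norm_scaleR using that by (intro mult_right_mono) auto
      also have "\<dots> < e3" using y(2) by (simp add: dist_norm norm_minus_commute)
      finally show ?thesis by (simp add: dist_norm)
    qed
    have "continuous_map (top_of_set {0..1}) (top_of_set ?O) (\<lambda>s::real. ?x1 + s *\<^sub>R (snd c y - ?x1))"
      unfolding continuous_map_in_subtopology
    proof
      show "continuous_map (top_of_set {0..1}) euclidean (\<lambda>s::real. ?x1 + s *\<^sub>R (snd c y - ?x1))"
        by (auto intro!: continuous_intros)
      show "(\<lambda>s::real. ?x1 + s *\<^sub>R (snd c y - ?x1)) \<in> topspace (top_of_set {0..1}) \<rightarrow> ?O"
        using in_ball e3(2) U(3) by (intro funcsetI) (simp only: topspace_euclidean_subtopology, blast)
    qed
    from continuous_map_compose[OF this continuous_chart_inv[OF ch]]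
    have "pathin X \<gamma>" unfolding pathin_def \<gamma>_def[abs_def] by (simp add: o_def)
    moreover have "\<gamma> 0 = \<one>" "\<gamma> 1 = y" using ci1 ci[OF y(1)] by (simp_all add: \<gamma>_def)
    moreover have "\<gamma> s \<in> N3" if "s \<in> {0..1}" for s
      using in_ball[OF that] e3(2) cU[of "?x1 + s *\<^sub>R (snd c y - ?x1)"] unfolding \<gamma>_def by (intro e3(3)) auto
    then have "\<forall>s\<in>{0..1}. \<forall>s'\<in>{0..1}. inv \<gamma> s \<otimes> \<gamma> s' \<in> W"
      by (intro ballI N3(3))
    ultimately show ?thesis using \<Phi>(2)[of \<gamma>] by simp
  qed
  interpret E: topological_group "model_group B" euclidean by (rule topological_group_model)
  define VE where "VE = V \<inter> \<sigma> -` ball ?x1 e"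
  define \<theta> where "\<theta> y = chart_inv c (\<sigma> y)" for y
  have VE: "open VE" "0 \<in> VE"
    unfolding VE_def using continuous_open_preimage[OF h(4) V open_ball] \<sigma>0 e(1) by auto
  have \<theta>W: "\<theta> y \<in> W" "\<phi> (\<theta> y) = y" if "y \<in> VE" for y
    using that cU[of "\<sigma> y"] e(2) h(2)[of y] by (auto simp: \<theta>_def VE_def W_def \<phi>_def)
  have \<theta>_mult: "\<theta> (model_mult B x y) = \<theta> x \<otimes> \<theta> y" if "x \<in> VE" "y \<in> VE" for x y
  proof -
    let ?q = "\<theta> x \<otimes> \<theta> y"
    have q: "?q \<in> fst c" "snd c ?q \<in> U" using WW \<theta>W that by blast+
    have "model_mult B x y = \<psi> (snd c ?q)"
      using \<phi>_mult[of "\<theta> x" "\<theta> y"] \<theta>W that by (simp add: \<phi>_def)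
    then have "\<sigma> (model_mult B x y) = snd c ?q" using h(1)[OF q(2)] by simp
    then show ?thesis using ci[OF q(1)] by (simp add: \<theta>_def[of "model_mult B x y"])
  qed
  interpret LE: local_hom "model_group B" euclidean G VE \<theta>
    by (intro local_hom.intro local_hom_axioms.intro topological_group_model is_group)
      (use VE \<theta>_mult \<theta>W Wc in auto)
  obtain F where F: "F \<in> hom (model_group B) G"
    "\<And>\<gamma>. pathin euclidean \<gamma> \<Longrightarrow> \<gamma> 0 = 0 \<Longrightarrow> (\<forall>s\<in>{0..1}. \<forall>s'\<in>{0..1}.
       model_mult B (model_inv B (\<gamma> s)) (\<gamma> s') \<in> VE) \<Longrightarrow> F (\<gamma> 1) = \<theta> (\<gamma> 1)"
    using LE.extension[OF simply_connected_euclidean] unfolding model_group_simps inv_model_group by blast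
  obtain NE where NE: "open NE" "0 \<in> NE" "\<And>a b. a \<in> NE \<Longrightarrow> b \<in> NE \<Longrightarrow> model_mult B (model_inv B a) b \<in> VE"
    using E.nbhd_quotients[of VE] VE by auto
  obtain \<rho> where \<rho>: "0 < \<rho>" "ball 0 \<rho> \<subseteq> NE" using NE(1,2) open_contains_ball by blast
  have F\<theta>: "F y = \<theta> y" if y: "y \<in> ball 0 \<rho>" for y
  proof -
    have "s *\<^sub>R y \<in> NE" if "s \<in> {0..1}" for s :: real
    proof -
      have "norm (s *\<^sub>R y) \<le> 1 * norm y" unfolding norm_scaleR using that by (intro mult_right_mono) auto
      then have "s *\<^sub>R y \<in> ball 0 \<rho>" using y by simp
      then show ?thesis using \<rho>(2) by blast
    qed
    moreover have "pathin euclidean (\<lambda>s. s *\<^sub>R y)"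
      by (auto simp: pathin_def intro!: continuous_intros)
    ultimately show ?thesis using F(2)[of "\<lambda>s. s *\<^sub>R y"] NE(3) by simp
  qed
  have \<rho>VE: "ball 0 \<rho> \<subseteq> VE"
  proof
    fix y :: "real \<times> (real^'n)" assume "y \<in> ball 0 \<rho>"
    then have "model_mult B (model_inv B 0) y \<in> VE" using \<rho>(2) NE(2) by (intro NE(3)) auto
    moreover have "model_inv B 0 = 0" by (simp add: model_inv_def zero_prod_def)
    ultimately show "y \<in> VE" by simp
  qed
  define W4 where "W4 = {p \<in> fst c. snd c p \<in> ball ?x1 e3 \<inter> (U \<inter> \<psi> -` ball 0 \<rho>)}"
  have W4: "openin X W4" "\<one> \<in> W4"
  proof -
    show "openin X W4"
      unfolding W4_def
      by (rule openin_chart_preimage[OF ch open_Int[OF open_ball continuous_open_preimage[OF h(3) U(1) open_ball]]])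
    show "\<one> \<in> W4"
      unfolding W4_def using c'(2) U(2) e3(1) \<psi>0 \<rho>(1) by simp
  qed
  define VE4 where "VE4 = ball 0 \<rho> \<inter> (V \<inter> \<sigma> -` ball ?x1 e3)"
  have VE4: "open VE4" "0 \<in> VE4"
  proof -
    show "open VE4"
      unfolding VE4_def by (rule open_Int[OF open_ball continuous_open_preimage[OF h(4) V open_ball]])
    show "0 \<in> VE4" unfolding VE4_def using \<sigma>0 e3(1) \<rho>(1) by simp
  qed
  have pc: "path_connected_space X" "path_connected_space (euclidean :: (real \<times> (real^'n)) topology)"
    using sc simply_connected_euclidean unfolding simply_connected_space_def by blast+
  have F\<Phi>: "F (\<Phi> p) = p" if "p \<in> carrier G" for p
  proof (rule homs_eqI[OF is_group _ _ pc(1) W4 _ that])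
    show "(\<lambda>p. F (\<Phi> p)) \<in> hom G G" "(\<lambda>p. p) \<in> hom G G"
      using F(1) \<Phi>(1) by (auto simp: hom_def simp del: split_paired_All)
    fix q assume q: "q \<in> W4"
    then have "F (\<Phi> q) = \<theta> (\<phi> q)" using \<Phi>\<phi>[of q] F\<theta>[of "\<phi> q"] by (simp add: W4_def \<phi>_def)
    also have "\<dots> = q" using q h(1)[of "snd c q"] ci[of q] by (simp add: W4_def \<phi>_def \<theta>_def)
    finally show "F (\<Phi> q) = q" .
  qed
  have \<Phi>F: "\<Phi> (F x) = x" for x
  proof (rule E.homs_eqI[OF group_model_group _ _ pc(2)])
    show "(\<lambda>p. \<Phi> (F p)) \<in> hom (model_group B) (model_group B)" "(\<lambda>p. p) \<in> hom (model_group B) (model_group B)"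
      using F(1) \<Phi>(1) by (auto simp: hom_def simp del: split_paired_All)
    show "openin euclidean VE4" "\<one>\<^bsub>model_group B\<^esub> \<in> VE4" using VE4 by auto
    fix y assume y: "y \<in> VE4"
    then have "\<theta> y \<in> fst c" "snd c (\<theta> y) = \<sigma> y" "\<phi> (\<theta> y) = y"
      using \<theta>W[of y] cU[of "\<sigma> y"] h(2)[of y] \<rho>VE by (auto simp: VE4_def \<theta>_def)
    then show "\<Phi> (F y) = y" using y \<Phi>\<phi>[of "\<theta> y"] F\<theta>[of y] by (simp add: VE4_def)
  qed simp
  have cF: "continuous_map euclidean X F"
  proof (rule continuous_map_hom[OF topological_group_model topological_group_axioms F(1)])
    show "openin euclidean (ball (0::real \<times> (real^'n)) \<rho>)" "\<one>\<^bsub>model_group B\<^esub> \<in> ball 0 \<rho>" using \<rho>(1) by auto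
    have "continuous_map (top_of_set (ball 0 \<rho>)) (top_of_set ?O) \<sigma>"
      unfolding continuous_map_in_subtopology
    proof
      have \<rho>V: "ball 0 \<rho> \<subseteq> V" using \<rho>VE by (auto simp: VE_def)
      then show "continuous_map (top_of_set (ball 0 \<rho>)) euclidean \<sigma>"
        using continuous_on_subset[OF h(4)] by simp
      show "\<sigma> \<in> topspace (top_of_set (ball 0 \<rho>)) \<rightarrow> ?O"
        unfolding topspace_euclidean_subtopology using \<rho>V h(2) U(3) by blast
    qed
    from continuous_map_compose[OF this continuous_chart_inv[OF ch]]
    show "continuous_map (subtopology euclidean (ball 0 \<rho>)) X F"
      by (rule continuous_map_eq) (auto simp: F\<theta> \<theta>_def)
  qed
  have c\<Phi>: "continuous_map X euclidean \<Phi>"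
  proof (rule continuous_map_hom[OF topological_group_axioms topological_group_model \<Phi>(1) W4])
    have t: "topspace (subtopology X W4) = W4"
      using openin_subset[OF W4(1)] by (rule topspace_subtopology_subset)
    have "continuous_map (subtopology X W4) euclidean (snd c)"
      by (rule continuous_map_from_subtopology_mono[OF continuous_chart[OF ch]]) (auto simp: W4_def)
    then have "continuous_map (subtopology X W4) (top_of_set U) (snd c)"
      unfolding continuous_map_in_subtopology t by (auto simp: W4_def)
    moreover have "continuous_map (top_of_set U) euclidean \<psi>" using h(3) by simp
    ultimately have "continuous_map (subtopology X W4) euclidean (\<psi> \<circ> snd c)" by (rule continuous_map_compose)
    then show "continuous_map (subtopology X W4) euclidean \<Phi>"
      by (rule continuous_map_eq) (use \<Phi>\<phi> in \<open>auto simp: t W4_def \<phi>_def\<close>)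
  qed
  show thesis
  proof (rule that[OF F(1) \<Phi>(1) F\<Phi> \<Phi>F cF c\<Phi> c \<rho>(1) _ _ d\<sigma>])
 fix y :: "real \<times> (real^'n)" assume y: "y \<in> ball 0 \<rho>"
    then have "y \<in> V" using \<rho>VE by (auto simp: VE_def)
    then show "F y \<in> fst c" "snd c (F y) = \<sigma> y"
      using F\<theta>[OF y] cU[of "\<sigma> y"] h(2)[of y] by (auto simp: \<theta>_def)
  qed
qed

end

section \<open>Manifolds with one global chart\<close>

lemma homeomorphic_map_imp_embedding_map:
  assumes "homeomorphic_map X Y f"
  shows "embedding_map X Y f"
proof -
  have "f ` topspace X = topspace Y" using assms by (rule homeomorphic_imp_surjective_map)
  then show ?thesis using assms by (simp add: embedding_map_def)
qed

text \<open>\<open>F\<close> is a diffeomorphism from the model space onto \<open>M\<close> with inverse \<open>\<Phi>\<close>, and \<open>q\<close> is the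
  metric \<open>g\<close> in these coordinates.\<close>

definition metric_coordinates ::
  "('m, 'e::euclidean_space) mfd \<Rightarrow> ('m, 'e) metric \<Rightarrow> ('e \<Rightarrow> 'e \<Rightarrow> 'e \<Rightarrow> real) \<Rightarrow> ('e \<Rightarrow> 'm) \<Rightarrow> ('m \<Rightarrow> 'e) \<Rightarrow> bool" where
  "metric_coordinates M g q F \<Phi> \<longleftrightarrow>
     continuous_map euclidean (mtop M) F \<and> continuous_map (mtop M) euclidean \<Phi> \<and>
     (\<forall>p\<in>topspace (mtop M). F (\<Phi> p) = p) \<and> (\<forall>x. \<Phi> (F x) = x) \<and>
     (\<forall>d\<in>atlas M. smooth_on (\<lambda>x. snd d (F x)) {x. F x \<in> fst d}) \<and>
     (\<forall>d\<in>atlas M. smooth_on (\<lambda>z. \<Phi> (chart_inv d z)) (snd d ` fst d)) \<and>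
     (\<forall>x. \<forall>d\<in>charts_at M (F x). \<exists>D. ((\<lambda>x. snd d (F x)) has_derivative D) (at x) \<and> inj D \<and>
        (\<forall>v w. g d (F x) (D v) (D w) = q x v w))"

context G_mu
begin

text \<open>By \<open>F (x y) = F x \<cdot> F y\<close>, the derivative of \<open>F\<close> at the origin determines it everywhere: \<open>F\<close> maps the
  invariant frame of the model to \<open>\<xi>\<close>. This equation gives the smoothness of \<open>F\<close> and of its inverse as well as
  the formula for the metric.\<close>

lemma global_coordinates:
  obtains F \<Phi> where "metric_coordinates (lmfd G) g (model_metric B) F \<Phi>" "F 0 = \<one>"
proof -
  obtain F \<Phi> c \<rho> \<sigma> where F: "F \<in> hom (model_group B) G" and \<Phi>: "\<Phi> \<in> hom G (model_group B)"
    and F\<Phi>: "\<And>p. p \<in> carrier G \<Longrightarrow> F (\<Phi> p) = p" and \<Phi>F: "\<And>x. \<Phi> (F x) = x"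
    and cF: "continuous_map euclidean X F" and c\<Phi>: "continuous_map X euclidean \<Phi>"
    and c: "c \<in> charts_at (lmfd G) \<one>" and \<rho>: "0 < \<rho>"
    and F\<sigma>: "\<And>y. y \<in> ball 0 \<rho> \<Longrightarrow> F y \<in> fst c" "\<And>y. y \<in> ball 0 \<rho> \<Longrightarrow> snd c (F y) = \<sigma> y"
    and d\<sigma>: "(\<sigma> has_derivative (\<lambda>v. \<xi> v c \<one>)) (at 0)"
    by (rule global_isomorphism) (rule that)
  have c': "c \<in> atlas (lmfd G)" using c by (simp add: charts_at_def)
  have F0: "F 0 = \<one>" using hom_one[OF F group_model_group is_group] by simp
  have \<sigma>0: "\<sigma> 0 = snd c \<one>" using F\<sigma>(2)[of 0] F0 \<rho> by simp
  have Fc: "F x \<in> carrier G" for x using F by (auto simp: hom_def)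
  have Fm: "F (model_mult B x y) = F x \<otimes> F y" for x y using hom_mult[OF F, of x y] by simp
  have dF: "((\<lambda>x. snd d (F x)) has_derivative (\<lambda>u. \<xi> (model_coframe B x u) d (F x))) (at x)"
    if d: "d \<in> charts_at (lmfd G) (F x)" for x d
  proof -
    let ?L = "model_mult B (model_inv B x)" and ?D = "differential c d (\<lambda>b. F x \<otimes> b) \<one>"
    have d1: "d \<in> charts_at (lmfd G) (F x \<otimes> \<one>)" using d Fc by simp
    have L: "(?L has_derivative model_coframe B x) (at x)"
      using model_mult_has_derivative[of B "model_inv B x" x]
      by (simp add: model_frame_def[abs_def] model_coframe_def[abs_def] model_inv_def)
    have "(\<sigma> has_derivative (\<lambda>v. \<xi> v c \<one>)) (at (?L x))" using d\<sigma> by simp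
    from has_derivative_compose[OF L this]
    have "((\<lambda>y. \<sigma> (?L y)) has_derivative (\<lambda>u. \<xi> (model_coframe B x u) c \<one>)) (at x)" .
    moreover have "((\<lambda>z. snd d (F x \<otimes> chart_inv c z)) has_derivative ?D) (at (\<sigma> (?L x)))"
      using left_translation_has_derivative[OF Fc c d1] \<sigma>0 by simp
    ultimately have "((\<lambda>y. snd d (F x \<otimes> chart_inv c (\<sigma> (?L y)))) has_derivative (\<lambda>u. ?D (\<xi> (model_coframe B x u) c \<one>))) (at x)"
      by (rule has_derivative_compose)
    moreover have "?D (\<xi> v c \<one>) = \<xi> v d (F x)" for v
      using frame_left_translation[OF Fc one_closed c d1, of v] Fc by simp
    ultimately have "((\<lambda>y. snd d (F x \<otimes> chart_inv c (\<sigma> (?L y)))) has_derivative (\<lambda>u. \<xi> (model_coframe B x u) d (F x))) (at x)"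
      by simp
    moreover have "open (?L -` ball 0 \<rho>)"
      using has_derivative_continuous[OF model_mult_has_derivative]
      by (intro open_vimage open_ball continuous_at_imp_continuous_on ballI) blast
    moreover have "x \<in> ?L -` ball 0 \<rho>" using \<rho> by simp
    moreover have "snd d (F x \<otimes> chart_inv c (\<sigma> (?L y))) = snd d (F y)" if "y \<in> ?L -` ball 0 \<rho>" for y
    proof -
      have "?L y \<in> ball 0 \<rho>" using that by simp
      then have "chart_inv c (\<sigma> (?L y)) = F (?L y)"
        using F\<sigma>[of "?L y"] chart_inv_chart[OF chart[OF c']] by metis
      then show ?thesis using Fm[of x "?L y"] by simp
    qed
    ultimately show ?thesis by (rule has_derivative_transform_within_open)
  qed
  have at: "d \<in> charts_at (lmfd G) (F x) \<longleftrightarrow> F x \<in> fst d" if "d \<in> atlas (lmfd G)" for d x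
    using that by (simp add: charts_at_def)
  have smF: "smooth_on (\<lambda>x. snd d (F x)) {x. F x \<in> fst d}" if d: "d \<in> atlas (lmfd G)" for d
  proof -
    let ?S = "{x. F x \<in> fst d}"
    interpret mu_frame B "snd d ` fst d" "chart_frame d" "chart_coframe d" by (rule mu_frame_chart[OF d])
    have S: "open ?S"
      using open_preimage[of UNIV X F, OF _ open_UNIV is_chart_openD(1)[OF chart[OF d]]] cF by simp
    show ?thesis
    proof (rule smooth_on_bootstrap[OF S])
      fix x assume "x \<in> ?S"
      then show "((\<lambda>x. snd d (F x)) has_derivative (\<lambda>u. \<xi> (model_coframe B x u) d (F x))) (at x)"
        using at[OF d] by (intro dF) simp
    next
      fix k v assume 1: "Ck k (\<lambda>x. snd d (F x)) ?S"
      have 2: "Ck k (chart_frame d) (snd d ` fst d)" using smoothL by (simp add: smooth_on_iff_Ck)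
      have "Ck k (\<lambda>x. chart_frame d (snd d (F x))) ?S"
        by (rule Ck_comp[OF S openU 1 2]) blast
      then have "Ck k (\<lambda>x. chart_frame d (snd d (F x)) (model_coframe B x v)) ?S"
        by (rule Ck_blinfun_apply[OF S _ Ck_model_frame(2)[OF S Ck_ident[OF S] Ck_const[OF S]]])
      moreover have "chart_frame d (snd d (F x)) (model_coframe B x v) = \<xi> (model_coframe B x v) d (F x)" if "x \<in> ?S" for x
        using that at[OF d] by (intro chart_frame_chart Fc) simp
      ultimately show "Ck k (\<lambda>x. \<xi> (model_coframe B x v) d (F x)) ?S"
        by (subst Ck_cong[OF S, where g = "\<lambda>x. chart_frame d (snd d (F x)) (model_coframe B x v)"]) simp_all
    qed
  qed
  have sm\<Phi>: "smooth_on (\<lambda>z. \<Phi> (chart_inv d z)) (snd d ` fst d)" if d: "d \<in> atlas (lmfd G)" for d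
  proof -
    let ?O = "snd d ` fst d" and ?h = "\<lambda>z. \<Phi> (chart_inv d z)"
    interpret mu_frame B ?O "chart_frame d" "chart_coframe d" by (rule mu_frame_chart[OF d])
    have "continuous_map (top_of_set ?O) euclidean (\<Phi> \<circ> chart_inv d)"
      by (rule continuous_map_compose[OF continuous_chart_inv[OF chart[OF d]] c\<Phi>])
    then have ch: "continuous_on ?O ?h" by (simp add: o_def)
    show ?thesis
    proof (rule smooth_on_bootstrap[OF openU])
      fix z assume z: "z \<in> ?O"
      let ?p = "chart_inv d z" and ?x = "?h z"
      have Fx: "F (?h y) = chart_inv d y" if "y \<in> ?O" for y using F\<Phi> chart_inv_charts_at(2)[OF d that] by simp
      have dx: "d \<in> charts_at (lmfd G) (F ?x)"
        unfolding Fx[OF z] by (rule chart_inv_charts_at(1)[OF d z])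
      show "(?h has_derivative (\<lambda>u. model_frame B (?h z) (chart_coframe d z u))) (at z)"
      proof (rule has_derivative_inverse_basic[where g = ?h and y = z, OF dF[OF dx] _ _ _ openU z])
        show "bounded_linear (\<lambda>u. model_frame B (?h z) (chart_coframe d z u))"
          using linear_model_frame(1)
          by (intro bounded_linear_compose[OF _ blinfun.bounded_linear_right]) (simp add: linear_conv_bounded_linear)
        have "chart_coframe d z (\<xi> v d (F ?x)) = v" for v
          using chart_frame_apply[OF d z, of v] TL_apply[OF z, of v] Fx[OF z] by simp
        then show "(\<lambda>u. model_frame B (?h z) (chart_coframe d z u)) \<circ> (\<lambda>u. \<xi> (model_coframe B ?x u) d (F ?x)) = id"
          by (simp add: fun_eq_iff)
        show "continuous (at z) ?h" using ch z openU continuous_on_eq_continuous_at by blast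
        fix y assume "y \<in> ?O"
        then show "snd d (F (?h y)) = y" using Fx chart_chart_inv by metis
      qed
    next
      fix k v assume "Ck k ?h ?O"
      moreover have "Ck k (chart_coframe d) ?O" using smoothT by (simp add: smooth_on_iff_Ck)
      ultimately show "Ck k (\<lambda>z. model_frame B (?h z) (chart_coframe d z v)) ?O"
        by (intro Ck_model_frame Ck_blinfun_apply Ck_const openU)
    qed
  qed
  have "\<exists>D. ((\<lambda>x. snd d (F x)) has_derivative D) (at x) \<and> inj D \<and>
        (\<forall>v w. g d (F x) (D v) (D w) = model_metric B x v w)" if d: "d \<in> charts_at (lmfd G) (F x)" for x d
  proof (intro exI conjI allI)
    show "((\<lambda>x. snd d (F x)) has_derivative (\<lambda>u. \<xi> (model_coframe B x u) d (F x))) (at x)" by (rule dF[OF d])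
    have "inj (model_coframe B x)" by (rule inj_on_inverseI[of _ "model_frame B x"]) simp
    from inj_compose[OF frame_inj[OF Fc d] this]
    show "inj (\<lambda>u. \<xi> (model_coframe B x u) d (F x))" by (simp add: o_def)
    show "g d (F x) (\<xi> (model_coframe B x v) d (F x)) (\<xi> (model_coframe B x w) d (F x)) = model_metric B x v w" for v w
      by (simp add: frame_orthonormal[OF Fc d] model_metric_coframe)
  qed
  then have "metric_coordinates (lmfd G) g (model_metric B) F \<Phi>"
    unfolding metric_coordinates_def carrier_topspace using cF c\<Phi> F\<Phi> \<Phi>F smF sm\<Phi> by blast
  then show thesis using F0 by (rule that)
qed

end

lemma is_G\<^sub>\<mu>_coordinates:
  fixes G :: "('m, real \<times> (real^'n)) lie_group"
  assumes "is_G\<^sub>\<mu> (mu B) G g"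
  shows "\<exists>F \<Phi>. metric_coordinates (lmfd G) g (model_metric B) F \<Phi> \<and> F 0 = \<one>\<^bsub>G\<^esub>"
proof -
  obtain \<xi> where \<xi>: "lie_algebra_iso (mu B) G \<xi>"
    "\<forall>c\<in>charts_at (lmfd G) \<one>\<^bsub>G\<^esub>. \<forall>v w. g c \<one>\<^bsub>G\<^esub> (\<xi> v c \<one>\<^bsub>G\<^esub>) (\<xi> w c \<one>\<^bsub>G\<^esub>) = v \<bullet> w"
    using assms unfolding is_G\<^sub>\<mu>_def by blast
  interpret G_mu G B g \<xi>
    by (intro G_mu.intro lie_grp.intro G_mu_axioms.intro) (use assms \<xi> in \<open>auto simp: is_G\<^sub>\<mu>_def\<close>)
  show ?thesis using global_coordinates by blast
qed

text \<open>The manifold \<open>M\<close> with the global coordinates as its only chart. In this chart convergence of metrics is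
  convergence of their coordinate expressions, without changes of coordinates.\<close>

definition one_chart :: "('m, 'e::euclidean_space) mfd \<Rightarrow> ('m \<Rightarrow> 'e) \<Rightarrow> ('m, 'e) mfd" where
  "one_chart M \<Phi> = \<lparr>mtop = mtop M, atlas = {(topspace (mtop M), \<Phi>)}\<rparr>"

lemma one_chart_simps [simp]:
  "mtop (one_chart M \<Phi>) = mtop M" "atlas (one_chart M \<Phi>) = {(topspace (mtop M), \<Phi>)}"
  "charts_at (one_chart M \<Phi>) p = (if p \<in> topspace (mtop M) then {(topspace (mtop M), \<Phi>)} else {})"
  by (auto simp: one_chart_def charts_at_def)

context
  fixes M :: "('m, 'e::euclidean_space) mfd" and g q F \<Phi>
  assumes mc: "metric_coordinates M g q F \<Phi>"
begin

lemma inverse_coordinates_in: "F x \<in> topspace (mtop M)"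
proof -
  have "continuous_map euclidean (mtop M) F" using mc by (simp add: metric_coordinates_def)
  then show ?thesis using continuous_map_funspace by fastforce
qed

lemma coordinates_inverse: "p \<in> topspace (mtop M) \<Longrightarrow> F (\<Phi> p) = p" "\<Phi> (F x) = x"
  using mc by (auto simp: metric_coordinates_def)

lemma coordinates_surj: "\<Phi> ` topspace (mtop M) = UNIV"
  using inverse_coordinates_in coordinates_inverse(2) by (metis UNIV_eq_I image_eqI)

lemma chart_inv_coordinates: "inv_into (topspace (mtop M)) \<Phi> = F"
proof
  fix x
  have "inj_on \<Phi> (topspace (mtop M))" using coordinates_inverse(1) by (rule inj_on_inverseI)
  then show "inv_into (topspace (mtop M)) \<Phi> x = F x"
    using inv_into_f_f[OF _ inverse_coordinates_in[of x], of \<Phi>] coordinates_inverse(2) by simp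
qed

lemma coordinates_homeomorphic_maps: "homeomorphic_maps (mtop M) euclidean \<Phi> F"
  using mc inverse_coordinates_in unfolding metric_coordinates_def homeomorphic_maps_def by auto

text \<open>The derivative \<open>D\<close> of \<open>F\<close> read in a chart is a linear isometry, hence so is the derivative
  of \<open>\<Phi>\<close>, which is its inverse.\<close>

lemma euclidean_coordinates_isometry:
  assumes M: "smooth_manifold M" and q: "\<And>x v w. q x v w = v \<bullet> w"
  shows "isometry_onto_open M g (topspace (mtop M)) (euclidean_mfd :: ('e, 'e) mfd) std_metric \<Phi>"
proof -
  let ?E = "euclidean_mfd :: ('e, 'e) mfd" and ?d = "(UNIV, id) :: ('e, 'e) chart"
  have E: "mtop ?E = euclidean" "atlas ?E = {?d}" "\<And>p. charts_at ?E p = {?d}"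
    by (auto simp: euclidean_mfd_def charts_at_def)
  have some: "(SOME d. d \<in> charts_at ?E p) = ?d" for p by (simp add: E)
  have chart: "is_chart (mtop M) c" if "c \<in> atlas M" for c using M that by (simp add: smooth_manifold_def)
  have sub: "fst c \<subseteq> topspace (mtop M)" if "c \<in> atlas M" for c
    using openin_subset[OF is_chart_openD(1)[OF chart[OF that]]] .
  have D: "inj (differential c ?d \<Phi> p) \<and> (\<forall>v w. g c p v w = differential c ?d \<Phi> p v \<bullet> differential c ?d \<Phi> p w)"
    if p: "p \<in> topspace (mtop M)" and c: "c \<in> charts_at M p" for p c
  proof -
    let ?D = "differential c ?d \<Phi> p" and ?O = "snd c ` fst c" and ?z = "snd c p"
    have c': "c \<in> atlas M" "p \<in> fst c" using c by (auto simp: charts_at_def)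
    have O: "open ?O" "?z \<in> ?O" using is_chart_openD(2)[OF chart[OF c'(1)]] c'(2) by auto
    have Fp: "F (\<Phi> p) = p" by (rule coordinates_inverse(1)[OF p])
    have cp: "chart_inv c ?z = p" by (rule chart_inv_chart[OF chart[OF c'(1)] c'(2)])
    have "smooth_on (\<lambda>z. \<Phi> (chart_inv c z)) ?O" using mc c'(1) by (simp add: metric_coordinates_def)
    from smooth_on_has_derivative[OF this O]
    have d1: "((\<lambda>z. \<Phi> (chart_inv c z)) has_derivative ?D) (at ?z)"
      by (simp add: differential_def o_def)
    obtain D where D: "((\<lambda>x. snd c (F x)) has_derivative D) (at (\<Phi> p))" "\<And>v w. g c p (D v) (D w) = q (\<Phi> p) v w"
      using mc c Fp unfolding metric_coordinates_def by metis
    have "((\<lambda>x. snd c (F x)) has_derivative D) (at (\<Phi> (chart_inv c ?z)))" using D(1) cp by simp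
    from has_derivative_compose[OF d1 this]
    have "((\<lambda>z. snd c (F (\<Phi> (chart_inv c z)))) has_derivative (\<lambda>u. D (?D u))) (at ?z)" .
    moreover have "snd c (F (\<Phi> (chart_inv c z))) = z" if "z \<in> ?O" for z
      using coordinates_inverse(1)[of "chart_inv c z"] chart_inv_in[OF that] sub[OF c'(1)] chart_chart_inv[OF that] by auto
    ultimately have "((\<lambda>z. z) has_derivative (\<lambda>u. D (?D u))) (at ?z)"
      by (rule has_derivative_transform_within_open[OF _ O])
    from has_derivative_unique[OF this has_derivative_ident]
    have DD: "D (?D u) = u" for u by (rule fun_cong)
    then have "inj ?D" by (metis injI)
    moreover have "g c p v w = ?D v \<bullet> ?D w" for v w
      using D(2)[of "?D v" "?D w"] by (simp add: DD q)
    ultimately show ?thesis by blast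
  qed
  have img: "snd c ` {p \<in> fst c \<inter> topspace (mtop M). \<Phi> p \<in> UNIV} = snd c ` fst c" if "c \<in> atlas M" for c
    using sub[OF that] by blast
  have "smooth_map M (topspace (mtop M)) ?E \<Phi>"
    unfolding smooth_map_def E
  proof (intro conjI ballI)
    show "continuous_map (subtopology (mtop M) (topspace (mtop M))) euclidean \<Phi>"
      using mc by (simp add: metric_coordinates_def)
    fix c and d :: "('e, 'e) chart" assume c: "c \<in> atlas M" and d: "d \<in> {?d}"
    have "smooth_on (\<lambda>z. \<Phi> (chart_inv c z)) (snd c ` fst c)" using mc c by (simp add: metric_coordinates_def)
    then show "smooth_on (snd d \<circ> \<Phi> \<circ> chart_inv c) (snd c ` {p \<in> fst c \<inter> topspace (mtop M). \<Phi> p \<in> fst d})"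
      using d img[OF c] by (simp add: o_def)
  qed simp
  moreover have "homeomorphic_map (mtop M) euclidean \<Phi>"
    using coordinates_homeomorphic_maps by (auto simp: homeomorphic_map_maps)
  then have "embedding_map (subtopology (mtop M) (topspace (mtop M))) (mtop ?E) \<Phi>"
    by (simp add: E homeomorphic_map_imp_embedding_map)
  ultimately have "smooth_embedding M (topspace (mtop M)) ?E \<Phi>"
    unfolding smooth_embedding_def E(3) using D by simp
  then show ?thesis
    unfolding isometry_onto_open_def pullback_def some Let_def std_metric_def
    using D coordinates_surj by (simp add: E)
qed

lemma one_chart_riemannian:
  assumes M: "smooth_manifold M" "connected_space (mtop M)"
    and q: "\<And>x. bilinear (q x)" "\<And>x v w. q x v w = q x w v" "\<And>x v. v \<noteq> 0 \<Longrightarrow> 0 < q x v v"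
      "\<And>v w. smooth_on (\<lambda>x. q x v w) UNIV"
  shows "riemannian_manifold (one_chart M \<Phi>) (\<lambda>c p. q (\<Phi> p))"
proof -
  let ?c = "(topspace (mtop M), \<Phi>)"
  have id: "\<Phi> \<circ> F = (\<lambda>x. x)" using coordinates_inverse(2) by auto
  have sid: "smooth_on (\<lambda>x::'e. x) UNIV" by (simp add: smooth_on_iff_Ck Ck_ident)
  have "is_chart (mtop M) ?c"
    using coordinates_homeomorphic_maps by (auto simp: is_chart_def coordinates_surj homeomorphic_map_maps)
  then have "smooth_manifold (one_chart M \<Phi>)"
    using M(1) unfolding smooth_manifold_def by (simp add: coordinates_surj chart_inv_coordinates id sid)
  moreover have "differential ?c ?c id p = id" for p
  proof -
    have "differential ?c ?c id p = frechet_derivative (\<lambda>x. x) (at (\<Phi> p))"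
      by (simp add: differential_def chart_inv_coordinates id)
    then show ?thesis by (simp add: frechet_derivative_ident id_def)
  qed
  then have "riemannian_metric (one_chart M \<Phi>) (\<lambda>c p. q (\<Phi> p))"
    unfolding riemannian_metric_def using q by (simp add: chart_inv_coordinates coordinates_inverse(2) coordinates_surj)
  ultimately show ?thesis using M(2) by (simp add: riemannian_manifold_def)
qed

text \<open>The map \<open>F' \<circ> \<Phi>\<close> has the same coordinates in the source and in the target, so that it pulls the metric
  \<open>k\<close> back to its coordinate expression \<open>r\<close>.\<close>

lemma one_chart_embedding:
  assumes N: "metric_coordinates N k r F' \<Phi>'" "smooth_manifold N"
  shows "smooth_embedding (one_chart M \<Phi>) (topspace (mtop M)) N (F' \<circ> \<Phi>)"
    and "(F' \<circ> \<Phi>) ` topspace (mtop M) = topspace (mtop N)"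
    and "p \<in> topspace (mtop M) \<Longrightarrow> pullback (F' \<circ> \<Phi>) N k (topspace (mtop M), \<Phi>) p v w = r (\<Phi> p) v w"
proof -
  let ?c = "(topspace (mtop M), \<Phi>)" and ?f = "F' \<circ> \<Phi>"
  have fF: "?f (F x) = F' x" for x by (simp add: coordinates_inverse(2))
  have N': "continuous_map euclidean (mtop N) F'" "continuous_map (mtop N) euclidean \<Phi>'"
    "\<And>p. p \<in> topspace (mtop N) \<Longrightarrow> F' (\<Phi>' p) = p" "\<And>x. \<Phi>' (F' x) = x"
    "\<And>d. d \<in> atlas N \<Longrightarrow> smooth_on (\<lambda>x. snd d (F' x)) {x. F' x \<in> fst d}"
    using N(1) by (auto simp: metric_coordinates_def)
  have F': "F' x \<in> topspace (mtop N)" for x using continuous_map_funspace[OF N'(1)] by fastforce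
  show img: "?f ` topspace (mtop M) = topspace (mtop N)"
    unfolding image_comp[symmetric] coordinates_surj using F' N'(3) by (metis rangeI subsetI subset_antisym image_subset_iff UNIV_I)
  have D: "inj (differential ?c d ?f p) \<and> (\<forall>v w. k d (?f p) (differential ?c d ?f p v) (differential ?c d ?f p w) = r (\<Phi> p) v w)"
    if p: "p \<in> topspace (mtop M)" and d: "d \<in> charts_at N (?f p)" for p d
  proof -
    have d': "d \<in> charts_at N (F' (\<Phi> p))" using d by simp
    obtain D where D: "((\<lambda>x. snd d (F' x)) has_derivative D) (at (\<Phi> p))" "inj D"
      "\<And>v w. k d (F' (\<Phi> p)) (D v) (D w) = r (\<Phi> p) v w"
      using N(1) d' unfolding metric_coordinates_def by metis
    have "snd d \<circ> ?f \<circ> chart_inv ?c = (\<lambda>x. snd d (F' x))"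
      by (simp add: chart_inv_coordinates fun_eq_iff coordinates_inverse(2))
    then have "differential ?c d ?f p = D"
      unfolding differential_def using frechet_derivative_at[OF D(1)] by simp
    with D(2,3) show ?thesis by simp
  qed
  have c\<Phi>: "continuous_map (mtop M) euclidean \<Phi>" and cF: "continuous_map euclidean (mtop M) F"
    using mc by (auto simp: metric_coordinates_def)
  have cf: "continuous_map (mtop M) (mtop N) ?f" by (rule continuous_map_compose[OF c\<Phi> N'(1)])
  have "smooth_map (one_chart M \<Phi>) (topspace (mtop M)) N ?f"
    unfolding smooth_map_def one_chart_simps
  proof (intro conjI ballI)
    show "continuous_map (subtopology (mtop M) (topspace (mtop M))) (mtop N) ?f" using cf by simp
    fix c d assume c: "c \<in> {?c}" and d: "d \<in> atlas N"
    have "snd d \<circ> ?f \<circ> chart_inv c = (\<lambda>x. snd d (F' x))"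
      using c by (simp add: chart_inv_coordinates fun_eq_iff coordinates_inverse(2))
    moreover have "snd c ` {p \<in> fst c \<inter> topspace (mtop M). ?f p \<in> fst d} = {x. F' x \<in> fst d}"
    proof (intro equalityI subsetI)
      fix x assume "x \<in> {x. F' x \<in> fst d}"
      then have "x = \<Phi> (F x)" "F x \<in> {p \<in> topspace (mtop M). ?f p \<in> fst d}"
        using inverse_coordinates_in coordinates_inverse(2) by auto
      then show "x \<in> snd c ` {p \<in> fst c \<inter> topspace (mtop M). ?f p \<in> fst d}" using c by auto
    qed (use c in auto)
    ultimately show "smooth_on (snd d \<circ> ?f \<circ> chart_inv c) (snd c ` {p \<in> fst c \<inter> topspace (mtop M). ?f p \<in> fst d})"
      using N'(5)[OF d] by simp
  qed simp
  moreover have "homeomorphic_maps (mtop M) (mtop N) ?f (F \<circ> \<Phi>')"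
    unfolding homeomorphic_maps_def
    using cf continuous_map_compose[OF N'(2) cF] by (auto simp: coordinates_inverse N'(3,4))
  then have "homeomorphic_map (mtop M) (mtop N) ?f" by (auto simp: homeomorphic_map_maps)
  then have "embedding_map (subtopology (mtop M) (topspace (mtop M))) (mtop N) ?f"
    by (simp add: homeomorphic_map_imp_embedding_map)
  ultimately show "smooth_embedding (one_chart M \<Phi>) (topspace (mtop M)) N ?f"
    unfolding smooth_embedding_def using D by simp
  assume p: "p \<in> topspace (mtop M)"
  have "\<exists>d. d \<in> charts_at N (?f p)"
    using N(2) img p unfolding smooth_manifold_def charts_at_def by blast
  then have "(SOME d. d \<in> charts_at N (?f p)) \<in> charts_at N (?f p)" by (rule someI_ex)
  from D[OF p this] show "pullback ?f N k ?c p v w = r (\<Phi> p) v w"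
    by (simp add: pullback_def Let_def)
qed

end

section \<open>Convergence along the bracket flow\<close>

theorem corollary3p11:
  fixes A0 Ainf :: "real^'n^'n"
    and A :: "real \<Rightarrow> real^'n^'n"
    and G :: "real^'n^'n \<Rightarrow> ('m, real \<times> (real^'n)) lie_group"
    and g :: "real^'n^'n \<Rightarrow> ('m, real \<times> (real^'n)) metric"
  assumes "\<And>B. is_G\<^sub>\<mu> (mu B) (G B) (g B)"
    and "bracket_flow A0 A"
    and "(A \<longlongrightarrow> Ainf) at_top"
  shows "transpose Ainf = - Ainf \<and>
    (\<forall>t :: nat \<Rightarrow> real. (\<forall>k. 0 \<le> t k) \<and> filterlim t at_top sequentially \<longrightarrow>
       (\<exists>(r :: nat \<Rightarrow> nat) (M :: ('m, real \<times> (real^'n)) mfd) h p.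
          strict_mono r \<and> riemannian_manifold M h \<and>
          pointed_converges (\<lambda>k. lmfd (G (A (t (r k))))) (\<lambda>k. g (A (t (r k))))
            (\<lambda>k. \<one>\<^bsub>G (A (t (r k)))\<^esub>) M h p \<and>
          locally_isometric M h (lmfd (G Ainf)) (g Ainf))) \<and>
    flat (lmfd (G Ainf)) (g Ainf)"
proof -
  have skew: "transpose Ainf = - Ainf"
    by (rule bracket_flow_limit_skew[OF assms(2,3)])
  have "\<exists>F \<Phi>. metric_coordinates (lmfd (G B)) (g B) (model_metric B) F \<Phi> \<and> F 0 = \<one>\<^bsub>G B\<^esub>" for B
    by (rule is_G\<^sub>\<mu>_coordinates[OF assms(1)])
  then obtain F \<Phi> where mc: "\<And>B. metric_coordinates (lmfd (G B)) (g B) (model_metric B) (F B) (\<Phi> B)"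
    and F0: "\<And>B. F B 0 = \<one>\<^bsub>G B\<^esub>"
    by metis
  have mfd: "smooth_manifold (lmfd (G B))" for B
    using assms(1)[of B] by (simp add: is_G\<^sub>\<mu>_def is_lie_group_def)
  let ?N = "lmfd (G Ainf)" and ?T = "topspace (mtop (lmfd (G Ainf)))"
  have conn: "connected_space (mtop ?N)"
    using assms(1)[of Ainf] path_connected_imp_connected_space
    by (auto simp: is_G\<^sub>\<mu>_def simply_connected_space_def)
  have flat: "flat ?N (g Ainf)"
    unfolding flat_def locally_isometric_def
    using euclidean_coordinates_isometry[OF mc mfd model_metric_skew[OF skew]] by blast
  define M where "M = one_chart ?N (\<Phi> Ainf)"
  define h :: "('m, real \<times> (real^'n)) metric" where "h = (\<lambda>c p. model_metric Ainf (\<Phi> Ainf p))"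
  have riem: "riemannian_manifold M h"
    unfolding M_def h_def
    by (intro one_chart_riemannian[OF mc mfd conn] bilinear_model_metric model_metric_commute
        model_metric_pos smooth_model_metric)
  note emb = one_chart_embedding[OF mc[of Ainf] mc mfd]
  have isom: "locally_isometric M h ?N (g Ainf)"
  proof -
    have "isometry_onto_open M h ?T ?N (g Ainf) (F Ainf \<circ> \<Phi> Ainf)"
      unfolding isometry_onto_open_def M_def h_def using emb by simp
    then show ?thesis unfolding locally_isometric_def by (auto simp: M_def)
  qed
  have conv: "pointed_converges (\<lambda>k. lmfd (G (A (t k)))) (\<lambda>k. g (A (t k))) (\<lambda>k. \<one>\<^bsub>G (A (t k))\<^esub>) M h \<one>\<^bsub>G Ainf\<^esub>"
    if t: "filterlim t at_top sequentially" for t :: "nat \<Rightarrow> real"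
    unfolding pointed_converges_def
  proof (intro conjI exI[of _ "\<lambda>k. ?T"] exI[of _ "\<lambda>k. F (A (t k)) \<circ> \<Phi> Ainf"] allI)
    have one: "\<one>\<^bsub>G Ainf\<^esub> \<in> ?T" using inverse_coordinates_in[OF mc, of Ainf 0] F0 by simp
    then show "\<one>\<^bsub>G Ainf\<^esub> \<in> topspace (mtop M)" by (simp add: M_def)
    show "exhausting (mtop M) (\<lambda>k. ?T)"
      by (auto simp: exhausting_def M_def dest: compactin_subset_topspace)
    fix k
    show "\<one>\<^bsub>G Ainf\<^esub> \<in> ?T" by (rule one)
    show "smooth_embedding M ?T (lmfd (G (A (t k)))) (F (A (t k)) \<circ> \<Phi> Ainf)"
      unfolding M_def by (rule emb(1))
    show "(F (A (t k)) \<circ> \<Phi> Ainf) \<one>\<^bsub>G Ainf\<^esub> = \<one>\<^bsub>G (A (t k))\<^esub>"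
      using coordinates_inverse(2)[OF mc, of Ainf 0] by (simp add: F0)
  next
    have At: "(\<lambda>k. A (t k)) \<longlonglongrightarrow> Ainf" by (rule filterlim_compose[OF assms(3) t])
    show "metrics_converge M (\<lambda>k. pullback (F (A (t k)) \<circ> \<Phi> Ainf) (lmfd (G (A (t k)))) (g (A (t k)))) h"
      unfolding metrics_converge_def
    proof (intro ballI allI impI)
      fix c K and v w :: "real \<times> (real^'n)" and vs
      assume "c \<in> atlas M" and K: "compact K \<and> K \<subseteq> snd c ` fst c"
      then have c: "c = (?T, \<Phi> Ainf)" by (simp add: M_def)
      have x: "chart_inv c x = F Ainf x" "\<Phi> Ainf (F Ainf x) = x" "F Ainf x \<in> ?T" for x
        using chart_inv_coordinates[OF mc] coordinates_inverse(2)[OF mc] inverse_coordinates_in[OF mc] by (simp_all add: c)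
      have "pullback (F B \<circ> \<Phi> Ainf) (lmfd (G B)) (g B) c (chart_inv c x) v w = model_metric B x v w" for B x
        unfolding c[symmetric] x(1) using emb(3)[OF x(3)[of x], of B v w] by (simp add: x(2) flip: c)
      moreover have "h c (chart_inv c x) v w = model_metric Ainf x v w" for x
        by (simp add: h_def x)
      ultimately show "uniform_limit K
          (\<lambda>k. dderivs vs (\<lambda>x. pullback (F (A (t k)) \<circ> \<Phi> Ainf) (lmfd (G (A (t k)))) (g (A (t k))) c (chart_inv c x) v w))
          (dderivs vs (\<lambda>x. h c (chart_inv c x) v w)) sequentially"
        using model_metric_uniform_limit[OF At, of K vs v w] K by simp
    qed
  qed
  show ?thesis
  proof (intro conjI allI impI skew flat)
    fix t :: "nat \<Rightarrow> real" assume "(\<forall>k. 0 \<le> t k) \<and> filterlim t at_top sequentially"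
    then show "\<exists>(r :: nat \<Rightarrow> nat) (M :: ('m, real \<times> (real^'n)) mfd) h p. strict_mono r \<and> riemannian_manifold M h \<and>
          pointed_converges (\<lambda>k. lmfd (G (A (t (r k))))) (\<lambda>k. g (A (t (r k))))
            (\<lambda>k. \<one>\<^bsub>G (A (t (r k)))\<^esub>) M h p \<and> locally_isometric M h ?N (g Ainf)"
      using conv[of t] riem isom
      by (intro exI[of _ "\<lambda>k. k"] exI[of _ M] exI[of _ h] exI[of _ "\<one>\<^bsub>G Ainf\<^esub>"]) (simp add: strict_mono_def)
  qed
qed

end
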